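(* If $f$ is any hyperbolic member of the exponential family ($z\mapsto\lambda e^z$, $\lambda\in\mathbb C\setminus\{0\}$) or of the sine family ($z\mapsto\sin(az+b)$, $a,b\in\mathbb C$, $a\ne0$), then the hyperbolic dimension $\mathrm{HD}(J_r(f))$ is strictly less than $\mathrm{HD}(J(f))$.
   Context: $J(f)$ denotes the Julia set of $f$ in $\mathbb C$, and $J_r(f)=\{z\in J(f):\liminf_{n\to\infty}|f^n(z)|<\infty\}$ is the radial Julia set. $\mathrm{HD}$ is Hausdorff dimension. $\mathrm{sing}(f^{-1})$ is the set of critical values and finite asymptotic values of $f$; for entire $f$ the post-critical set $\mathcal P_f$ is the closure in $\mathbb C$ of $\bigcup_{n\ge0}f^n(\mathrm{sing}(f^{-1}))$. $f$ is topologically hyperbolic if $\mathrm{dist}(J(f),\mathcal P_f)>0$; expanding if there are $c>0$, $\lambda_0>1$ with $|(f^n)'(z)|\ge c\lambda_0^n$ for all $n\geq 1$ and $z\in J(f)$; hyperbolic if both. *)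

theory Defs
  imports "HOL-Analysis.Analysis"
begin

section \<open>Hausdorff dimension\<close>

text \<open>The diameter of a set raised to the power s, with the conventions that the empty set has
  gauge 0 for every s and that \<open>0\<^sup>0 = 1\<close> (whereas \<open>0 powr 0 = 0\<close>), so that s = 0 gives
  counting measure.\<close>

definition hausdorff_gauge :: "real \<Rightarrow> 'a::metric_space set \<Rightarrow> ennreal" where
  "hausdorff_gauge s U =
     (if U = {} then 0 else if s = 0 then 1 else ennreal (diameter U powr s))"

text \<open>Boundedness is required explicitly because \<^const>\<open>diameter\<close> is 0 on unbounded sets.\<close>

definition hausdorff_content :: "real \<Rightarrow> real \<Rightarrow> 'a::metric_space set \<Rightarrow> ennreal" where
  "hausdorff_content s \<delta> A =
     (INF U \<in> {U :: nat \<Rightarrow> 'a set. A \<subseteq> (\<Union>i. U i) \<and> (\<forall>i. bounded (U i) \<and> diameter (U i) \<le> \<delta>)}.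
        \<Sum>i. hausdorff_gauge s (U i))"

definition hausdorff_measure :: "real \<Rightarrow> 'a::metric_space set \<Rightarrow> ennreal" where
  "hausdorff_measure s A = (SUP \<delta> \<in> {0<..}. hausdorff_content s \<delta> A)"

definition HD :: "'a::metric_space set \<Rightarrow> ereal" where
  "HD A = (INF s \<in> {s. 0 \<le> s \<and> hausdorff_measure s A = 0}. ereal s)"

section \<open>Julia sets of entire functions\<close>

text \<open>Normality with respect to the spherical metric.  On a connected open set, a limit of
  holomorphic functions that is locally uniform in the spherical metric is either holomorphic
  or constantly \<open>\<infinity>\<close>; these are the two alternatives below.\<close>

definition normal_family_on :: "complex set \<Rightarrow> (complex \<Rightarrow> complex) set \<Rightarrow> bool" where
  "normal_family_on U \<F> \<longleftrightarrow>
     (\<forall>s :: nat \<Rightarrow> complex \<Rightarrow> complex. range s \<subseteq> \<F> \<longrightarrow>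
        (\<exists>r :: nat \<Rightarrow> nat. strict_mono r \<and>
           ((\<exists>g. g holomorphic_on U \<and>
                (\<forall>K. compact K \<and> K \<subseteq> U \<longrightarrow> uniform_limit K (\<lambda>k. s (r k)) g sequentially)) \<or>
            (\<forall>K. compact K \<and> K \<subseteq> U \<longrightarrow>
                (\<forall>B. eventually (\<lambda>k. \<forall>z\<in>K. B < norm (s (r k) z)) sequentially)))))"

definition fatou_set :: "(complex \<Rightarrow> complex) \<Rightarrow> complex set" where
  "fatou_set f =
     {z. \<exists>U. open U \<and> connected U \<and> z \<in> U \<and> normal_family_on U (range (\<lambda>n. f ^^ n))}"

definition julia_set :: "(complex \<Rightarrow> complex) \<Rightarrow> complex set" where
  "julia_set f = - fatou_set f"

definition radial_julia_set :: "(complex \<Rightarrow> complex) \<Rightarrow> complex set" where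
  "radial_julia_set f =
     {z \<in> julia_set f. liminf (\<lambda>n. ereal (norm ((f ^^ n) z))) < \<infinity>}"

section \<open>Singular values and hyperbolicity\<close>

definition critical_values :: "(complex \<Rightarrow> complex) \<Rightarrow> complex set" where
  "critical_values f = f ` {c. deriv f c = 0}"

definition finite_asymptotic_values :: "(complex \<Rightarrow> complex) \<Rightarrow> complex set" where
  "finite_asymptotic_values f =
     {a. \<exists>\<gamma> :: real \<Rightarrow> complex. continuous_on {0..} \<gamma> \<and>
           filterlim \<gamma> at_infinity at_top \<and> ((\<lambda>t. f (\<gamma> t)) \<longlongrightarrow> a) at_top}"

definition sing_inv :: "(complex \<Rightarrow> complex) \<Rightarrow> complex set" where
  "sing_inv f = critical_values f \<union> finite_asymptotic_values f"

definition postcritical_set :: "(complex \<Rightarrow> complex) \<Rightarrow> complex set" where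
  "postcritical_set f = closure (\<Union>n. (f ^^ n) ` sing_inv f)"

text \<open>\<^const>\<open>setdist\<close> is 0 if one of the sets is empty, but for a transcendental entire function
  both the Julia set and the post-critical set are nonempty.\<close>

definition topologically_hyperbolic :: "(complex \<Rightarrow> complex) \<Rightarrow> bool" where
  "topologically_hyperbolic f \<longleftrightarrow> setdist (julia_set f) (postcritical_set f) > 0"

definition expanding :: "(complex \<Rightarrow> complex) \<Rightarrow> bool" where
  "expanding f \<longleftrightarrow>
     (\<exists>c l. c > 0 \<and> l > 1 \<and>
        (\<forall>n\<ge>1. \<forall>z\<in>julia_set f. norm (deriv (f ^^ n) z) \<ge> c * l ^ n))"

definition hyperbolic :: "(complex \<Rightarrow> complex) \<Rightarrow> bool" where
  "hyperbolic f \<longleftrightarrow> topologically_hyperbolic f \<and> expanding f"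

definition exponential_family :: "(complex \<Rightarrow> complex) set" where
  "exponential_family = {(\<lambda>z. l * exp z) | l. l \<noteq> 0}"

definition sine_family :: "(complex \<Rightarrow> complex) set" where
  "sine_family = {(\<lambda>z. sin (a * z + b)) | a b. a \<noteq> 0}"

end

theory Submission
  imports Defs "HOL-Complex_Analysis.Complex_Analysis" "HOL-Real_Asymp.Real_Asymp"
begin

text \<open>
  Both families consist of maps \<open>z \<mapsto> C (a z + b)\<close> with \<open>C = cos\<close> or \<open>C \<zeta> = exp (-\<i> \<zeta>)\<close>, and the
  proof shows \<open>HD (J\<^sub>r) < 2 \<le> HD J\<close>.

  Lower bound (McMullen). Far up in the upper half-plane the conjugate map \<open>G \<zeta> = a C \<zeta> + b\<close>
  sends a square of a fixed grid onto a set containing a fixed proportion of the \<open>L\<^sup>2\<close> grid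
  squares that its Lipschitz constant \<open>L\<close> allows, so points whose orbit stays in high squares
  carry positive \<open>t\<close>-dimensional content for all \<open>t < 2\<close>. They lie in the Julia set, because a
  holomorphic function with \<open>|f\<^sup>m| > 1\<close> on a disc has a logarithm with values in a half-plane,
  which bounds its derivative.

  Upper bound. Inverse branches of \<open>f\<^sup>n\<close> on discs of a fixed radius centred at the Julia set
  contract with bounded distortion. Let \<open>L\<^sub>s\<close> be the transfer operator with weights
  \<open>|f'|\<^sup>-\<^sup>s\<close>, the derivative being taken in the metric \<open>|dz| / (1 + |z|)\<close>. Near each Julia
  point there is a disc of Fatou points all of whose pullbacks are disjoint; comparing areas, the
  sums \<open>\<Sum>\<^sub>n L\<^sub>2\<^sup>n 1\<^sub>X\<close> are bounded for bounded \<open>X\<close>. As \<open>L\<^sub>2 1\<close> is at most \<open>1/2\<close> far out,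
  \<open>\<Phi> = \<Sum>\<^sub>n L\<^sub>2\<^sup>n 1\<close> is bounded, whence \<open>L\<^sub>2 \<Phi> \<le> \<rho> \<Phi>\<close> with \<open>\<rho> < 1\<close>. This inequality
  persists for some \<open>s < 2\<close>, and pullbacks of finitely many discs then show that the
  \<open>s\<close>-dimensional measure of \<open>J\<^sub>r\<close> vanishes.
\<close>

section \<open>Hausdorff content\<close>

text \<open>In both families the modulus of \<open>f'\<close> is a function of the value of
  \<open>f\<close>. So the infinitely many preimages of a Julia point all have the same Euclidean
  derivative, and with Euclidean weights the transfer operator would be infinite for every exponent.
  The metric contributes the factor \<open>(1 + |z|)^(-s)\<close> at a preimage \<open>z\<close>:
  the sum now converges for \<open>s > 1\<close> and becomes small when all preimages are far out,
  which makes up for the missing compactness of the Julia set. The same dependence on the value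
  alone yields bounded distortion, because the derivative of an inverse branch varies only as fast
  as an explicit function on the target. Exponent 2 is where areas of disjoint sets take the role of
  a conformal measure. Strictness comes from the summand 1 in \<open>\<Phi> = 1 + L \<Phi>\<close>,
  a definite fraction of the bounded function \<Phi>. It passes to exponents below 2 by
  interpolation with the exponent 3/2, at which the operator is still bounded. For the lower bound,
  a mass distribution on the orbits in high squares is replaced by an estimate for finite covers of
  each finite level, with a constant independent of the level.\<close>

lemma hausdorff_content_le:
  fixes U :: "'i \<Rightarrow> 'a::metric_space set"
  assumes I: "countable I" and sub: "A \<subseteq> (\<Union>i\<in>I. U i)"
    and U: "\<And>i. i \<in> I \<Longrightarrow> bounded (U i) \<and> diameter (U i) \<le> \<delta>" and "0 \<le> \<delta>"
  shows "hausdorff_content s \<delta> A \<le> (\<integral>\<^sup>+i. hausdorff_gauge s (U i) \<partial>count_space I)"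
proof -
  \<comment> \<open>Indices outside the range of the enumeration get the empty set, whose gauge is 0
    even for exponent 0. Its diameter 0 has to be admissible, hence
    \<open>0 \<le> \<delta>\<close>.\<close>
  define V where "V n = (if n \<in> to_nat_on I ` I then U (from_nat_into I n) else {})" for n
  have VI: "V (to_nat_on I i) = U i" if "i \<in> I" for i
    using that I by (auto simp: V_def)
  have cover: "A \<subseteq> (\<Union>n. V n)"
    using sub VI by blast
  have small: "bounded (V n) \<and> diameter (V n) \<le> \<delta>" for n
    using U I \<open>0 \<le> \<delta>\<close> by (auto simp: V_def)
  have "hausdorff_content s \<delta> A \<le> (\<Sum>n. hausdorff_gauge s (V n))"
    unfolding hausdorff_content_def using cover small by (intro INF_lower) auto
  also have "\<dots> = (\<integral>\<^sup>+n. hausdorff_gauge s (V n) \<partial>count_space UNIV)"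
    by (simp add: nn_integral_count_space_nat)
  also have "\<dots> = (\<integral>\<^sup>+n. hausdorff_gauge s (V n) \<partial>count_space (to_nat_on I ` I))"
    by (rule nn_integral_count_space_eq) (auto simp: V_def hausdorff_gauge_def)
  also have "\<dots> = (\<integral>\<^sup>+i. hausdorff_gauge s (V (to_nat_on I i)) \<partial>count_space I)"
    by (rule nn_integral_bij_count_space[symmetric])
       (use I in \<open>auto intro: inj_on_imp_bij_betw\<close>)
  also have "\<dots> = (\<integral>\<^sup>+i. hausdorff_gauge s (U i) \<partial>count_space I)"
    by (rule nn_integral_cong) (use VI in auto)
  finally show ?thesis .
qed

lemma hausdorff_content_mono:
  "A \<subseteq> B \<Longrightarrow> hausdorff_content s \<delta> A \<le> hausdorff_content s \<delta> B"
  unfolding hausdorff_content_def by (rule INF_superset_mono) auto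

lemma hausdorff_content_less:
  assumes "hausdorff_content s \<delta> A < \<eta>"
  obtains U :: "nat \<Rightarrow> 'a::metric_space set" where "A \<subseteq> (\<Union>i. U i)"
    "\<And>i. bounded (U i)" "\<And>i. diameter (U i) \<le> \<delta>" "(\<Sum>i. hausdorff_gauge s (U i)) < \<eta>"
  using assms unfolding hausdorff_content_def INF_less_iff by blast

lemma hausdorff_content_UN_null:
  fixes A :: "nat \<Rightarrow> 'a::metric_space set"
  assumes null: "\<And>k. hausdorff_content s \<delta> (A k) = 0" and "0 \<le> \<delta>"
  shows "hausdorff_content s \<delta> (\<Union>k. A k) = 0"
proof -
  have "hausdorff_content s \<delta> (\<Union>k. A k) \<le> 0 + ennreal \<epsilon>" if "\<epsilon> > 0" for \<epsilon> :: real
  proof -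
    have "\<exists>U. A k \<subseteq> (\<Union>i. U i) \<and> (\<forall>i::nat. bounded (U i) \<and> diameter (U i) \<le> \<delta>) \<and>
            (\<Sum>i. hausdorff_gauge s (U i)) < ennreal (\<epsilon> * (1/2) ^ Suc k)" for k
    proof -
      have "hausdorff_content s \<delta> (A k) < ennreal (\<epsilon> * (1/2) ^ Suc k)"
        using null[of k] that by (simp add: ennreal_less_zero_iff)
      then show ?thesis
        by (elim hausdorff_content_less) blast
    qed
    then obtain U where U: "\<And>k. A k \<subseteq> (\<Union>i. U k i)"
      "\<And>k i::nat. bounded (U k i)" "\<And>k i. diameter (U k i) \<le> \<delta>"
      "\<And>k. (\<Sum>i. hausdorff_gauge s (U k i)) < ennreal (\<epsilon> * (1/2) ^ Suc k)"
      by metis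
    have "hausdorff_content s \<delta> (\<Union>k. A k) \<le>
        (\<integral>\<^sup>+p. hausdorff_gauge s (case p of (k, i) \<Rightarrow> U k i) \<partial>count_space UNIV)"
    proof (rule hausdorff_content_le)
      show "(\<Union>k. A k) \<subseteq> (\<Union>p\<in>UNIV. case p of (k, i) \<Rightarrow> U k i)"
        using U(1) by fastforce
    qed (use U \<open>0 \<le> \<delta>\<close> in auto)
    also have "\<dots> = (\<integral>\<^sup>+k. (\<integral>\<^sup>+i. hausdorff_gauge s (U k i) \<partial>count_space UNIV) \<partial>count_space UNIV)"
      by (subst nn_integral_fst_count_space[symmetric]) simp
    also have "\<dots> = (\<Sum>k. \<Sum>i. hausdorff_gauge s (U k i))"
      by (simp add: nn_integral_count_space_nat)
    also have "\<dots> \<le> (\<Sum>k. ennreal (\<epsilon> * (1/2) ^ Suc k))"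
      by (intro suminf_le) (use U(4) in \<open>auto intro: less_imp_le\<close>)
    also have "\<dots> = ennreal (\<Sum>k. \<epsilon> * (1/2) ^ Suc k)"
      using sums_mult[OF power_half_series, of \<epsilon>] \<open>\<epsilon> > 0\<close>
      by (intro suminf_ennreal2) (auto simp: sums_iff)
    also have "(\<Sum>k. \<epsilon> * (1/2) ^ Suc k) = \<epsilon>"
      using sums_mult[OF power_half_series, of \<epsilon>] by (simp add: sums_iff)
    finally show ?thesis by simp
  qed
  then have "hausdorff_content s \<delta> (\<Union>k. A k) \<le> 0"
    by (rule ennreal_le_epsilon)
  then show ?thesis by simp
qed

lemma hausdorff_content_UN_countable_null:
  fixes A :: "'i \<Rightarrow> 'a::metric_space set"
  assumes "countable I" "\<And>i. i \<in> I \<Longrightarrow> hausdorff_content s \<delta> (A i) = 0" "0 \<le> \<delta>"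
  shows "hausdorff_content s \<delta> (\<Union>i\<in>I. A i) = 0"
proof (cases "I = {}")
  case True
  have "hausdorff_content s \<delta> ({} :: 'a set) \<le> (\<integral>\<^sup>+i. hausdorff_gauge s ({} :: 'a set) \<partial>count_space ({} :: nat set))"
    by (rule hausdorff_content_le) (use assms(3) in auto)
  then show ?thesis using True by simp
next
  case False
  have "(\<Union>i\<in>I. A i) = (\<Union>n. A (from_nat_into I n))"
    using range_from_nat_into[OF False assms(1)] by (metis image_image)
  then show ?thesis
    using hausdorff_content_UN_null[of s \<delta> "\<lambda>n. A (from_nat_into I n)"] assms from_nat_into[OF False] by simp
qed

lemma HD_le:
  assumes "0 \<le> s" "\<And>\<delta>. \<delta> > 0 \<Longrightarrow> hausdorff_content s \<delta> A = 0"
  shows "HD A \<le> ereal s"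
proof -
  have "hausdorff_measure s A = (SUP \<delta>\<in>{0 :: real<..}. 0)"
    unfolding hausdorff_measure_def by (rule SUP_cong[OF refl]) (simp add: assms(2))
  also have "\<dots> = (0 :: ennreal)" by (metis SUP_bot bot_ennreal)
  finally have "hausdorff_measure s A = 0" .
  then show ?thesis
    unfolding HD_def using assms(1) by (intro INF_lower) auto
qed

lemma hausdorff_content_exponent_mono:
  assumes "0 \<le> s" "s \<le> t" "\<delta> \<le> 1"
  shows "hausdorff_content t \<delta> A \<le> hausdorff_content s \<delta> A"
  unfolding hausdorff_content_def
proof (rule INF_mono)
  fix U :: "nat \<Rightarrow> 'a set"
  assume U: "U \<in> {U. A \<subseteq> (\<Union>i. U i) \<and> (\<forall>i. bounded (U i) \<and> diameter (U i) \<le> \<delta>)}"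
  have "hausdorff_gauge t (U i) \<le> hausdorff_gauge s (U i)" for i
  proof -
    have d: "0 \<le> diameter (U i)" "diameter (U i) \<le> 1"
      using U assms(3) by (auto intro: diameter_ge_0 order_trans)
    \<comment> \<open>This serves the case \<open>s = 0\<close>, in which the gauge of a nonempty
      set is 1 and not a value of \<open>powr\<close>.\<close>
    then have "diameter (U i) powr t \<le> 1"
      using assms by (cases "diameter (U i) = 0") (auto simp: powr_le1)
    moreover have "diameter (U i) powr t \<le> diameter (U i) powr s"
      using d assms powr_mono'[of s t "diameter (U i)"] by auto
    ultimately show ?thesis
      using assms by (auto simp: hausdorff_gauge_def intro: ennreal_leI)
  qed
  then show "\<exists>V\<in>{U. A \<subseteq> (\<Union>i. U i) \<and> (\<forall>i. bounded (U i) \<and> diameter (U i) \<le> \<delta>)}.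
      (\<Sum>i. hausdorff_gauge t (V i)) \<le> (\<Sum>i. hausdorff_gauge s (U i))"
    using U by (intro bexI[of _ U] suminf_le) auto
qed

text \<open>Compactness needs open covering sets. Each set of a countable cover is therefore
  thickened by a radius \<open>r i\<close> so small that the sum of powers grows by at most
  \<open>\<eta> / 2\<close>; \<open>0 < t\<close> makes this possible for sets of diameter
  0.\<close>

lemma compact_null_content_finite_cover:
  fixes K :: "'a::metric_space set"
  assumes K: "compact K" and null: "hausdorff_content t \<delta> K = 0" and "0 < t" "0 < \<eta>"
  obtains V :: "nat \<Rightarrow> 'a set" and I where "finite I" "K \<subseteq> (\<Union>i\<in>I. V i)"
    "\<And>i. bounded (V i)" "\<And>i. open (V i)" "(\<Sum>i\<in>I. diameter (V i) powr t) < \<eta>"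
proof -
  have "hausdorff_content t \<delta> K < ennreal (\<eta> / 2)"
    using null \<open>0 < \<eta>\<close> by simp
  then obtain U :: "nat \<Rightarrow> 'a set" where U: "K \<subseteq> (\<Union>i. U i)" "\<And>i. bounded (U i)"
    "(\<Sum>i. hausdorff_gauge t (U i)) < ennreal (\<eta> / 2)"
    by (elim hausdorff_content_less) blast
  define d where "d i = diameter (U i)" for i
  have d0: "0 \<le> d i" for i using U(2) diameter_ge_0 by (auto simp: d_def)
  have gauge: "hausdorff_gauge t (U i) = ennreal (d i powr t)" for i
    using \<open>0 < t\<close> by (auto simp: hausdorff_gauge_def d_def)
  have "\<exists>r>0. (d i + 2 * r) powr t \<le> d i powr t + \<eta> / 2 * (1/2) ^ Suc i" for i
  proof -
    have "((\<lambda>r. (d i + 2 * r) powr t) \<longlongrightarrow> (d i + 2 * 0) powr t) (at_right 0)"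
      using \<open>0 < t\<close> d0[of i]
      by (intro tendsto_powr2 tendsto_intros)
        (auto intro!: eventually_mono[OF eventually_at_right_less[of "0::real"]])
    then have "\<forall>\<^sub>F r in at_right 0. (d i + 2 * r) powr t < d i powr t + \<eta> / 2 * (1/2) ^ Suc i"
      by (rule order_tendstoD) (use \<open>0 < \<eta>\<close> in auto)
    with eventually_at_right_less[of "0::real"]
    have "\<forall>\<^sub>F r in at_right (0::real). 0 < r \<and> (d i + 2 * r) powr t < d i powr t + \<eta> / 2 * (1/2) ^ Suc i"
      by (rule eventually_conj)
    then show ?thesis
      by (metis (no_types, lifting) eventually_happens less_imp_le trivial_limit_at_right_real)
  qed
  then obtain r where r: "\<And>i. r i > 0"
    "\<And>i. (d i + 2 * r i) powr t \<le> d i powr t + \<eta> / 2 * (1/2) ^ Suc i" by metis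
  define V where "V i = (\<Union>y\<in>U i. ball y (r i))" for i
  have UV: "U i \<subseteq> V i" for i using r(1)[of i] by (auto simp: V_def)
  have dV: "dist x y \<le> d i + 2 * r i" if xy: "x \<in> V i" "y \<in> V i" for x y i
  proof -
    obtain x' y' where *: "x' \<in> U i" "y' \<in> U i" "dist x' x < r i" "dist y' y < r i"
      using xy by (auto simp: V_def)
    have "dist x' y' \<le> d i"
      unfolding d_def using diameter_bounded_bound[OF U(2) *(1,2)] .
    then show ?thesis
      using * dist_triangle[of x y x'] dist_triangle[of x' y y'] by (simp add: dist_commute)
  qed
  have bV: "bounded (V i)" for i
    unfolding bounded_any_center[of _ undefined]
  proof (cases "V i = {}")
    case False
    then obtain x where "x \<in> V i" by blast
    then have "bounded (V i)" using dV[of x i] by (auto simp: bounded_def)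
    then show "\<exists>e. \<forall>y\<in>V i. dist undefined y \<le> e" by (simp add: bounded_any_center[symmetric])
  qed simp
  have "diameter (V i) \<le> d i + 2 * r i" for i
  proof (cases "V i = {}")
    case True
    then show ?thesis using d0[of i] r(1)[of i] by simp
  next
    case False
    then show ?thesis using dV unfolding diameter_def by (auto intro!: cSUP_least)
  qed
  then have dVt: "diameter (V i) powr t \<le> d i powr t + \<eta> / 2 * (1/2) ^ Suc i" for i
    using r(2)[of i] powr_mono2[of t "diameter (V i)" "d i + 2 * r i"] diameter_ge_0[OF bV[of i]] \<open>0 < t\<close>
    by (meson less_imp_le order_trans)
  have oV: "open (V i)" for i by (auto simp: V_def)
  have "K \<subseteq> \<Union>(range V)" using U(1) UV by blast
  then obtain I where I: "finite I" "K \<subseteq> (\<Union>i\<in>I. V i)"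
    using compactE_image[OF K, of UNIV V] oV by metis
  have "ennreal (\<Sum>i\<in>I. d i powr t) = (\<Sum>i\<in>I. hausdorff_gauge t (U i))"
    by (simp add: gauge)
  also have "\<dots> \<le> (\<Sum>i. hausdorff_gauge t (U i))"
    by (rule sum_le_suminf) (use I in auto)
  also have "\<dots> < ennreal (\<eta> / 2)" by (rule U(3))
  finally have "(\<Sum>i\<in>I. d i powr t) < \<eta> / 2"
    by (subst (asm) ennreal_less_iff) (auto intro: sum_nonneg)
  moreover have "(\<Sum>i\<in>I. \<eta> / 2 * (1/2) ^ Suc i) \<le> \<eta> / 2"
  proof -
    have s: "(\<lambda>i. \<eta> / 2 * (1/2) ^ Suc i) sums (\<eta> / 2 * 1)"
      by (intro sums_mult power_half_series)
    then show ?thesis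
      using sum_le_suminf[OF _ I(1), where f = "\<lambda>i. \<eta> / 2 * (1/2) ^ Suc i"] \<open>0 < \<eta>\<close>
      by (simp add: sums_iff)
  qed
  ultimately have "(\<Sum>i\<in>I. diameter (V i) powr t) < \<eta>"
    using sum_mono[of I "\<lambda>i. diameter (V i) powr t" "\<lambda>i. d i powr t + \<eta> / 2 * (1/2) ^ Suc i"] dVt
    by (simp add: sum.distrib)
  then show ?thesis using that I bV oV by blast
qed

text \<open>Content at scale 1 bounds the measure from below and decreases as the exponent grows. A
  null exponent below \<open>r\<close> would make the content vanish at \<open>r\<close> too, so
  testing exponents close to \<open>a\<close> is enough.\<close>

lemma HD_ge:
  assumes "r < a" and pos: "\<And>t. r \<le> t \<Longrightarrow> t < a \<Longrightarrow> 0 < hausdorff_content t 1 A"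
  shows "ereal a \<le> HD A"
  unfolding HD_def
proof (rule INF_greatest)
  fix s assume "s \<in> {s. 0 \<le> s \<and> hausdorff_measure s A = 0}"
  then have s: "0 \<le> s" "hausdorff_measure s A = 0" by auto
  have "hausdorff_content s 1 A \<le> hausdorff_measure s A"
    unfolding hausdorff_measure_def by (rule SUP_upper) auto
  then have z: "hausdorff_content s 1 A = 0" using s by simp
  show "ereal a \<le> ereal s"
  proof (rule ccontr)
    assume "\<not> ereal a \<le> ereal s"
    then have "s < a" by simp
    show False
    proof -
      have "hausdorff_content (max s r) 1 A = 0"
        using z hausdorff_content_exponent_mono[of s "max s r" 1 A] s by auto
      then show False using pos[of "max s r"] assms(1) \<open>s < a\<close> by auto
    qed
  qed
qed

section \<open>Dimension of sets of orbits in a grid of squares\<close>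

text \<open>The side 7 exceeds the period \<open>2 * pi\<close> of the exponential and the cosine,
  so a single square sees all real parts modulo the period.\<close>

definition grid_square :: "int \<times> int \<Rightarrow> complex set" where
  "grid_square p = cbox (Complex (7 * of_int (fst p)) (7 * of_int (snd p)))
                        (Complex (7 * of_int (fst p) + 7) (7 * of_int (snd p) + 7))"

lemma mem_grid_square:
  "z \<in> grid_square p \<longleftrightarrow> 7 * of_int (fst p) \<le> Re z \<and> Re z \<le> 7 * of_int (fst p) + 7 \<and>
     7 * of_int (snd p) \<le> Im z \<and> Im z \<le> 7 * of_int (snd p) + 7"
  by (auto simp: grid_square_def in_cbox_complex_iff)

lemma compact_grid_square: "compact (grid_square p)"
  by (simp add: grid_square_def compact_cbox)

text \<open>The diagonal is 7 times the square root of 2, just below 10.\<close>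

lemma dist_grid_square_le:
  assumes "x \<in> grid_square p" "y \<in> grid_square p"
  shows "dist x y \<le> 10"
proof -
  have "\<bar>Re (x - y)\<bar> \<le> 7" "\<bar>Im (x - y)\<bar> \<le> 7"
    using assms by (auto simp: mem_grid_square)
  then have "(Re (x - y))\<^sup>2 + (Im (x - y))\<^sup>2 \<le> 7\<^sup>2 + 7\<^sup>2"
    by (intro add_mono) (metis abs_ge_zero power2_abs power_mono)+
  also have "\<dots> \<le> (10::real)\<^sup>2" by simp
  finally have "cmod (x - y) \<le> 10"
    unfolding cmod_def by (rule real_le_lsqrt[rotated 1]) auto
  then show ?thesis by (simp add: dist_norm)
qed

lemma card_int_interval_le:
  assumes "\<And>m::int. m \<in> S \<Longrightarrow> a \<le> of_int m \<and> of_int m \<le> (a + D :: real)" "0 \<le> D"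
  shows "finite S" "real (card S) \<le> D + 1"
proof -
  have sub: "S \<subseteq> {\<lceil>a\<rceil>..\<lfloor>a + D\<rfloor>}"
    using assms by (auto simp: le_floor_iff ceiling_le_iff)
  then show "finite S" by (rule finite_subset) simp
  have "real (card S) \<le> real (card {\<lceil>a\<rceil>..\<lfloor>a + D\<rfloor>})"
    using sub by (intro of_nat_mono card_mono) auto
  also have "\<dots> \<le> D + 1"
    using \<open>0 \<le> D\<close> by (simp add: nat_le_iff) linarith
  finally show "real (card S) \<le> D + 1" .
qed

lemma card_grid_squares_meeting:
  assumes "bounded V"
  shows "finite {p. grid_square p \<inter> V \<noteq> {}}"
    and "real (card {p. grid_square p \<inter> V \<noteq> {}}) \<le> 9 * (max 1 (diameter V))\<^sup>2"
proof -
  let ?S = "{p. grid_square p \<inter> V \<noteq> {}}"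
  define D where "D = diameter V"
  have "finite ?S \<and> real (card ?S) \<le> 9 * (max 1 D)\<^sup>2"
  proof (cases "V = {}")
    case False
    then obtain x where x: "x \<in> V" by blast
    have D: "0 \<le> D" unfolding D_def using assms by (rule diameter_ge_0)
    have *: "\<bar>Re y - Re x\<bar> \<le> D \<and> \<bar>Im y - Im x\<bar> \<le> D" if "y \<in> V" for y
    proof -
      have "cmod (y - x) \<le> D"
        using diameter_bounded_bound[OF assms that x] by (simp add: D_def dist_norm)
      then show ?thesis
        using abs_Re_le_cmod[of "y - x"] abs_Im_le_cmod[of "y - x"] by auto
    qed
    let ?M = "{m::int. \<exists>y\<in>V. 7 * of_int m \<le> Re y \<and> Re y \<le> 7 * of_int m + 7}"
    let ?N = "{m::int. \<exists>y\<in>V. 7 * of_int m \<le> Im y \<and> Im y \<le> 7 * of_int m + 7}"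
    have M: "(Re x - D) / 7 - 1 \<le> of_int m \<and> of_int m \<le> (Re x - D) / 7 - 1 + (2 * D / 7 + 1)"
      if m: "m \<in> ?M" for m
    proof -
      obtain y where "y \<in> V" "7 * of_int m \<le> Re y" "Re y \<le> 7 * of_int m + 7"
        using m by blast
      with *[of y] show ?thesis by (auto simp: field_simps)
    qed
    have N: "(Im x - D) / 7 - 1 \<le> of_int m \<and> of_int m \<le> (Im x - D) / 7 - 1 + (2 * D / 7 + 1)"
      if m: "m \<in> ?N" for m
    proof -
      obtain y where "y \<in> V" "7 * of_int m \<le> Im y" "Im y \<le> 7 * of_int m + 7"
        using m by blast
      with *[of y] show ?thesis by (auto simp: field_simps)
    qed
    have D': "0 \<le> 2 * D / 7 + 1" using D by simp
    note cM = card_int_interval_le[of ?M, OF M D'] and cN = card_int_interval_le[of ?N, OF N D']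
    have sub: "?S \<subseteq> ?M \<times> ?N" by (auto simp: mem_grid_square)
    have fin: "finite ?M" "finite ?N" using cM(1) cN(1) by simp_all
    have "real (card ?S) \<le> real (card (?M \<times> ?N))"
      using sub fin by (intro of_nat_mono card_mono) auto
    also have "\<dots> = real (card ?M) * real (card ?N)" by (simp add: card_cartesian_product)
    \<comment> \<open>Each coordinate allows at most \<open>2 * D / 7 + 2\<close> indices.\<close>
    also have "\<dots> \<le> (3 * max 1 D) * (3 * max 1 D)"
    proof (intro mult_mono)
      show "real (card ?M) \<le> 3 * max 1 D" using cM(2) D by linarith
      show "real (card ?N) \<le> 3 * max 1 D" using cN(2) D by linarith
    qed auto
    also have "\<dots> = 9 * (max 1 D)\<^sup>2" by (simp add: power2_eq_square)
    finally show ?thesis using finite_subset[OF sub finite_cartesian_product[OF fin]] by blast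
  qed simp
  then show "finite ?S" "real (card ?S) \<le> 9 * (max 1 (diameter V))\<^sup>2"
    by (auto simp: D_def)
qed

section \<open>Orbits that follow chains of covered squares\<close>

definition grid_children :: "(complex \<Rightarrow> complex) \<Rightarrow> (int \<times> int) set \<Rightarrow> int \<times> int \<Rightarrow> (int \<times> int) set" where
  "grid_children g G p = {p' \<in> G. grid_square p' \<subseteq> g ` grid_square p}"

text \<open>The stages of a Cantor construction inside \<open>p\<close>. A child is entirely covered
  by the image of its parent, so every point of a stage of the child has a preimage in the next
  stage of the parent.\<close>

primrec grid_level :: "(complex \<Rightarrow> complex) \<Rightarrow> (int \<times> int) set \<Rightarrow> nat \<Rightarrow> int \<times> int \<Rightarrow> complex set" where
  "grid_level g G 0 p = grid_square p"
| "grid_level g G (Suc n) p =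
     {z \<in> grid_square p. \<exists>p'\<in>grid_children g G p. g z \<in> grid_level g G n p'}"

lemma grid_level_subset: "grid_level g G n p \<subseteq> grid_square p"
  by (cases n) auto

lemma grid_level_decreasing: "grid_level g G (Suc n) p \<subseteq> grid_level g G n p"
proof (induction n arbitrary: p)
  case 0 then show ?case by auto
next
  case (Suc n)
  show ?case
  proof
    fix z assume "z \<in> grid_level g G (Suc (Suc n)) p"
    then obtain p' where "z \<in> grid_square p" "p' \<in> grid_children g G p" "g z \<in> grid_level g G (Suc n) p'"
      unfolding grid_level.simps(2)[of g G "Suc n"] by blast
    with Suc.IH[of p'] show "z \<in> grid_level g G (Suc n) p"
      unfolding grid_level.simps(2)[of g G n] by blast
  qed
qed

lemma finite_grid_children:
  assumes "continuous_on UNIV g"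
  shows "finite (grid_children g G p)"
proof -
  have c: "compact (g ` grid_square p)"
    by (rule compact_continuous_image[OF continuous_on_subset[OF assms] compact_grid_square]) auto
  have "grid_square p' \<noteq> {}" for p'
  proof -
    have "Complex (7 * of_int (fst p')) (7 * of_int (snd p')) \<in> grid_square p'"
      by (simp add: mem_grid_square)
    then show ?thesis by blast
  qed
  then have "grid_children g G p \<subseteq> {p'. grid_square p' \<inter> g ` grid_square p \<noteq> {}}"
    by (fastforce simp: grid_children_def)
  then show ?thesis
    using card_grid_squares_meeting(1)[OF compact_imp_bounded[OF c]] finite_subset by blast
qed

lemma compact_grid_level:
  assumes "continuous_on UNIV g"
  shows "compact (grid_level g G n p)"
proof (induction n arbitrary: p)
  case 0 then show ?case by (simp add: compact_grid_square)
next
  case (Suc n)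
  have "grid_level g G (Suc n) p =
      grid_square p \<inter> g -` (\<Union>p'\<in>grid_children g G p. grid_level g G n p')" by auto
  moreover have "closed (g -` (\<Union>p'\<in>grid_children g G p. grid_level g G n p'))"
    using Suc finite_grid_children[OF assms] assms
    by (intro closed_vimage closed_UN) (auto intro: compact_imp_closed simp: continuous_on_eq_continuous_at)
  ultimately show ?case
    using compact_grid_square by (metis compact_Int_closed)
qed

section \<open>Lower bounds for finite covers of the levels\<close>

lemma grid_square_cover_sum_ge:
  assumes "finite I" "grid_square p \<subseteq> (\<Union>i\<in>I. U i)" "\<And>i. i \<in> I \<Longrightarrow> U i \<subseteq> grid_square p"
  shows "10 \<le> (\<Sum>i\<in>I. (diameter (U i))\<^sup>2)"
proof -
  have bU: "bounded (U i)" if "i \<in> I" for i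
    using assms(3)[OF that] compact_grid_square bounded_subset compact_imp_bounded by blast
  \<comment> \<open>A set lies in the disc about any of its points whose radius is its diameter, and
    the area of that disc is at most 4 times the squared diameter. Comparison with the area 49 of
    the square gives 49/4, which exceeds 10.\<close>
  define V where "V i = (if U i = {} then {} else cball (SOME x. x \<in> U i) (diameter (U i)))" for i
  have UV: "U i \<subseteq> V i" if "i \<in> I" for i
  proof
    fix x assume x: "x \<in> U i"
    then have s: "(SOME x. x \<in> U i) \<in> U i" by (rule someI)
    show "x \<in> V i"
      using x diameter_bounded_bound[OF bU[OF that] s x] by (auto simp: V_def)
  qed
  have mV: "measure lebesgue (V i) \<le> 4 * (diameter (U i))\<^sup>2" if "i \<in> I" for i
  proof -
    have "0 \<le> diameter (U i)" using bU[OF that] by (rule diameter_ge_0)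
    moreover have "pi * (diameter (U i))\<^sup>2 \<le> 4 * (diameter (U i))\<^sup>2"
      using pi_less_4 by (intro mult_right_mono) auto
    ultimately show ?thesis
      by (auto simp: V_def content_cball DIM_complex unit_ball_vol_2)
  qed
  have lm: "V i \<in> lmeasurable" for i by (auto simp: V_def)
  have "49 = measure lebesgue (grid_square p)"
    by (simp add: grid_square_def content_cbox_if Basis_complex_def in_cbox_complex_iff box_ne_empty(1))
  also have "\<dots> \<le> measure lebesgue (\<Union>i\<in>I. V i)"
  proof (rule measure_mono_fmeasurable)
    show "grid_square p \<subseteq> (\<Union>i\<in>I. V i)" using assms(2) UV by blast
  qed (use assms(1) lm in \<open>auto simp: grid_square_def\<close>)
  also have "\<dots> \<le> (\<Sum>i\<in>I. measure lebesgue (V i))"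
    using assms(1) lm by (intro measure_UNION_le) auto
  also have "\<dots> \<le> (\<Sum>i\<in>I. 4 * (diameter (U i))\<^sup>2)"
    using mV by (rule sum_mono)
  finally show ?thesis by (simp add: sum_distrib_left[symmetric])
qed

lemma powr_le_of_le_10:
  fixes u s :: real
  assumes "0 \<le> u" "u \<le> 10" "1 \<le> s" "s \<le> 2"
  shows "u\<^sup>2 \<le> 10 * u powr s"
proof (cases "u = 0")
  case False
  then have "u\<^sup>2 = u powr (2 - s) * u powr s"
    using assms by (simp add: powr_add[symmetric])
  also have "u powr (2 - s) \<le> 10 powr (2 - s)"
    using assms by (intro powr_mono2) auto
  also have "\<dots> \<le> 10 powr 1" using assms by (intro powr_mono) auto
  finally show ?thesis using assms by (simp add: mult_right_mono)
qed (use assms in auto)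

text \<open>Induction on the level in place of a mass distribution: a cover of level
  \<open>Suc n\<close> of \<open>p\<close> is pushed forward by \<open>g\<close> to covers of level
  \<open>n\<close> of all children, and the bounds for the at least
  \<open>\<Delta> * (L p)\<^sup>2\<close> children are added up. Since the bound does not depend on
  \<open>n\<close>, it can be used for covers of the intersection of all levels.\<close>

lemma grid_level_cover_sum_ge:
  fixes s \<Delta> :: real and L :: "int \<times> int \<Rightarrow> real"
  assumes g: "continuous_on UNIV g" and s: "1 \<le> s" "s \<le> 2" and \<Delta>: "0 < \<Delta>" "\<Delta> \<le> 180"
    and L0: "\<And>p. p \<in> G \<Longrightarrow> 0 < L p"
    and lip: "\<And>p x y. p \<in> G \<Longrightarrow> x \<in> grid_square p \<Longrightarrow> y \<in> grid_square p \<Longrightarrow>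
        dist (g x) (g y) \<le> L p * dist x y"
    and many: "\<And>p. p \<in> G \<Longrightarrow> \<Delta> * (L p)\<^sup>2 \<le> real (card (grid_children g G p))"
    and big: "\<And>p. p \<in> G \<Longrightarrow> 18 * L p powr (s - 2) \<le> \<Delta>"
  shows "finite I \<Longrightarrow> p \<in> G \<Longrightarrow> grid_level g G n p \<subseteq> (\<Union>i\<in>I. U i) \<Longrightarrow>
    \<Delta> / 180 \<le> (\<Sum>i\<in>I. diameter (U i \<inter> grid_square p) powr s)"
proof (induction n arbitrary: p U)
  case 0
  let ?u = "\<lambda>i. diameter (U i \<inter> grid_square p)"
  have b: "bounded (U i \<inter> grid_square p)" for i
    using compact_grid_square by (meson bounded_Int compact_imp_bounded)
  have u: "0 \<le> ?u i" "?u i \<le> 10" for i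
    using b diameter_ge_0 by (auto intro!: diameter_le dist_grid_square_le simp: dist_norm[symmetric])
  \<comment> \<open>Together with \<open>powr_le_of_le_10\<close> this makes the sum of powers at
    least 1, and \<open>\<Delta> / 180 \<le> 1\<close>.\<close>
  have "10 \<le> (\<Sum>i\<in>I. (?u i)\<^sup>2)"
    by (rule grid_square_cover_sum_ge[of _ p]) (use 0 in auto)
  also have "\<dots> \<le> (\<Sum>i\<in>I. 10 * ?u i powr s)"
    using u s by (intro sum_mono powr_le_of_le_10) auto
  finally show ?case using \<Delta> by (simp add: sum_distrib_left[symmetric])
next
  case (Suc n)
  define \<kappa> where "\<kappa> = \<Delta> / 180"
  define u where "u i = diameter (U i \<inter> grid_square p)" for i
  define V where "V i = g ` (U i \<inter> grid_square p)" for i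
  define H where "H = grid_children g G p"
  define l where "l = L p"
  \<comment> \<open>A piece with image of size below 1 is charged its full power in each square that
    it meets. A larger piece may meet many squares, but in each of them the charge \<kappa> alone
    already gives the claim; this truncation keeps its total charge of order
    \<open>\<kappa> * l\<^sup>2 * (u i)\<^sup>2\<close>.\<close>
  define wt where "wt i = (if l * u i < 1 then (l * u i) powr s else \<kappa>)" for i
  have l0: "0 < l" and \<kappa>0: "0 < \<kappa>" using L0 Suc.prems \<Delta> by (auto simp: l_def \<kappa>_def)
  have b: "bounded (U i \<inter> grid_square p)" for i
    using compact_grid_square by (meson bounded_Int compact_imp_bounded)
  have u: "0 \<le> u i" "u i \<le> 10" for i
    using b diameter_ge_0 by (auto intro!: diameter_le dist_grid_square_le simp: u_def dist_norm[symmetric])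
  have wt0: "0 \<le> wt i" for i using \<kappa>0 by (auto simp: wt_def)
  have dV: "dist x y \<le> l * u i" if xy: "x \<in> V i" "y \<in> V i" for x y i
  proof -
    obtain x' y' where *: "x' \<in> U i \<inter> grid_square p" "y' \<in> U i \<inter> grid_square p" "x = g x'" "y = g y'"
      using xy by (auto simp: V_def)
    have "dist x y \<le> l * dist x' y'"
      using lip[OF Suc.prems(2)] * by (auto simp: l_def)
    also have "\<dots> \<le> l * u i"
      using diameter_bounded_bound[OF b *(1,2)] l0 by (intro mult_left_mono) (auto simp: u_def)
    finally show ?thesis .
  qed
  have bV: "bounded (V i)" for i
    using compact_continuous_image[OF continuous_on_subset[OF g] compact_grid_square]
    unfolding V_def by (meson Int_lower2 bounded_subset compact_imp_bounded image_mono subset_UNIV)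
  have diamV: "diameter (V i \<inter> W) \<le> l * u i" for i W
    using dV u[of i] l0 by (intro diameter_le) (auto simp: dist_norm[symmetric])
  have finH: "finite H" unfolding H_def by (rule finite_grid_children[OF g])
  let ?meets = "\<lambda>p' i. grid_square p' \<inter> V i \<noteq> {}"
  have key: "\<kappa> \<le> (\<Sum>i\<in>I. if ?meets p' i then wt i else 0)" if p': "p' \<in> H" for p'
  proof (cases "\<exists>i\<in>I. ?meets p' i \<and> \<not> l * u i < 1")
    case True
    then obtain i where i: "i \<in> I" "?meets p' i" "\<not> l * u i < 1" by blast
    have "\<kappa> = (if ?meets p' i then wt i else 0)" using i by (simp add: wt_def)
    also have "\<dots> \<le> (\<Sum>i\<in>I. if ?meets p' i then wt i else 0)"
      by (rule member_le_sum) (use i wt0 Suc.prems in auto)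
    finally show ?thesis .
  next
    case False
    have "p' \<in> G" and img: "grid_square p' \<subseteq> g ` grid_square p"
      using p' by (auto simp: H_def grid_children_def)
    have "grid_level g G n p' \<subseteq> (\<Union>i\<in>I. V i)"
    proof
      fix w assume w: "w \<in> grid_level g G n p'"
      then obtain z where z: "z \<in> grid_square p" "w = g z"
        using grid_level_subset img by blast
      then have "z \<in> grid_level g G (Suc n) p" using w p' by (auto simp: H_def)
      then obtain i where "i \<in> I" "z \<in> U i" using Suc.prems by blast
      then show "w \<in> (\<Union>i\<in>I. V i)" using z by (auto simp: V_def)
    qed
    from Suc.IH[OF Suc.prems(1) \<open>p' \<in> G\<close> this]
    have "\<kappa> \<le> (\<Sum>i\<in>I. diameter (V i \<inter> grid_square p') powr s)" by (simp add: \<kappa>_def)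
    also have "\<dots> \<le> (\<Sum>i\<in>I. if ?meets p' i then wt i else 0)"
    proof (rule sum_mono)
      fix i assume "i \<in> I"
      show "diameter (V i \<inter> grid_square p') powr s \<le> (if ?meets p' i then wt i else 0)"
      proof (cases "?meets p' i")
        case True
        then have "wt i = (l * u i) powr s" using False \<open>i \<in> I\<close> by (auto simp: wt_def)
        moreover have "0 \<le> diameter (V i \<inter> grid_square p')"
          using bV by (intro diameter_ge_0) (auto intro: bounded_Int)
        ultimately show ?thesis using True diamV[of i "grid_square p'"] s by (auto intro: powr_mono2)
      next
        case False
        then have "V i \<inter> grid_square p' = {}" by blast
        then show ?thesis using False by simp
      qed
    qed
    finally show ?thesis .
  qed
  have each: "(\<Sum>p'\<in>H. if ?meets p' i then wt i else 0) \<le> (9 * l powr s + 90 * \<kappa> * l\<^sup>2) * u i powr s" for i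
  proof -
    have "(\<Sum>p'\<in>H. if ?meets p' i then wt i else 0) = wt i * real (card {p' \<in> H. ?meets p' i})"
      using finH by (simp add: sum.If_cases Int_def mult.commute)
    also have "\<dots> \<le> wt i * (9 * (max 1 (diameter (V i)))\<^sup>2)"
    proof (intro mult_left_mono wt0)
      have "real (card {p' \<in> H. ?meets p' i}) \<le> real (card {p'. ?meets p' i})"
        using card_grid_squares_meeting(1)[OF bV] by (intro of_nat_mono card_mono) auto
      also have "\<dots> \<le> 9 * (max 1 (diameter (V i)))\<^sup>2"
        by (rule card_grid_squares_meeting(2)[OF bV])
      finally show "real (card {p' \<in> H. ?meets p' i}) \<le> 9 * (max 1 (diameter (V i)))\<^sup>2" .
    qed
    also have "\<dots> \<le> wt i * (9 * (max 1 (l * u i))\<^sup>2)"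
      using diamV[of i UNIV] wt0 by (intro mult_left_mono power_mono) auto
    also have "\<dots> \<le> 9 * (l powr s * u i powr s) + 90 * \<kappa> * l\<^sup>2 * u i powr s"
    proof (cases "l * u i < 1")
      case True
      then show ?thesis using l0 \<kappa>0 u(1)[of i] by (simp add: wt_def max_def powr_mult)
    next
      case False
      have "\<kappa> * (9 * (l * u i)\<^sup>2) = (9 * \<kappa> * l\<^sup>2) * (u i)\<^sup>2" by (simp add: power_mult_distrib)
      also have "\<dots> \<le> (9 * \<kappa> * l\<^sup>2) * (10 * u i powr s)"
        using powr_le_of_le_10[OF u s] \<kappa>0 by (intro mult_left_mono) auto
      finally have "\<kappa> * (9 * (l * u i)\<^sup>2) \<le> 90 * \<kappa> * l\<^sup>2 * u i powr s" by simp
      moreover have "0 \<le> 9 * (l powr s * u i powr s)" by simp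
      ultimately have "\<kappa> * (9 * (l * u i)\<^sup>2) \<le> 9 * (l powr s * u i powr s) + 90 * \<kappa> * l\<^sup>2 * u i powr s"
        by linarith
      then show ?thesis using False by (simp add: wt_def max_def)
    qed
    finally show ?thesis by (simp add: algebra_simps)
  qed
  have "\<kappa> * (\<Delta> * l\<^sup>2) \<le> \<kappa> * real (card H)"
    using many[OF Suc.prems(2)] \<kappa>0 by (intro mult_left_mono) (auto simp: H_def l_def)
  also have "\<dots> = (\<Sum>p'\<in>H. \<kappa>)" by simp
  also have "\<dots> \<le> (\<Sum>p'\<in>H. \<Sum>i\<in>I. if ?meets p' i then wt i else 0)"
    by (rule sum_mono) (rule key)
  also have "\<dots> = (\<Sum>i\<in>I. \<Sum>p'\<in>H. if ?meets p' i then wt i else 0)"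
    by (rule sum.swap)
  also have "\<dots> \<le> (\<Sum>i\<in>I. (9 * l powr s + 90 * \<kappa> * l\<^sup>2) * u i powr s)"
    by (rule sum_mono) (rule each)
  also have "\<dots> = (9 * l powr s + 90 * \<kappa> * l\<^sup>2) * (\<Sum>i\<in>I. u i powr s)"
    by (simp add: sum_distrib_left)
  finally have le: "\<kappa> * (\<Delta> * l\<^sup>2) \<le> (9 * l powr s + 90 * \<kappa> * l\<^sup>2) * (\<Sum>i\<in>I. u i powr s)" .
  \<comment> \<open>The coefficient \<open>90 * \<kappa>\<close> is half of \<Delta> by the choice
    of 180, and \<open>big\<close> bounds the contribution of the small pieces by the other
    half.\<close>
  have "9 * l powr s = l\<^sup>2 * (9 * l powr (s - 2))"
    using l0 by (simp add: powr_diff)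
  also have "\<dots> \<le> l\<^sup>2 * (\<Delta> / 2)"
    using big[OF Suc.prems(2)] by (intro mult_left_mono) (auto simp: l_def)
  finally have "9 * l powr s + 90 * \<kappa> * l\<^sup>2 \<le> \<Delta> * l\<^sup>2"
    by (simp add: \<kappa>_def mult.commute)
  then have "(9 * l powr s + 90 * \<kappa> * l\<^sup>2) * (\<Sum>i\<in>I. u i powr s) \<le> \<Delta> * l\<^sup>2 * (\<Sum>i\<in>I. u i powr s)"
    by (intro mult_right_mono sum_nonneg) auto
  with le have "(\<Delta> * l\<^sup>2) * \<kappa> \<le> (\<Delta> * l\<^sup>2) * (\<Sum>i\<in>I. u i powr s)" by (simp add: mult.commute)
  then show ?case
    using \<Delta> l0 by (simp add: \<kappa>_def u_def mult_le_cancel_left_pos)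
qed

section \<open>Julia sets\<close>

lemma normal_family_on_subset:
  assumes "normal_family_on U F" "V \<subseteq> U" "F' \<subseteq> F"
  shows "normal_family_on V F'"
  unfolding normal_family_on_def
proof (intro allI impI)
  fix s :: "nat \<Rightarrow> complex \<Rightarrow> complex" assume "range s \<subseteq> F'"
  then have "range s \<subseteq> F" using assms(3) by blast
  with assms(1) obtain r :: "nat \<Rightarrow> nat" where r: "strict_mono r"
    and *: "(\<exists>g. g holomorphic_on U \<and>
                (\<forall>K. compact K \<and> K \<subseteq> U \<longrightarrow> uniform_limit K (\<lambda>k. s (r k)) g sequentially)) \<or>
            (\<forall>K. compact K \<and> K \<subseteq> U \<longrightarrow>
                (\<forall>B. eventually (\<lambda>k. \<forall>z\<in>K. B < norm (s (r k) z)) sequentially))"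
    unfolding normal_family_on_def by meson
  show "\<exists>r :: nat \<Rightarrow> nat. strict_mono r \<and>
           ((\<exists>g. g holomorphic_on V \<and>
                (\<forall>K. compact K \<and> K \<subseteq> V \<longrightarrow> uniform_limit K (\<lambda>k. s (r k)) g sequentially)) \<or>
            (\<forall>K. compact K \<and> K \<subseteq> V \<longrightarrow>
                (\<forall>B. eventually (\<lambda>k. \<forall>z\<in>K. B < norm (s (r k) z)) sequentially)))"
    using *
  proof
    assume "\<exists>g. g holomorphic_on U \<and>
                (\<forall>K. compact K \<and> K \<subseteq> U \<longrightarrow> uniform_limit K (\<lambda>k. s (r k)) g sequentially)"
    then show ?thesis using r assms(2) by (meson holomorphic_on_subset subset_trans)
  next
    assume "\<forall>K. compact K \<and> K \<subseteq> U \<longrightarrow>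
                (\<forall>B. eventually (\<lambda>k. \<forall>z\<in>K. B < norm (s (r k) z)) sequentially)"
    then show ?thesis using r assms(2) by (meson subset_trans)
  qed
qed

lemma normal_family_on_compose:
  assumes N: "normal_family_on U F" and h: "h holomorphic_on V" "h ` V \<subseteq> U"
    and F': "\<And>f'. f' \<in> F' \<Longrightarrow> \<exists>f\<in>F. \<forall>z\<in>V. f' z = f (h z)"
  shows "normal_family_on V F'"
  unfolding normal_family_on_def
proof (intro allI impI)
  fix s :: "nat \<Rightarrow> complex \<Rightarrow> complex" assume s: "range s \<subseteq> F'"
  have "\<exists>f. f \<in> F \<and> (\<forall>z\<in>V. s k z = f (h z))" for k
    using F'[of "s k"] s by blast
  then obtain t where t: "\<And>k. t k \<in> F" "\<And>k z. z \<in> V \<Longrightarrow> s k z = t k (h z)"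
    by metis
  have "range t \<subseteq> F" using t by blast
  with N obtain r :: "nat \<Rightarrow> nat" where r: "strict_mono r"
    and *: "(\<exists>g. g holomorphic_on U \<and>
                (\<forall>K. compact K \<and> K \<subseteq> U \<longrightarrow> uniform_limit K (\<lambda>k. t (r k)) g sequentially)) \<or>
            (\<forall>K. compact K \<and> K \<subseteq> U \<longrightarrow>
                (\<forall>B. eventually (\<lambda>k. \<forall>z\<in>K. B < norm (t (r k) z)) sequentially))"
    unfolding normal_family_on_def by meson
  have hK: "compact (h ` K) \<and> h ` K \<subseteq> U" if "compact K" "K \<subseteq> V" for K
    using that h holomorphic_on_imp_continuous_on holomorphic_on_subset
    by (metis compact_continuous_image dual_order.trans image_mono)
  show "\<exists>r :: nat \<Rightarrow> nat. strict_mono r \<and>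
           ((\<exists>g. g holomorphic_on V \<and>
                (\<forall>K. compact K \<and> K \<subseteq> V \<longrightarrow> uniform_limit K (\<lambda>k. s (r k)) g sequentially)) \<or>
            (\<forall>K. compact K \<and> K \<subseteq> V \<longrightarrow>
                (\<forall>B. eventually (\<lambda>k. \<forall>z\<in>K. B < norm (s (r k) z)) sequentially)))"
    using *
  proof (elim disjE exE conjE)
    fix g assume g: "g holomorphic_on U"
      and lim: "\<forall>K. compact K \<and> K \<subseteq> U \<longrightarrow> uniform_limit K (\<lambda>k. t (r k)) g sequentially"
    have "(g \<circ> h) holomorphic_on V"
      using h g by (meson holomorphic_on_compose holomorphic_on_subset)
    moreover have "uniform_limit K (\<lambda>k. s (r k)) (g \<circ> h) sequentially" if K: "compact K" "K \<subseteq> V" for K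
    proof -
      have ul: "uniform_limit (h ` K) (\<lambda>k. t (r k)) g sequentially"
        using lim hK[OF K] by blast
      show ?thesis
      proof (rule uniform_limitI)
        fix e :: real assume "0 < e"
        with ul have "\<forall>\<^sub>F k in sequentially. \<forall>x\<in>h ` K. dist (t (r k) x) (g x) < e"
          by (rule uniform_limitD)
        then show "\<forall>\<^sub>F k in sequentially. \<forall>x\<in>K. dist (s (r k) x) ((g \<circ> h) x) < e"
        proof (rule eventually_mono, intro ballI)
          fix k x assume *: "\<forall>x\<in>h ` K. dist (t (r k) x) (g x) < e" and x: "x \<in> K"
          then have "x \<in> V" using K(2) by blast
          with * x show "dist (s (r k) x) ((g \<circ> h) x) < e" by (simp add: t(2))
        qed
      qed
    qed
    ultimately show ?thesis using r by blast
  next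
    assume inf: "\<forall>K. compact K \<and> K \<subseteq> U \<longrightarrow>
                (\<forall>B. eventually (\<lambda>k. \<forall>z\<in>K. B < norm (t (r k) z)) sequentially)"
    have "eventually (\<lambda>k. \<forall>z\<in>K. B < norm (s (r k) z)) sequentially" if K: "compact K" "K \<subseteq> V" for K B
    proof -
      have "eventually (\<lambda>k. \<forall>z\<in>h ` K. B < norm (t (r k) z)) sequentially"
        using inf hK[OF K] by blast
      then show ?thesis
        by (rule eventually_mono) (use t(2) K in auto)
    qed
    then show ?thesis using r by blast
  qed
qed

text \<open>A sequence that equals \<open>h\<close> infinitely often has a constant subsequence;
  otherwise a tail of it lies in \<open>F\<close>.\<close>

lemma normal_family_on_insert:
  assumes N: "normal_family_on U F" and h: "h holomorphic_on U"
  shows "normal_family_on U (insert h F)"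
  unfolding normal_family_on_def
proof (intro allI impI)
  fix s :: "nat \<Rightarrow> complex \<Rightarrow> complex" assume s: "range s \<subseteq> insert h F"
  show "\<exists>r :: nat \<Rightarrow> nat. strict_mono r \<and>
           ((\<exists>g. g holomorphic_on U \<and>
                (\<forall>K. compact K \<and> K \<subseteq> U \<longrightarrow> uniform_limit K (\<lambda>k. s (r k)) g sequentially)) \<or>
            (\<forall>K. compact K \<and> K \<subseteq> U \<longrightarrow>
                (\<forall>B. eventually (\<lambda>k. \<forall>z\<in>K. B < norm (s (r k) z)) sequentially)))"
  proof (cases "infinite {k. s k = h}")
    case True
    then have e: "strict_mono (enumerate {k. s k = h})" "\<And>k. s (enumerate {k. s k = h} k) = h"
      using strict_mono_enumerate[OF True] enumerate_in_set[OF True] by auto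
    show ?thesis
      using e h by (intro exI[of _ "enumerate {k. s k = h}"] conjI disjI1 exI[of _ h])
        (auto intro: uniform_limit_const)
  next
    case False
    then obtain k0 where k0: "\<And>k. s k = h \<Longrightarrow> k < k0"
      by (metis (mono_tags, lifting) bounded_nat_set_is_finite finite_nat_set_iff_bounded mem_Collect_eq)
    have "range (\<lambda>k. s (k + k0)) \<subseteq> F"
      using s k0 by (fastforce simp: image_subset_iff)
    with N obtain r :: "nat \<Rightarrow> nat" where r: "strict_mono r"
      and *: "(\<exists>g. g holomorphic_on U \<and>
                (\<forall>K. compact K \<and> K \<subseteq> U \<longrightarrow> uniform_limit K (\<lambda>k. s (r k + k0)) g sequentially)) \<or>
            (\<forall>K. compact K \<and> K \<subseteq> U \<longrightarrow>
                (\<forall>B. eventually (\<lambda>k. \<forall>z\<in>K. B < norm (s (r k + k0) z)) sequentially))"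
      unfolding normal_family_on_def by meson
    have "strict_mono (\<lambda>k. r k + k0)" using r by (simp add: strict_mono_def)
    then show ?thesis using * by (intro exI[of _ "\<lambda>k. r k + k0"]) blast
  qed
qed

lemma fatou_setI_ball:
  assumes "r > 0" "normal_family_on (ball z r) (range (\<lambda>n. f ^^ n))"
  shows "z \<in> fatou_set f"
  unfolding fatou_set_def
proof (intro CollectI exI conjI)
  show "open (ball z r)" "connected (ball z r)" "z \<in> ball z r"
    using assms(1) by simp_all
qed (rule assms(2))

lemma fatou_setD_ball:
  assumes "z \<in> fatou_set f"
  obtains r where "r > 0" "normal_family_on (ball z r) (range (\<lambda>n. f ^^ n))"
proof -
  obtain U where U: "open U" "z \<in> U" "normal_family_on U (range (\<lambda>n. f ^^ n))"
    using assms by (auto simp: fatou_set_def)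
  then obtain r where "r > 0" "ball z r \<subseteq> U" by (meson open_contains_ball)
  then show ?thesis using that normal_family_on_subset[OF U(3)] by blast
qed

lemma closed_julia_set: "closed (julia_set f)"
proof -
  have "open (fatou_set f)"
    unfolding open_subopen[of "fatou_set f"]
  proof
    fix z assume "z \<in> fatou_set f"
    then obtain U where "open U" "connected U" "z \<in> U" "normal_family_on U (range (\<lambda>n. f ^^ n))"
      by (auto simp: fatou_set_def)
    then show "\<exists>T. open T \<and> z \<in> T \<and> T \<subseteq> fatou_set f"
      by (intro exI[of _ U]) (auto simp: fatou_set_def)
  qed
  then show ?thesis by (simp add: julia_set_def closed_Compl)
qed

text \<open>Near \<open>z\<close> the iterates of positive order are the iterates near
  \<open>f z\<close> composed with \<open>f\<close>, which preserves normality. Only the identity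
  remains to be inserted.\<close>

lemma julia_set_image:
  assumes f: "f holomorphic_on UNIV" and z: "z \<in> julia_set f"
  shows "f z \<in> julia_set f"
proof (rule ccontr)
  assume "f z \<notin> julia_set f"
  then have "f z \<in> fatou_set f" by (simp add: julia_set_def)
  then obtain e where e: "e > 0" "normal_family_on (ball (f z) e) (range (\<lambda>n. f ^^ n))"
    by (rule fatou_setD_ball)
  have "continuous_on UNIV f" using f by (rule holomorphic_on_imp_continuous_on)
  then have "isCont f z" by (simp add: continuous_on_eq_continuous_at)
  then obtain d where d: "d > 0" "f ` ball z d \<subseteq> ball (f z) e"
    using e(1) unfolding continuous_at_ball by blast
  have fh: "f holomorphic_on ball z d" using f holomorphic_on_subset by blast
  have "normal_family_on (ball z d) (range (\<lambda>n. f ^^ Suc n))"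
    by (rule normal_family_on_compose[OF e(2) fh d(2)]) (auto simp: funpow_swap1)
  then have "normal_family_on (ball z d) (insert id (range (\<lambda>n. f ^^ Suc n)))"
    by (intro normal_family_on_insert) (auto simp: id_def)
  moreover have "range (\<lambda>n. f ^^ n) \<subseteq> insert id (range (\<lambda>n. f ^^ Suc n))"
  proof
    fix h assume "h \<in> range (\<lambda>n. f ^^ n)"
    then obtain n where "h = f ^^ n" by blast
    then show "h \<in> insert id (range (\<lambda>n. f ^^ Suc n))" by (cases n) auto
  qed
  ultimately have "normal_family_on (ball z d) (range (\<lambda>n. f ^^ n))"
    using normal_family_on_subset by blast
  with d(1) have "z \<in> fatou_set f" by (rule fatou_setI_ball)
  then show False using z by (simp add: julia_set_def)
qed

text \<open>Near \<open>f z\<close> every \<open>f ^^ n\<close> is \<open>f ^^ Suc n\<close>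
  composed with the inverse branch \<psi>, so normality at \<open>z\<close> would pass to
  \<open>f z\<close>.\<close>

lemma julia_set_preimage:
  assumes "f z \<in> julia_set f" "0 < e"
    and psi: "\<psi> holomorphic_on ball (f z) e" "\<psi> (f z) = z" "\<And>u. u \<in> ball (f z) e \<Longrightarrow> f (\<psi> u) = u"
  shows "z \<in> julia_set f"
proof (rule ccontr)
  assume "z \<notin> julia_set f"
  then have "z \<in> fatou_set f" by (simp add: julia_set_def)
  then obtain r where r: "r > 0" "normal_family_on (ball z r) (range (\<lambda>n. f ^^ n))"
    by (rule fatou_setD_ball)
  have "isCont \<psi> (f z)"
    using holomorphic_on_imp_continuous_on[OF psi(1)] \<open>0 < e\<close>
    by (simp add: continuous_on_eq_continuous_at)
  then obtain d where d: "d > 0" "\<psi> ` ball (f z) d \<subseteq> ball z r"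
    using r(1) psi(2) unfolding continuous_at_ball by force
  let ?d = "min d e"
  have "normal_family_on (ball (f z) ?d) (range (\<lambda>n. f ^^ n))"
  proof (rule normal_family_on_compose[OF r(2), of \<psi>])
    show "\<psi> holomorphic_on ball (f z) ?d"
      using psi(1) by (rule holomorphic_on_subset) auto
    show "\<psi> ` ball (f z) ?d \<subseteq> ball z r" using d(2) by auto
    fix f' assume "f' \<in> range (\<lambda>n. f ^^ n)"
    then obtain n where n: "f' = f ^^ n" by blast
    then have "\<forall>u\<in>ball (f z) ?d. f' u = (f ^^ Suc n) (\<psi> u)"
      using psi(3) by (auto simp: funpow_swap1)
    then show "\<exists>h\<in>range (\<lambda>n. f ^^ n). \<forall>u\<in>ball (f z) ?d. f' u = h (\<psi> u)"
      by blast
  qed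
  then have "f z \<in> fatou_set f"
    using d(1) \<open>0 < e\<close> fatou_setI_ball[of ?d "f z"] by simp
  then show False using assms(1) by (simp add: julia_set_def)
qed

section \<open>Empty interior, and a criterion by growth of derivatives\<close>

lemma holomorphic_on_funpow:
  assumes "f holomorphic_on UNIV"
  shows "(f ^^ n) holomorphic_on UNIV"
proof (induction n)
  case (Suc n)
  have "f \<circ> f ^^ n holomorphic_on UNIV"
    using Suc assms by (intro holomorphic_on_compose) (auto intro: holomorphic_on_subset)
  then show ?case by (simp add: comp_def)
qed (simp add: id_def)

text \<open>The orbit of an open subset of the Julia set misses a disc around \<open>v\<close>, so the functions
  \<open>1 / (f\<^sup>n - v)\<close> are uniformly bounded on it, and Montel's theorem applies.\<close>

lemma interior_julia_set_empty:
  assumes f: "f holomorphic_on UNIV" and v: "e > 0" "ball v e \<inter> julia_set f = {}"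
  shows "interior (julia_set f) = {}"
proof (rule ccontr)
  assume "interior (julia_set f) \<noteq> {}"
  then obtain z0 r where z0: "r > 0" "ball z0 r \<subseteq> julia_set f"
    by (metis all_not_in_conv mem_interior)
  let ?B = "ball z0 r"
  have inJ: "(f ^^ n) z \<in> julia_set f" if "z \<in> ?B" for n z
    by (induction n) (use that z0 julia_set_image[OF f] in auto)
  have far: "e \<le> cmod ((f ^^ n) z - v)" if "z \<in> ?B" for n z
    using inJ[OF that, of n] v(2) by (force simp: dist_norm norm_minus_commute)
  define k where "k n z = 1 / ((f ^^ n) z - v)" for n z
  have nz: "(f ^^ n) z - v \<noteq> 0" if "z \<in> ?B" for n z using far[OF that, of n] v(1) by auto
  have holf: "(f ^^ n) holomorphic_on ?B" for n
    using holomorphic_on_funpow[OF f] holomorphic_on_subset by blast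
  have kh: "k n holomorphic_on ?B" for n
    unfolding k_def using nz holf by (intro holomorphic_intros) auto
  have kb: "cmod (k n z) \<le> 1 / e" if "z \<in> ?B" for n z
    unfolding k_def norm_divide using far[OF that, of n] v(1) by (auto intro!: frac_le)
  have k0: "k n z \<noteq> 0" if "z \<in> ?B" for n z using nz[OF that] by (auto simp: k_def)
  have fk: "(f ^^ n) z = v + 1 / k n z" if "z \<in> ?B" for n z
    using nz[OF that, of n] by (simp add: k_def)
  have "normal_family_on ?B (range (\<lambda>n. f ^^ n))"
    unfolding normal_family_on_def
  proof (intro allI impI)
    fix s :: "nat \<Rightarrow> complex \<Rightarrow> complex" assume "range s \<subseteq> range (\<lambda>n. f ^^ n)"
    then have "\<exists>n. s j = f ^^ n" for j by blast
    then obtain m where m: "\<And>j. s j = f ^^ m j" by metis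
    obtain g and \<rho> :: "nat \<Rightarrow> nat" where g: "g holomorphic_on ?B" and \<rho>: "strict_mono \<rho>"
      and lim: "\<And>K. compact K \<Longrightarrow> K \<subseteq> ?B \<Longrightarrow> uniform_limit K ((\<lambda>j. k (m j)) \<circ> \<rho>) g sequentially"
    proof (rule Montel[of ?B "range k" "\<lambda>j. k (m j)"])
      show "\<exists>B. \<forall>h\<in>range k. \<forall>z\<in>K. cmod (h z) \<le> B" if "compact K" "K \<subseteq> ?B" for K
        using kb that by (intro exI[of _ "1/e"]) blast
    qed (use kh in auto)
    note lim = lim[unfolded comp_def]
    show "\<exists>r :: nat \<Rightarrow> nat. strict_mono r \<and>
           ((\<exists>g. g holomorphic_on ?B \<and>
                (\<forall>K. compact K \<and> K \<subseteq> ?B \<longrightarrow> uniform_limit K (\<lambda>k. s (r k)) g sequentially)) \<or>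
            (\<forall>K. compact K \<and> K \<subseteq> ?B \<longrightarrow>
                (\<forall>B. eventually (\<lambda>k. \<forall>z\<in>K. B < norm (s (r k) z)) sequentially)))"
    \<comment> \<open>By Hurwitz the limit of the zero-free functions \<open>k (m j)\<close> either
      vanishes identically, and the iterates tend to infinity, or has no zero, and they tend to
      \<open>v + 1 / g\<close>. These are the two alternatives of normality.\<close>
    proof (cases "\<exists>z\<in>?B. g z = 0")
      case True
      then obtain z1 where z1: "z1 \<in> ?B" "g z1 = 0" by blast
      have "g constant_on ?B"
      proof (rule ccontr)
        assume "\<not> g constant_on ?B"
        then have "g z1 \<noteq> 0"
          by (rule Hurwitz_no_zeros[OF open_ball connected_ball kh g lim _ k0 z1(1), rotated 2])
        then show False using z1 by simp
      qed
      then have g0: "g z = 0" if "z \<in> ?B" for z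
        using z1 that by (auto simp: constant_on_def)
      have "\<forall>\<^sub>F j in sequentially. \<forall>z\<in>K. B < norm (s (\<rho> j) z)" if K: "compact K" "K \<subseteq> ?B" for K B
      proof -
        define b where "b = \<bar>B\<bar> + cmod v + 1"
        have b: "b > 0" unfolding b_def using norm_ge_zero[of v] by linarith
        have "\<forall>\<^sub>F j in sequentially. \<forall>z\<in>K. dist (k (m (\<rho> j)) z) (g z) < 1 / b"
          using lim[OF K] b unfolding uniform_limit_iff by auto
        then show ?thesis
        proof (rule eventually_mono, intro ballI)
          fix j z assume *: "\<forall>z\<in>K. dist (k (m (\<rho> j)) z) (g z) < 1 / b" and z: "z \<in> K"
          have zB: "z \<in> ?B" using z K by blast
          have "cmod (k (m (\<rho> j)) z) < 1 / b" using * z g0[OF zB] by auto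
          then have "1 / cmod ((f ^^ m (\<rho> j)) z - v) < 1 / b" by (simp add: k_def norm_divide)
          then have "b < cmod ((f ^^ m (\<rho> j)) z - v)"
            using b nz[OF zB, of "m (\<rho> j)"] by (simp add: field_simps)
          also have "\<dots> \<le> cmod ((f ^^ m (\<rho> j)) z) + cmod v" by (rule norm_triangle_ineq4)
          finally show "B < cmod (s (\<rho> j) z)" by (simp add: m b_def)
        qed
      qed
      then show ?thesis using \<rho> by blast
    next
      case False
      have "uniform_limit K (\<lambda>j. s (\<rho> j)) (\<lambda>z. v + 1 / g z) sequentially"
        if K: "compact K" "K \<subseteq> ?B" for K
      proof -
        have cg: "continuous_on K g"
          using g K holomorphic_on_imp_continuous_on holomorphic_on_subset by blast
        have "\<exists>b>0. \<forall>z\<in>K. b \<le> cmod (g z)"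
        proof (cases "K = {}")
          case False
          then obtain x where "x \<in> K" "\<And>y. y \<in> K \<Longrightarrow> cmod (g x) \<le> cmod (g y)"
            using continuous_attains_inf[OF K(1), of "\<lambda>z. cmod (g z)"] cg continuous_on_norm by blast
          then show ?thesis using \<open>\<not> (\<exists>z\<in>?B. g z = 0)\<close> K by (intro exI[of _ "cmod (g x)"]) auto
        qed (auto intro: exI[of _ 1])
        then obtain b where b: "b > 0" "\<And>z. z \<in> K \<Longrightarrow> b \<le> cmod (g z)" by blast
        have "uniform_limit K (\<lambda>j z. v + 1 / k (m (\<rho> j)) z) (\<lambda>z. v + 1 / g z) sequentially"
          using lim[OF K] b
          by (intro uniform_limit_intros uniform_lim_divide[where b = b])
             (auto intro: bounded_subset[OF bounded_cball[of 0 1]] uniform_limit_const)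
        moreover have "\<forall>\<^sub>F j in sequentially. \<forall>z\<in>K. v + 1 / k (m (\<rho> j)) z = s (\<rho> j) z"
          using fk K(2) by (intro always_eventually allI ballI) (metis m subsetD)
        ultimately show ?thesis
          using uniform_limit_cong by fastforce
      qed
      moreover have "(\<lambda>z. v + 1 / g z) holomorphic_on ?B"
        using g False by (intro holomorphic_intros) auto
      ultimately show ?thesis using \<rho> by blast
    qed
  qed
  then have "z0 \<in> fatou_set f" using z0(1) fatou_setI_ball by blast
  moreover have "z0 \<in> julia_set f" using z0 by auto
  ultimately show False by (simp add: julia_set_def)
qed

text \<open>This is the Schwarz-Pick inequality for a logarithm \<open>p\<close> of \<open>G\<close>
  with values in the right half-plane, with a factor 2 lost by using Cauchy's inequality on half the
  radius. The Cayley map centred at \<open>p z\<close> turns \<open>p\<close> into a function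
  \<open>q\<close> bounded by 1, and the derivative of \<open>q\<close> at \<open>z\<close> is that
  of \<open>p\<close> divided by \<open>2 * Re (p z)\<close>.\<close>

lemma log_derivative_bound:
  assumes G: "G holomorphic_on ball z R" and R: "0 < R"
    and gt: "\<And>x. x \<in> ball z R \<Longrightarrow> 1 < norm (G x)"
  shows "norm (deriv G z) \<le> 4 * norm (G z) * ln (norm (G z)) / R"
proof -
  have nz: "G x \<noteq> 0" if "x \<in> ball z R" for x using gt[OF that] by auto
  obtain p where p: "p holomorphic_on ball z R" "\<And>x. x \<in> ball z R \<Longrightarrow> G x = exp (p x)"
    using contractible_imp_holomorphic_log[OF G convex_imp_contractible[OF convex_ball] nz] by blast
  have z: "z \<in> ball z R" using R by simp
  have Rep: "Re (p x) = ln (norm (G x))" "0 < Re (p x)" if "x \<in> ball z R" for x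
    using p(2)[OF that] gt[OF that] by (auto simp: norm_exp_eq_Re)
  define a where "a = p z"
  have a: "0 < Re a" using Rep(2)[OF z] by (simp add: a_def)
  have den: "p x + cnj a \<noteq> 0" if "x \<in> ball z R" for x
    using Rep(2)[OF that] a by (auto simp: complex_eq_iff)
  define q where "q x = (p x - a) / (p x + cnj a)" for x
  have qh: "q holomorphic_on ball z R"
    unfolding q_def using p(1) den by (intro holomorphic_intros) auto
  have q1: "norm (q x) \<le> 1" if x: "x \<in> ball z R" for x
  proof -
    have "(Re (p x) - Re a)\<^sup>2 \<le> (Re (p x) + Re a)\<^sup>2"
      using Rep(2)[OF x] a by (simp add: power2_eq_square algebra_simps)
    then have "norm (p x - a) \<le> norm (p x + cnj a)"
      by (simp add: cmod_def)
    then show ?thesis using den[OF x] by (simp add: q_def norm_divide)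
  qed
  have "norm ((deriv ^^ 1) q z) \<le> fact 1 * 1 / (R / 2) ^ 1"
  proof (rule Cauchy_inequality)
    show "q holomorphic_on ball z (R / 2)"
      by (rule holomorphic_on_subset[OF qh subset_ball]) (use R in simp)
    have "q holomorphic_on cball z (R / 2)"
      using qh by (rule holomorphic_on_subset) (use R in auto)
    then show "continuous_on (cball z (R / 2)) q" by (rule holomorphic_on_imp_continuous_on)
    show "norm (q x) \<le> 1" if "norm (z - x) = R / 2" for x
      using that R by (intro q1) (simp add: dist_norm)
  qed (use R in auto)
  then have dq: "norm (deriv q z) \<le> 2 / R" by simp
  have dp: "(p has_field_derivative deriv p z) (at z)"
    using p(1) z by (rule holomorphic_derivI[OF _ open_ball])
  have "(q has_field_derivative (deriv p z * (a + cnj a) - (p z - a) * deriv p z) / ((a + cnj a) * (a + cnj a))) (at z)"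
    unfolding q_def using den[OF z] by (auto intro!: derivative_eq_intros dp simp: a_def)
  then have "deriv q z = deriv p z * (a + cnj a) / ((a + cnj a) * (a + cnj a))"
    by (simp add: DERIV_imp_deriv a_def)
  also have "\<dots> = deriv p z / (a + cnj a)"
    using den[OF z] by (simp add: a_def)
  finally have "deriv q z = deriv p z / (a + cnj a)" .
  moreover have "norm (a + cnj a) = 2 * Re a"
    using a unfolding complex_add_cnj norm_of_real by simp
  ultimately have dp2: "norm (deriv p z) \<le> 4 * Re a / R"
    using dq a R by (simp add: norm_divide field_simps)
  have "(G has_field_derivative exp (p z) * deriv p z) (at z)"
  proof (rule has_field_derivative_transform_within_open[OF _ open_ball z])
    show "((\<lambda>x. exp (p x)) has_field_derivative exp (p z) * deriv p z) (at z)"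
      by (auto intro!: derivative_eq_intros dp)
  qed (use p(2) in auto)
  then have "deriv G z = G z * deriv p z" using p(2)[OF z] by (simp add: DERIV_imp_deriv)
  then have "norm (deriv G z) \<le> norm (G z) * (4 * Re a / R)"
    using mult_left_mono[OF dp2 norm_ge_zero[of "G z"]] by (simp only: norm_mult)
  then show ?thesis using Rep(1)[OF z] by (simp add: a_def mult_ac)
qed

lemma deriv_funpow_Suc:
  assumes "f holomorphic_on UNIV"
  shows "deriv (f ^^ Suc n) z = deriv f ((f ^^ n) z) * deriv (f ^^ n) z"
proof -
  have "deriv (f \<circ> f ^^ n) z = deriv f ((f ^^ n) z) * deriv (f ^^ n) z"
    using assms holomorphic_on_funpow[OF assms, of n]
    by (intro deriv_chain) (auto intro: holomorphic_on_imp_differentiable_at[OF _ open_UNIV])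
  then show ?thesis by (simp add: comp_def)
qed

text \<open>If a subsequence of iterates converges, Cauchy's inequality bounds its derivatives at
  \<open>z\<close>. If it tends to infinity, \<open>log_derivative_bound\<close> leaves the
  unbounded factors \<open>norm (f x)\<close> and its logarithm. Two derivatives are then split off
  by the chain rule: by \<open>low\<close> the first cancels \<open>norm (f x)\<close>, and the
  second cancels \<open>norm x\<close>, which by \<open>up\<close> controls the logarithm. What
  remains bounds the derivative of the iterate of order \<open>\<rho> k - 2\<close>.\<close>

lemma julia_setI_deriv_at_top:
  assumes f: "f holomorphic_on UNIV" and \<alpha>: "0 < \<alpha>" and A: "0 < A"
    and low: "\<And>w. 2 \<le> norm (f w) \<Longrightarrow> \<alpha> * norm (f w) \<le> norm (deriv f w)"
    and up: "\<And>w. norm (f w) \<le> exp (A * (1 + norm w))"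
    and lim: "filterlim (\<lambda>n. norm (deriv (f ^^ n) z)) at_top sequentially"
  shows "z \<in> julia_set f"
proof (rule ccontr)
  assume "z \<notin> julia_set f"
  then have "z \<in> fatou_set f" by (simp add: julia_set_def)
  then obtain r where r: "r > 0" and N: "normal_family_on (ball z r) (range (\<lambda>n. f ^^ n))"
    by (rule fatou_setD_ball)
  obtain \<rho> :: "nat \<Rightarrow> nat" where \<rho>: "strict_mono \<rho>" and
    *: "(\<exists>g. g holomorphic_on ball z r \<and>
          (\<forall>K. compact K \<and> K \<subseteq> ball z r \<longrightarrow> uniform_limit K (\<lambda>k. f ^^ \<rho> k) g sequentially)) \<or>
        (\<forall>K. compact K \<and> K \<subseteq> ball z r \<longrightarrow>
          (\<forall>B. eventually (\<lambda>k. \<forall>x\<in>K. B < norm ((f ^^ \<rho> k) x)) sequentially))"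
    using N[unfolded normal_family_on_def, rule_format, of "\<lambda>n. f ^^ n"] by blast
  have sub: "cball z (r / 2) \<subseteq> ball z r" using r by auto
  have \<rho>lim: "filterlim \<rho> at_top sequentially" using \<rho> by (rule filterlim_subseq)
  show False using *
  proof (elim disjE exE conjE)
    fix g assume g: "g holomorphic_on ball z r"
      and ul: "\<forall>K. compact K \<and> K \<subseteq> ball z r \<longrightarrow> uniform_limit K (\<lambda>k. f ^^ \<rho> k) g sequentially"
    have "compact (g ` cball z (r / 2))"
      using g sub by (intro compact_continuous_image holomorphic_on_imp_continuous_on)
        (auto intro: holomorphic_on_subset)
    then obtain B where B: "\<And>x. x \<in> cball z (r / 2) \<Longrightarrow> norm (g x) \<le> B"
      by (meson bounded_iff compact_imp_bounded imageI)
    have "\<forall>\<^sub>F k in sequentially. \<forall>x\<in>cball z (r / 2). dist ((f ^^ \<rho> k) x) (g x) < 1"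
      using ul sub by (intro uniform_limitD) auto
    moreover have "\<forall>\<^sub>F k in sequentially. 2 * (B + 1) / r + 1 \<le> norm (deriv (f ^^ \<rho> k) z)"
      using filterlim_compose[OF lim \<rho>lim] unfolding filterlim_at_top by blast
    ultimately have "\<forall>\<^sub>F k in sequentially. (\<forall>x\<in>cball z (r / 2). dist ((f ^^ \<rho> k) x) (g x) < 1) \<and>
        2 * (B + 1) / r + 1 \<le> norm (deriv (f ^^ \<rho> k) z)" by (rule eventually_conj)
    then obtain k where k: "\<forall>x\<in>cball z (r / 2). dist ((f ^^ \<rho> k) x) (g x) < 1"
      "2 * (B + 1) / r + 1 \<le> norm (deriv (f ^^ \<rho> k) z)"
      using eventually_happens'[OF sequentially_bot] by blast
    have "norm ((deriv ^^ 1) (f ^^ \<rho> k) z) \<le> fact 1 * (B + 1) / (r / 2) ^ 1"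
    proof (rule Cauchy_inequality)
      show "f ^^ \<rho> k holomorphic_on ball z (r / 2)"
        using holomorphic_on_funpow[OF f] by (rule holomorphic_on_subset) auto
      show "continuous_on (cball z (r / 2)) (f ^^ \<rho> k)"
        using holomorphic_on_funpow[OF f] by (intro holomorphic_on_imp_continuous_on) (rule holomorphic_on_subset, auto)
      fix x assume "norm (z - x) = r / 2"
      then have x: "x \<in> cball z (r / 2)" by (simp add: dist_norm)
      have "norm ((f ^^ \<rho> k) x) \<le> norm (g x) + dist ((f ^^ \<rho> k) x) (g x)"
        unfolding dist_norm using norm_triangle_sub by blast
      then show "norm ((f ^^ \<rho> k) x) \<le> B + 1" using k(1) x B[OF x] by fastforce
    qed (use r in auto)
    then show False using k(2) r by (simp add: mult.commute)
  next
    assume inf: "\<forall>K. compact K \<and> K \<subseteq> ball z r \<longrightarrow>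
          (\<forall>B. eventually (\<lambda>k. \<forall>x\<in>K. B < norm ((f ^^ \<rho> k) x)) sequentially)"
    define R where "R = r / 2"
    have R: "0 < R" using r by (simp add: R_def)
    define C where "C = 6 * A / (\<alpha>\<^sup>2 * R)"
    \<comment> \<open>By \<open>up\<close>, a value above \<open>exp (3 * A)\<close> forces the
      preceding orbit point to have norm above 2, so that \<open>low\<close> applies to it as
      well.\<close>
    have "\<forall>\<^sub>F k in sequentially. \<forall>x\<in>cball z R. max 2 (exp (3 * A)) < norm ((f ^^ \<rho> k) x)"
      using inf[rule_format, of "cball z R" "max 2 (exp (3 * A))"] sub by (simp only: R_def compact_cball)
    moreover have "\<forall>\<^sub>F k in sequentially. \<rho> k \<ge> 2"
      using \<rho>lim by (simp add: filterlim_at_top)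
    moreover have "\<forall>\<^sub>F k in sequentially. C + 1 \<le> norm (deriv (f ^^ (\<rho> k - 2)) z)"
    proof -
      have "filterlim (\<lambda>k. \<rho> k - 2) at_top sequentially"
        using filterlim_compose[OF filterlim_minus_const_nat_at_top \<rho>lim] .
      from filterlim_compose[OF lim this] show ?thesis
        unfolding filterlim_at_top by blast
    qed
    ultimately have "\<forall>\<^sub>F k in sequentially. (\<forall>x\<in>cball z R. max 2 (exp (3 * A)) < norm ((f ^^ \<rho> k) x)) \<and> \<rho> k \<ge> 2 \<and>
       C + 1 \<le> norm (deriv (f ^^ (\<rho> k - 2)) z)" by (intro eventually_conj)
    then obtain k where k: "\<forall>x\<in>cball z R. max 2 (exp (3 * A)) < norm ((f ^^ \<rho> k) x)" "\<rho> k \<ge> 2"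
       "C + 1 \<le> norm (deriv (f ^^ (\<rho> k - 2)) z)"
      using eventually_happens'[OF sequentially_bot] by blast
    define m where "m = \<rho> k - 2"
    have m: "\<rho> k = Suc (Suc m)" using k(2) by (simp add: m_def)
    define x where "x = (f ^^ Suc m) z"
    have fx: "(f ^^ \<rho> k) z = f x" by (simp add: x_def m)
    have big: "max 2 (exp (3 * A)) < norm (f x)" using k(1)[rule_format, of z] R fx by simp
    then have "exp (3 * A) < exp (A * (1 + norm x))" using up[of x] by linarith
    then have x2: "2 < norm x" using A by simp
    have "2 \<le> norm (f x)" using big by simp
    have "norm (deriv (f ^^ \<rho> k) z) \<le> 4 * norm (f x) * ln (norm (f x)) / R"
      unfolding fx[symmetric]
    proof (rule log_derivative_bound[OF _ R])
      show "f ^^ \<rho> k holomorphic_on ball z R"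
        using holomorphic_on_funpow[OF f] by (rule holomorphic_on_subset) auto
      show "1 < norm ((f ^^ \<rho> k) y)" if "y \<in> ball z R" for y
        using k(1) that ball_subset_cball[of z R] by fastforce
    qed
    moreover have "deriv (f ^^ \<rho> k) z = deriv f x * deriv (f ^^ Suc m) z"
      unfolding m x_def by (rule deriv_funpow_Suc[OF f])
    ultimately have 1: "norm (deriv f x) * norm (deriv (f ^^ Suc m) z) \<le> 4 * norm (f x) * ln (norm (f x)) / R"
      by (simp only: norm_mult)
    have fpos: "0 < norm (f x)" using \<open>2 \<le> norm (f x)\<close> by linarith
    have lnx: "ln (norm (f x)) \<le> A * (1 + norm x)"
      using up[of x] fpos by (metis exp_gt_zero ln_exp ln_le_cancel_iff)
    have "\<alpha> * norm (f x) * norm (deriv (f ^^ Suc m) z) \<le> norm (deriv f x) * norm (deriv (f ^^ Suc m) z)"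
      using low[OF \<open>2 \<le> norm (f x)\<close>] by (intro mult_right_mono) auto
    also have "\<dots> \<le> 4 * norm (f x) * (A * (1 + norm x)) / R"
      using 1 lnx fpos R by (smt (verit) divide_right_mono mult_left_mono norm_ge_zero)
    finally have "norm (f x) * (\<alpha> * norm (deriv (f ^^ Suc m) z)) \<le> norm (f x) * (4 * (A * (1 + norm x)) / R)"
      by (simp add: mult_ac)
    then have 2: "\<alpha> * norm (deriv (f ^^ Suc m) z) \<le> 4 * (A * (1 + norm x)) / R"
      using fpos by (simp only: mult_le_cancel_left_pos)
    have xf: "x = f ((f ^^ m) z)" by (simp add: x_def)
    have "deriv (f ^^ Suc m) z = deriv f ((f ^^ m) z) * deriv (f ^^ m) z"
      by (rule deriv_funpow_Suc[OF f])
    moreover have "\<alpha> * norm x \<le> norm (deriv f ((f ^^ m) z))"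
      using low[of "(f ^^ m) z"] x2 by (simp add: xf)
    ultimately have "\<alpha> * norm x * norm (deriv (f ^^ m) z) \<le> norm (deriv (f ^^ Suc m) z)"
      by (simp add: norm_mult mult_right_mono)
    then have "\<alpha> * (\<alpha> * norm x * norm (deriv (f ^^ m) z)) \<le> 4 * (A * (1 + norm x)) / R"
      using 2 \<alpha> by (meson less_imp_le mult_left_mono order_trans)
    also have "\<dots> \<le> 4 * (A * (3 / 2 * norm x)) / R"
      using x2 A R by (intro divide_right_mono mult_left_mono) auto
    also have "\<dots> = norm x * (6 * A / R)" by simp
    finally have "norm x * (\<alpha>\<^sup>2 * norm (deriv (f ^^ m) z)) \<le> norm x * (6 * A / R)"
      by (simp add: power2_eq_square mult_ac)
    then have "\<alpha>\<^sup>2 * norm (deriv (f ^^ m) z) \<le> 6 * A / R"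
      using x2 by (subst (asm) mult_le_cancel_left_pos) auto
    then have "norm (deriv (f ^^ m) z) \<le> C"
      using \<alpha> R by (simp add: C_def field_simps)
    then show False using k(3) by (simp add: m_def)
  qed
qed

section \<open>Inverse branches near the Julia set\<close>

lemma holomorphic_on_near:
  assumes "h holomorphic_on S" "open S" "x \<in> S" "0 < r"
  obtains d where "0 < d" "\<And>v. dist v x < d \<Longrightarrow> dist (h v) (h x) < r"
proof -
  have "isCont h x"
    using holomorphic_on_imp_differentiable_at[OF assms(1-3)] field_differentiable_imp_continuous_at by blast
  then show ?thesis using \<open>0 < r\<close> that unfolding continuous_at_eps_delta by metis
qed

lemma deriv_right_inverse:
  assumes "g holomorphic_on UNIV" "\<phi> holomorphic_on ball w d" "\<And>x. x \<in> ball w d \<Longrightarrow> g (\<phi> x) = x"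
    and x: "x \<in> ball w d"
  shows "deriv g (\<phi> x) * deriv \<phi> x = 1"
proof -
  have 1: "(\<phi> has_field_derivative deriv \<phi> x) (at x)"
    using assms(2) x by (rule holomorphic_derivI[OF _ open_ball])
  have 2: "(g has_field_derivative deriv g (\<phi> x)) (at (\<phi> x))"
    using assms(1) by (rule holomorphic_derivI[OF _ open_UNIV]) auto
  have "((\<lambda>y. g (\<phi> y)) has_field_derivative deriv g (\<phi> x) * deriv \<phi> x) (at x)"
    using DERIV_chain2[OF 2 1] .
  moreover have "((\<lambda>y. g (\<phi> y)) has_field_derivative 1) (at x)"
  proof (rule has_field_derivative_transform_within_open[OF DERIV_ident open_ball x])
  qed (use assms(3) in auto)
  ultimately show ?thesis by (rule DERIV_unique)
qed

text \<open>Because the modulus of the derivative is \<open>q\<close> of the value, a local inverse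
  of \<open>f\<close> has derivative of modulus \<open>1 / q\<close>, whichever branch it is. The
  bounds on the variation of log \<open>q\<close> then give distortion estimates by the chain rule.
  \<open>c \<le> 1\<close> is what makes \<open>expand\<close> compatible with
  \<open>n = 0\<close>.\<close>

locale hyperbolic_branches =
  fixes f :: "complex \<Rightarrow> complex" and q :: "complex \<Rightarrow> real" and J :: "complex set" and c l e K :: real
  assumes holo: "f holomorphic_on UNIV"
    and J_closed: "closed J" and J_inv: "\<And>z. f z \<in> J \<longleftrightarrow> z \<in> J" and J_interior: "interior J = {}"
    and q_eq: "\<And>z. norm (deriv f z) = q (f z)"
    and q_pos: "\<And>w u. w \<in> J \<Longrightarrow> u \<in> ball w e \<Longrightarrow> 0 < q u"
    and q_lip: "\<And>w u. w \<in> J \<Longrightarrow> u \<in> ball w e \<Longrightarrow> q w \<le> q u * exp (K * dist w u)"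
    and q_lip': "\<And>w u. w \<in> J \<Longrightarrow> u \<in> ball w e \<Longrightarrow> q u \<le> q w * exp (K * dist w u)"
    and branch: "\<And>w u y. w \<in> J \<Longrightarrow> u \<in> ball w e \<Longrightarrow> f y = u \<Longrightarrow>
        \<exists>\<psi>. \<psi> holomorphic_on ball w e \<and> (\<forall>x\<in>ball w e. f (\<psi> x) = x) \<and> \<psi> u = y"
    and c_pos: "0 < c" "c \<le> 1" and l_gt_1: "1 < l" and e_pos: "0 < e" and K_pos: "0 < K"
    and expand: "\<And>z n. z \<in> J \<Longrightarrow> c * l ^ n \<le> norm (deriv (f ^^ n) z)"
begin

text \<open>The first bound keeps the pullbacks of discs of radius \<delta> inside discs of radius
  \<open>e\<close>, where branches exist; the second keeps their distortion at most 5/4.\<close>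

definition "\<delta> = min (c * e / 2) (ln (5/4) * c * (1 - 1 / l) / (2 * K))"

text \<open>Accumulated logarithmic distortion: a branch of order \<open>i\<close> maps the disc
  within \<open>2 * \<delta> / (c * l ^ i)\<close> of the image of its centre, and log
  \<open>q\<close> varies there by at most \<open>K\<close> times this.\<close>

definition "\<kappa> n = 2 * K * \<delta> / c * (\<Sum>i<n. (1 / l) ^ i)"

text \<open>The constant \<open>exp (\<kappa> n)\<close> is what an induction over \<open>n\<close>
  can carry; it is replaced by 5/4 afterwards.\<close>

definition inverse_branch :: "nat \<Rightarrow> complex \<Rightarrow> (complex \<Rightarrow> complex) \<Rightarrow> bool" where
  "inverse_branch n w \<phi> \<longleftrightarrow> \<phi> holomorphic_on ball w \<delta> \<and> (\<forall>x\<in>ball w \<delta>. (f ^^ n) (\<phi> x) = x) \<and>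
     (\<forall>x\<in>ball w \<delta>. norm (deriv \<phi> x) \<le> exp (\<kappa> n) * norm (deriv \<phi> w) \<and>
                   norm (deriv \<phi> w) \<le> exp (\<kappa> n) * norm (deriv \<phi> x))"

lemma l_pos: "0 < l" using l_gt_1 by simp

lemma \<delta>_pos: "0 < \<delta>"
  using c_pos e_pos l_gt_1 K_pos by (auto simp: \<delta>_def)

lemma \<delta>_le: "2 * \<delta> / c \<le> e"
  using c_pos by (simp add: \<delta>_def field_simps min_def)

text \<open>A geometric series. The value 5/4 is chosen so that its square, the distortion between
  two arbitrary points of the disc, stays below 2, as Bloch's lemma will require.\<close>

lemma \<kappa>_le: "exp (\<kappa> n) \<le> 5 / 4"
proof -
  have "(\<Sum>i<n. (1 / l) ^ i) \<le> 1 / (1 - 1 / l)"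
  proof -
    have s: "(\<lambda>i. (1 / l) ^ i) sums (1 / (1 - 1 / l))"
      using l_gt_1 by (intro geometric_sums) auto
    show ?thesis
      using sum_le_suminf[of "\<lambda>i. (1 / l) ^ i" "{..<n}"] s l_pos by (auto simp: sums_iff)
  qed
  then have "\<kappa> n \<le> 2 * K * \<delta> / c * (1 / (1 - 1 / l))"
    unfolding \<kappa>_def using \<delta>_pos K_pos c_pos by (intro mult_left_mono) auto
  also have "\<dots> \<le> 2 * K * (ln (5/4) * c * (1 - 1 / l) / (2 * K)) / c * (1 / (1 - 1 / l))"
    using K_pos c_pos l_gt_1 by (intro mult_right_mono divide_right_mono mult_left_mono) (auto simp: \<delta>_def)
  also have "\<dots> = ln (5/4)"
  proof -
    have "1 - 1 / l \<noteq> 0" using l_gt_1 by simp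
    then show ?thesis using K_pos c_pos by simp
  qed
  finally have "exp (\<kappa> n) \<le> exp (ln (5/4))" by (simp only: exp_le_cancel_iff)
  then show ?thesis by (simp only: exp_ln)
qed

lemma funpow_in_J: "(f ^^ n) z \<in> J \<longleftrightarrow> z \<in> J"
  by (induction n) (auto simp: J_inv)

lemma holo_funpow: "(f ^^ n) holomorphic_on S"
  using holomorphic_on_funpow[OF holo] holomorphic_on_subset by blast

lemma inverse_branchD:
  assumes "inverse_branch n w \<phi>" "w \<in> J"
  shows "\<phi> holomorphic_on ball w \<delta>"
    and "\<And>x. x \<in> ball w \<delta> \<Longrightarrow> (f ^^ n) (\<phi> x) = x"
    and "\<And>x. x \<in> ball w \<delta> \<Longrightarrow> norm (deriv (f ^^ n) (\<phi> x)) * norm (deriv \<phi> x) = 1"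
    and "\<phi> w \<in> J"
    and "\<And>x. x \<in> ball w \<delta> \<Longrightarrow> norm (deriv \<phi> x) \<le> 5 / 4 * norm (deriv \<phi> w)"
    and "\<And>x. x \<in> ball w \<delta> \<Longrightarrow> norm (deriv \<phi> w) \<le> 5 / 4 * norm (deriv \<phi> x)"
    and "norm (deriv \<phi> w) \<le> 1 / (c * l ^ n)"
proof -
  show h: "\<phi> holomorphic_on ball w \<delta>" and inv: "\<And>x. x \<in> ball w \<delta> \<Longrightarrow> (f ^^ n) (\<phi> x) = x"
    using assms(1) by (auto simp: inverse_branch_def)
  have w: "w \<in> ball w \<delta>" using \<delta>_pos by simp
  show d: "norm (deriv (f ^^ n) (\<phi> x)) * norm (deriv \<phi> x) = 1" if "x \<in> ball w \<delta>" for x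
    using deriv_right_inverse[OF holo_funpow h inv that] by (metis norm_mult norm_one)
  show J: "\<phi> w \<in> J" using inv[OF w] assms(2) funpow_in_J by metis
  show "norm (deriv \<phi> x) \<le> 5 / 4 * norm (deriv \<phi> w)" if x: "x \<in> ball w \<delta>" for x
  proof -
    have "norm (deriv \<phi> x) \<le> exp (\<kappa> n) * norm (deriv \<phi> w)"
      using assms(1) x by (auto simp: inverse_branch_def)
    also have "\<dots> \<le> 5 / 4 * norm (deriv \<phi> w)" using \<kappa>_le by (intro mult_right_mono) auto
    finally show ?thesis .
  qed
  show "norm (deriv \<phi> w) \<le> 5 / 4 * norm (deriv \<phi> x)" if x: "x \<in> ball w \<delta>" for x
  proof -
    have "norm (deriv \<phi> w) \<le> exp (\<kappa> n) * norm (deriv \<phi> x)"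
      using assms(1) x by (auto simp: inverse_branch_def)
    also have "\<dots> \<le> 5 / 4 * norm (deriv \<phi> x)" using \<kappa>_le by (intro mult_right_mono) auto
    finally show ?thesis .
  qed
  have p: "0 < c * l ^ n" using c_pos l_pos by simp
  have "c * l ^ n * norm (deriv \<phi> w) \<le> 1"
    using d[OF w] expand[OF J, of n] by (metis mult_right_mono norm_ge_zero)
  then show "norm (deriv \<phi> w) \<le> 1 / (c * l ^ n)"
    using p by (simp add: pos_le_divide_eq mult.commute)
qed

lemma inverse_branch_lipschitz:
  assumes "inverse_branch n w \<phi>" "w \<in> J" "x \<in> ball w \<delta>" "y \<in> ball w \<delta>"
  shows "dist (\<phi> x) (\<phi> y) \<le> 5 / 4 * norm (deriv \<phi> w) * dist x y"
  unfolding dist_norm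
proof (rule field_differentiable_bound[OF convex_ball])
  fix z assume z: "z \<in> ball w \<delta>"
  show "(\<phi> has_field_derivative deriv \<phi> z) (at z within ball w \<delta>)"
    by (rule has_field_derivative_at_within,
        rule holomorphic_derivI[OF inverse_branchD(1)[OF assms(1,2)] open_ball z])
  show "norm (deriv \<phi> z) \<le> 5 / 4 * norm (deriv \<phi> w)"
    by (rule inverse_branchD(5)[OF assms(1,2) z])
qed (use assms in auto)

lemma inverse_branch_dist_le:
  assumes "inverse_branch n w \<phi>" "w \<in> J" "x \<in> ball w \<delta>"
  shows "dist (\<phi> w) (\<phi> x) \<le> 2 * \<delta> / (c * l ^ n)"
proof -
  have p: "0 < c * l ^ n" using c_pos l_pos by simp
  have "dist (\<phi> w) (\<phi> x) \<le> 5 / 4 * norm (deriv \<phi> w) * dist w x"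
    using inverse_branch_lipschitz[OF assms(1,2) _ assms(3)] \<delta>_pos by simp
  also have "\<dots> \<le> 2 * (1 / (c * l ^ n)) * \<delta>"
    using inverse_branchD(7)[OF assms(1,2)] assms(3) p
    by (intro mult_mono) auto
  finally show ?thesis by simp
qed

lemma inverse_branch_image_subset:
  assumes "inverse_branch n w \<phi>" "w \<in> J" "x \<in> ball w \<delta>"
  shows "\<phi> x \<in> ball (\<phi> w) e"
proof -
  have "dist (\<phi> w) (\<phi> x) \<le> 5 / 4 * norm (deriv \<phi> w) * dist w x"
    using inverse_branch_lipschitz[OF assms(1,2) _ assms(3)] \<delta>_pos by simp
  also have "\<dots> \<le> 5 / 4 * (1 / (c * l ^ n)) * \<delta>"
    using inverse_branchD(7)[OF assms(1,2)] assms(3) c_pos l_pos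
    by (intro mult_mono mult_left_mono) auto
  also have "\<dots> \<le> 5 / 4 * (1 / c) * \<delta>"
  proof -
    have "c * 1 \<le> c * l ^ n" using c_pos l_gt_1 by (intro mult_left_mono one_le_power) auto
    then have "1 / (c * l ^ n) \<le> 1 / c" using c_pos by (intro divide_left_mono) auto
    then show ?thesis using \<delta>_pos by (intro mult_right_mono mult_left_mono) auto
  qed
  also have "\<dots> < 2 * \<delta> / c" using \<delta>_pos c_pos by (simp add: field_simps)
  also have "\<dots> \<le> e" by (rule \<delta>_le)
  finally show ?thesis by simp
qed

text \<open>A branch \<psi> of \<open>f\<close> through \<open>y\<close> is applied after the branch
  \<phi> of order \<open>n\<close> through \<open>f y\<close>. This is possible since \<phi> maps
  the disc into the ball of radius \<open>e\<close> about the Julia point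
  \<open>\<phi> w\<close>.\<close>

lemma inverse_branch_exists:
  assumes "w \<in> J" "u \<in> ball w \<delta>" "(f ^^ n) y = u"
  shows "\<exists>\<phi>. inverse_branch n w \<phi> \<and> \<phi> u = y"
  using assms(3)
proof (induction n arbitrary: y)
  case 0
  then show ?case using \<delta>_pos
    by (intro exI[of _ id]) (auto simp: inverse_branch_def id_def \<kappa>_def)
next
  case (Suc n)
  have "(f ^^ n) (f y) = u" using Suc.prems by (simp add: funpow_swap1)
  then obtain \<phi> where \<phi>: "inverse_branch n w \<phi>" "\<phi> u = f y" using Suc.IH by blast
  note D = inverse_branchD[OF \<phi>(1) assms(1)]
  note im = inverse_branch_image_subset[OF \<phi>(1) assms(1)]
  have w: "w \<in> ball w \<delta>" using \<delta>_pos by simp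
  have "f y \<in> ball (\<phi> w) e" using im[OF assms(2)] \<phi>(2) by simp
  then obtain \<psi> where \<psi>: "\<psi> holomorphic_on ball (\<phi> w) e" "\<And>x. x \<in> ball (\<phi> w) e \<Longrightarrow> f (\<psi> x) = x" "\<psi> (f y) = y"
    using branch[OF D(4) _ refl] by blast
  have norm\<psi>: "norm (deriv \<psi> v) = 1 / q v" if v: "v \<in> ball (\<phi> w) e" for v
  proof -
    have "norm (deriv f (\<psi> v)) * norm (deriv \<psi> v) = 1"
      using deriv_right_inverse[OF holo \<psi>(1,2) v] by (metis norm_mult norm_one)
    then have "q v * norm (deriv \<psi> v) = 1" using q_eq \<psi>(2)[OF v] by metis
    then show ?thesis using q_pos[OF D(4) v] by (simp add: field_simps)
  qed
  have chain: "norm (deriv (\<psi> \<circ> \<phi>) x) = norm (deriv \<phi> x) / q (\<phi> x)" if x: "x \<in> ball w \<delta>" for x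
  proof -
    have "deriv (\<psi> \<circ> \<phi>) x = deriv \<psi> (\<phi> x) * deriv \<phi> x"
      using D(1) \<psi>(1) x im[OF x]
      by (intro deriv_chain holomorphic_on_imp_differentiable_at[OF _ open_ball])
    then show ?thesis using norm\<psi>[OF im[OF x]] by (simp add: norm_mult)
  qed
  \<comment> \<open>The increment bounds the variation of log \<open>q\<close> on the image of
    \<phi>, which is the extra distortion caused by \<psi>.\<close>
  have \<kappa>Suc: "\<kappa> (Suc n) = \<kappa> n + K * (2 * \<delta> / (c * l ^ n))"
    by (simp add: \<kappa>_def power_divide distrib_left add_divide_distrib)
  have "inverse_branch (Suc n) w (\<psi> \<circ> \<phi>)"
    unfolding inverse_branch_def
  proof (intro conjI ballI)
    show "\<psi> \<circ> \<phi> holomorphic_on ball w \<delta>"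
      using D(1) \<psi>(1) im by (intro holomorphic_on_compose_gen) auto
    fix x assume x: "x \<in> ball w \<delta>"
    show "(f ^^ Suc n) ((\<psi> \<circ> \<phi>) x) = x"
      using \<psi>(2)[OF im[OF x]] D(2)[OF x] by (simp add: funpow_swap1)
    have 1: "norm (deriv \<phi> x) \<le> exp (\<kappa> n) * norm (deriv \<phi> w)" "norm (deriv \<phi> w) \<le> exp (\<kappa> n) * norm (deriv \<phi> x)"
      using \<phi>(1) x by (auto simp: inverse_branch_def)
    have k: "exp (K * dist (\<phi> w) (\<phi> x)) \<le> exp (K * (2 * \<delta> / (c * l ^ n)))"
      using inverse_branch_dist_le[OF \<phi>(1) assms(1) x] K_pos
      by (simp only: exp_le_cancel_iff mult_le_cancel_left_pos)
    have qp: "0 < q (\<phi> x)" "0 < q (\<phi> w)" using q_pos[OF D(4) im[OF x]] q_pos[OF D(4) im[OF w]] .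
    have 2: "q (\<phi> w) \<le> q (\<phi> x) * exp (K * (2 * \<delta> / (c * l ^ n)))"
      by (rule order_trans[OF q_lip[OF D(4) im[OF x]] mult_left_mono[OF k less_imp_le[OF qp(1)]]])
    have 3: "q (\<phi> x) \<le> q (\<phi> w) * exp (K * (2 * \<delta> / (c * l ^ n)))"
      by (rule order_trans[OF q_lip'[OF D(4) im[OF x]] mult_left_mono[OF k less_imp_le[OF qp(2)]]])
    have "norm (deriv \<phi> x) * q (\<phi> w) \<le> (exp (\<kappa> n) * norm (deriv \<phi> w)) * (q (\<phi> x) * exp (K * (2 * \<delta> / (c * l ^ n))))"
      by (rule mult_mono[OF 1(1) 2 _ less_imp_le[OF qp(2)]]) simp
    then show "norm (deriv (\<psi> \<circ> \<phi>) x) \<le> exp (\<kappa> (Suc n)) * norm (deriv (\<psi> \<circ> \<phi>) w)"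
      using qp by (simp add: chain[OF x] chain[OF w] \<kappa>Suc exp_add field_simps)
    have "norm (deriv \<phi> w) * q (\<phi> x) \<le> (exp (\<kappa> n) * norm (deriv \<phi> x)) * (q (\<phi> w) * exp (K * (2 * \<delta> / (c * l ^ n))))"
      by (rule mult_mono[OF 1(2) 3 _ less_imp_le[OF qp(1)]]) simp
    then show "norm (deriv (\<psi> \<circ> \<phi>) w) \<le> exp (\<kappa> (Suc n)) * norm (deriv (\<psi> \<circ> \<phi>) x)"
      using qp by (simp add: chain[OF x] chain[OF w] \<kappa>Suc exp_add field_simps)
  qed
  moreover have "(\<psi> \<circ> \<phi>) u = y" using \<phi>(2) \<psi>(3) by simp
  ultimately show ?case by blast
qed

text \<open>Applying \<open>f ^^ n\<close> to the common value gives \<open>x1 = x2\<close>. At that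
  value \<open>f ^^ n\<close> is locally injective, so both branches agree near \<open>x1\<close>,
  hence on the whole disc by analytic continuation.\<close>

lemma inverse_branch_unique:
  assumes b: "inverse_branch n w \<phi>1" "inverse_branch n w \<phi>2" and w: "w \<in> J"
    and x: "x1 \<in> ball w \<delta>" "x2 \<in> ball w \<delta>" and eq: "\<phi>1 x1 = \<phi>2 x2"
    and z: "z \<in> ball w \<delta>"
  shows "\<phi>1 z = \<phi>2 z"
proof -
  note D1 = inverse_branchD[OF b(1) w] and D2 = inverse_branchD[OF b(2) w]
  have xx: "x1 = x2" using D1(2)[OF x(1)] D2(2)[OF x(2)] eq by metis
  let ?y = "\<phi>1 x1"
  have "deriv (f ^^ n) ?y \<noteq> 0" using D1(3)[OF x(1)] by auto
  then obtain r where r: "r > 0" "inj_on (f ^^ n) (ball ?y r)"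
    using has_complex_derivative_locally_injective[OF holo_funpow[of n UNIV], of ?y] by auto
  obtain d1 where d1: "d1 > 0" "\<And>v. dist v x1 < d1 \<Longrightarrow> dist (\<phi>1 v) ?y < r"
    using holomorphic_on_near[OF D1(1) open_ball x(1) r(1)] by blast
  have y2: "\<phi>2 x1 = ?y" using eq xx by simp
  obtain d2 where d2: "d2 > 0" "\<And>v. dist v x1 < d2 \<Longrightarrow> dist (\<phi>2 v) ?y < r"
    using holomorphic_on_near[OF D2(1) open_ball x(1) r(1)] y2 by metis
  let ?V = "ball x1 (min d1 d2) \<inter> ball w \<delta>"
  have "\<phi>1 v = \<phi>2 v" if v: "v \<in> ?V" for v
  proof -
    have "(f ^^ n) (\<phi>1 v) = (f ^^ n) (\<phi>2 v)" using D1(2)[of v] D2(2)[of v] v by simp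
    moreover have "\<phi>1 v \<in> ball ?y r" "\<phi>2 v \<in> ball ?y r" using v d1(2)[of v] d2(2)[of v] by (auto simp: dist_commute)
    ultimately show ?thesis using r(2) by (meson inj_onD)
  qed
  moreover have "x1 \<in> ?V" using x(1) d1(1) d2(1) by simp
  ultimately show ?thesis
    using analytic_continuation_open[of ?V "ball w \<delta>" \<phi>1 \<phi>2 z] D1(1) D2(1) z by blast
qed

text \<open>For large \<open>p\<close>, a return to the disc about \<open>w\<close> would put the
  point close to the Julia point \<open>\<phi> w\<close>, whereas \<open>z0\<close> has positive
  distance from \<open>J\<close>. A periodic \<open>z0\<close> would return at arbitrarily large
  times, so \<open>z0\<close> is not periodic, and continuity settles the finitely many small
  \<open>p\<close>.\<close>

lemma nonrecurrent_ball:
  assumes w: "w \<in> J" and z0: "z0 \<in> ball w \<delta>" "z0 \<notin> J"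
  obtains \<rho> where "0 < \<rho>" "cball z0 \<rho> \<subseteq> ball w \<delta>"
    "\<And>p x. 0 < p \<Longrightarrow> x \<in> ball z0 \<rho> \<Longrightarrow> (f ^^ p) x \<notin> ball z0 \<rho>"
proof -
  obtain d where d: "d > 0" "ball z0 d \<inter> J = {}"
    using J_closed z0(2) open_contains_ball[of "- J"] by (auto simp: open_Compl) blast
  obtain a where a: "a > 0" "ball z0 a \<subseteq> ball w \<delta>"
    using z0(1) open_ball open_contains_ball by blast
  have "(\<lambda>p. 2 * \<delta> / c * (1 / l) ^ p) \<longlonglongrightarrow> 2 * \<delta> / c * 0"
    using l_gt_1 by (intro tendsto_intros LIMSEQ_power_zero) auto
  then have "\<forall>\<^sub>F p in sequentially. 2 * \<delta> / c * (1 / l) ^ p < d / 2"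
    using d(1) by (intro order_tendstoD) auto
  then obtain p0 where p0: "\<And>p. p \<ge> p0 \<Longrightarrow> 2 * \<delta> / c * (1 / l) ^ p < d / 2"
    unfolding eventually_sequentially by blast
  have large: "(f ^^ p) x \<notin> ball w \<delta>" if p: "p \<ge> p0" and x: "x \<in> ball z0 (d / 2)" for p x
  proof
    assume "(f ^^ p) x \<in> ball w \<delta>"
    then obtain \<phi> where \<phi>: "inverse_branch p w \<phi>" "\<phi> ((f ^^ p) x) = x"
      using inverse_branch_exists[OF w] by blast
    have "dist (\<phi> w) x \<le> 2 * \<delta> / (c * l ^ p)"
      using inverse_branch_dist_le[OF \<phi>(1) w \<open>(f ^^ p) x \<in> ball w \<delta>\<close>] \<phi>(2) by simp
    also have "\<dots> < d / 2" using p0[OF p] by (simp add: power_divide)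
    finally have "dist z0 (\<phi> w) < d"
      using x dist_triangle[of z0 "\<phi> w" x] by (simp add: dist_commute)
    then show False using d(2) inverse_branchD(4)[OF \<phi>(1) w] by auto
  qed
  have nper: "(f ^^ p) z0 \<noteq> z0" if "p > 0" for p
  proof
    assume "(f ^^ p) z0 = z0"
    then have "(f ^^ (p * k)) z0 = z0" for k
      by (induction k) (simp_all add: funpow_add)
    moreover have "p0 \<le> p * p0" using that by simp
    ultimately show False using large[of "p * p0" z0] d(1) z0(1) by auto
  qed
  have "\<exists>r>0. \<forall>x\<in>ball z0 r. (f ^^ p) x \<notin> ball z0 r" if "p > 0" for p
  proof -
    define b where "b = dist ((f ^^ p) z0) z0 / 2"
    have b: "b > 0" using nper[OF that] by (simp add: b_def)
    obtain r where r: "r > 0" "\<And>v. dist v z0 < r \<Longrightarrow> dist ((f ^^ p) v) ((f ^^ p) z0) < b"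
      using holomorphic_on_near[OF holo_funpow[of p UNIV] open_UNIV UNIV_I b] by blast
    have "(f ^^ p) x \<notin> ball z0 (min r b)" if "x \<in> ball z0 (min r b)" for x
    proof
      assume "(f ^^ p) x \<in> ball z0 (min r b)"
      then have "dist z0 ((f ^^ p) x) < b" by simp
      moreover have "dist ((f ^^ p) x) ((f ^^ p) z0) < b"
        using r(2)[of x] that by (simp add: dist_commute)
      ultimately show False
        using dist_triangle[of "(f ^^ p) z0" z0 "(f ^^ p) x"] by (simp add: b_def dist_commute)
    qed
    then show ?thesis using r(1) b by (intro exI[of _ "min r b"]) auto
  qed
  then obtain r where r: "\<And>p. p > 0 \<Longrightarrow> r p > 0" "\<And>p x. p > 0 \<Longrightarrow> x \<in> ball z0 (r p) \<Longrightarrow> (f ^^ p) x \<notin> ball z0 (r p)"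
    by metis
  define \<rho> where "\<rho> = Min (insert (d / 2) (insert (a / 2) (r ` {1..<p0})))"
  have fin: "finite (insert (d / 2) (insert (a / 2) (r ` {1..<p0})))" by simp
  have \<rho>: "\<rho> > 0" using d(1) a(1) r(1) by (auto simp: \<rho>_def)
  have \<rho>d: "\<rho> \<le> d / 2" and \<rho>a: "\<rho> \<le> a / 2"
    unfolding \<rho>_def by (rule Min_le[OF fin], simp)+
  have \<rho>r: "\<rho> \<le> r p" if "0 < p" "p < p0" for p
    unfolding \<rho>_def by (rule Min_le[OF fin]) (use that in auto)
  show ?thesis
  proof (rule that[of \<rho>])
    have "cball z0 \<rho> \<subseteq> ball z0 a" using a(1) \<rho>a by auto
    then show sub: "cball z0 \<rho> \<subseteq> ball w \<delta>" using a(2) by blast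
    show "(f ^^ p) x \<notin> ball z0 \<rho>" if p: "0 < p" and x: "x \<in> ball z0 \<rho>" for p x
    proof (cases "p < p0")
      case True
      have "x \<in> ball z0 (r p)" using x \<rho>r[OF p True] by simp
      then have "(f ^^ p) x \<notin> ball z0 (r p)" by (rule r(2)[OF p])
      then show ?thesis using \<rho>r[OF p True] by simp
    next
      case False
      then have "(f ^^ p) x \<notin> ball w \<delta>"
        using large[of p x] x \<rho>d by simp
      then show ?thesis using sub ball_subset_cball by blast
    qed
  qed (rule \<rho>)
qed

end

section \<open>Disjoint pullbacks and sums of squared contraction factors\<close>

lemma sum_disjoint_ball_areas_le:
  fixes x :: "'i \<Rightarrow> complex"
  assumes "finite F" "\<And>i. i \<in> F \<Longrightarrow> 0 \<le> r i"
    and disj: "disjoint_family_on (\<lambda>i. ball (x i) (r i)) F"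
    and sub: "\<And>i. i \<in> F \<Longrightarrow> ball (x i) (r i) \<subseteq> cball 0 R" and "0 \<le> R"
  shows "(\<Sum>i\<in>F. (r i)\<^sup>2) \<le> R\<^sup>2"
proof -
  have "(\<Sum>i\<in>F. pi * (r i)\<^sup>2) = (\<Sum>i\<in>F. measure lebesgue (ball (x i) (r i)))"
    using assms(2) by (intro sum.cong) (auto simp: content_ball unit_ball_vol_2)
  also have "\<dots> = measure lebesgue (\<Union>i\<in>F. ball (x i) (r i))"
  proof (rule measure_finite_Union[OF \<open>finite F\<close> _ disj, symmetric])
    show "emeasure lebesgue (ball (x i) (r i)) \<noteq> \<infinity>" for i
      using emeasure_bounded_finite[of "ball (x i) (r i)"] by (simp add: emeasure_completion)
  qed auto
  also have "\<dots> \<le> measure lebesgue (cball (0::complex) R)"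
  proof (rule measure_mono_fmeasurable)
    show "(\<Union>i\<in>F. ball (x i) (r i)) \<subseteq> cball 0 R" using sub by blast
    show "(\<Union>i\<in>F. ball (x i) (r i)) \<in> sets lebesgue" by (intro sets.finite_UN \<open>finite F\<close>) simp
  qed simp
  also have "\<dots> = pi * R\<^sup>2"
    using \<open>0 \<le> R\<close> by (simp add: content_cball unit_ball_vol_2)
  finally show ?thesis by (simp add: sum_distrib_left[symmetric])
qed

context hyperbolic_branches
begin

text \<open>Pullbacks of the nonrecurrent disc about \<open>z0\<close> are disjoint: for different
  orders because a common point would make an orbit return to the disc, for equal orders by
  \<open>inverse_branch_unique\<close>. By Bloch's lemma each contains a disc of radius comparable
  to the contraction factor at \<open>v\<close>, so the squared factors of all orders together are
  bounded by an area.\<close>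

lemma local_weight_bound:
  assumes w: "w \<in> J"
  shows "\<exists>C. \<forall>v F. v \<in> J \<inter> ball w \<delta> \<longrightarrow> finite F \<longrightarrow>
     F \<subseteq> {(n, y). (f ^^ n) y = v \<and> norm y \<le> R} \<longrightarrow>
     (\<Sum>(n, y)\<in>F. (1 / norm (deriv (f ^^ n) y))\<^sup>2) \<le> C"
proof -
  have "\<not> ball w \<delta> \<subseteq> J"
    using J_interior interior_maximal[of "ball w \<delta>" J] \<delta>_pos by (metis ball_eq_empty empty_subsetI
        linorder_not_less open_ball subset_antisym)
  then obtain z0 where z0: "z0 \<in> ball w \<delta>" "z0 \<notin> J" by blast
  obtain \<rho> where \<rho>: "0 < \<rho>" "cball z0 \<rho> \<subseteq> ball w \<delta>"
    "\<And>p x. 0 < p \<Longrightarrow> x \<in> ball z0 \<rho> \<Longrightarrow> (f ^^ p) x \<notin> ball z0 \<rho>"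
    using nonrecurrent_ball[OF w z0] by blast
  \<comment> \<open>The factor \<open>3 - 2 * sqrt 2\<close> is the constant of
    \<open>Bloch_lemma\<close>.\<close>
  define b where "b = (3 - 2 * sqrt 2) * \<rho>"
  have "sqrt 2 < 3 / (2::real)" by (rule real_less_lsqrt) (auto simp: power2_eq_square)
  then have "0 < 3 - 2 * sqrt (2::real)" by linarith
  then have b: "0 < b" unfolding b_def using \<rho>(1) by (rule mult_pos_pos)
  \<comment> \<open>A pullback stays within \<open>5 / 4 * (1 / c) * (2 * \<delta>)\<close>, below
    \<open>3 * \<delta> / c\<close>, of its preimage \<open>y\<close> of \<open>v\<close>.\<close>
  define R' where "R' = \<bar>R\<bar> + 3 * \<delta> / c"
  have R': "0 \<le> R'" using \<delta>_pos c_pos by (simp add: R'_def)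
  show ?thesis
  proof (intro exI[of _ "(2 / b * R')\<^sup>2"] allI impI)
    fix v F assume v: "v \<in> J \<inter> ball w \<delta>" and F: "finite F"
      "F \<subseteq> {(n, y). (f ^^ n) y = v \<and> norm y \<le> R}"
    have "\<exists>\<phi>. inverse_branch (fst p) w \<phi> \<and> \<phi> v = snd p" if "p \<in> F" for p
      using inverse_branch_exists[of w v "fst p" "snd p"] w v F(2) that by auto
    then obtain \<Phi> where \<Phi>: "\<And>p. p \<in> F \<Longrightarrow> inverse_branch (fst p) w (\<Phi> p)" "\<And>p. p \<in> F \<Longrightarrow> \<Phi> p v = snd p"
      by metis
    define d where "d p = 1 / norm (deriv (f ^^ fst p) (snd p))" for p
    note D = inverse_branchD[OF \<Phi>(1) w]
    have vb: "v \<in> ball w \<delta>" using v by simp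
    have dv: "norm (deriv (\<Phi> p) v) = d p" if p: "p \<in> F" for p
      using D(3)[OF p vb] unfolding d_def \<Phi>(2)[OF p]
      by (metis inverse_eq_divide inverse_unique)
    define B where "B p = ball (\<Phi> p z0) (b * d p / 2)" for p
    have sub: "B p \<subseteq> \<Phi> p ` ball z0 \<rho>" if p: "p \<in> F" for p
    proof -
      have z0b: "z0 \<in> ball w \<delta>" by (rule z0(1))
      have "ball (\<Phi> p z0) ((3 - 2 * sqrt 2) * \<rho> * norm (deriv (\<Phi> p) z0)) \<subseteq> \<Phi> p ` ball z0 \<rho>"
      proof (rule Bloch_lemma[OF _ \<rho>(1)])
        show "\<Phi> p holomorphic_on cball z0 \<rho>" using D(1)[OF p] \<rho>(2) holomorphic_on_subset by blast
        fix z assume "z \<in> ball z0 \<rho>"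
        then have z: "z \<in> ball w \<delta>" using \<rho>(2) ball_subset_cball by blast
        show "norm (deriv (\<Phi> p) z) \<le> 2 * norm (deriv (\<Phi> p) z0)"
          using D(5)[OF p z] D(6)[OF p z0b] norm_ge_zero[of "deriv (\<Phi> p) z0"] by linarith
      qed
      moreover have "b * d p / 2 \<le> (3 - 2 * sqrt 2) * \<rho> * norm (deriv (\<Phi> p) z0)"
      proof -
        have "d p / 2 \<le> norm (deriv (\<Phi> p) z0)"
          using dv[OF p] D(5)[OF p vb] D(6)[OF p z0b] norm_ge_zero[of "deriv (\<Phi> p) z0"] by linarith
        then have "b * (d p / 2) \<le> b * norm (deriv (\<Phi> p) z0)" using b by (intro mult_left_mono) auto
        then show ?thesis by (simp add: b_def)
      qed
      ultimately show ?thesis unfolding B_def using subset_ball by blast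
    qed
    have distinct: "p = p'" if p: "p \<in> F" "p' \<in> F" and le: "fst p \<le> fst p'"
      and x: "x \<in> ball z0 \<rho>" "x' \<in> ball z0 \<rho>" and eq: "\<Phi> p x = \<Phi> p' x'" for p p' x x'
    proof -
      have xb: "x \<in> ball w \<delta>" "x' \<in> ball w \<delta>" using x \<rho>(2) ball_subset_cball by blast+
      have 1: "(f ^^ fst p) (\<Phi> p x) = x" "(f ^^ fst p') (\<Phi> p x) = x'"
        using D(2)[OF p(1) xb(1)] D(2)[OF p(2) xb(2)] eq by auto
      have "(f ^^ (fst p' - fst p)) x = x'"
      proof -
        have "(f ^^ (fst p' - fst p)) ((f ^^ fst p) (\<Phi> p x)) = (f ^^ fst p') (\<Phi> p x)"
          using le by (simp add: funpow_add[symmetric, THEN fun_cong, unfolded comp_def])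
        then show ?thesis by (simp add: 1)
      qed
      then have "\<not> fst p' - fst p > 0" using \<rho>(3)[of "fst p' - fst p" x] x by auto
      then have n: "fst p = fst p'" using le by simp
      have "\<Phi> p v = \<Phi> p' v"
      proof (rule inverse_branch_unique[of "fst p" w "\<Phi> p" "\<Phi> p'" x x' v])
        show "inverse_branch (fst p) w (\<Phi> p')" using \<Phi>(1)[OF p(2)] by (simp only: n)
      qed (fact \<Phi>(1)[OF p(1)] w xb eq vb)+
      then have "snd p = snd p'" using \<Phi>(2)[OF p(1)] \<Phi>(2)[OF p(2)] by simp
      then show "p = p'" using n by (simp add: prod_eq_iff)
    qed
    have disj: "disjoint_family_on B F"
      unfolding disjoint_family_on_def
    proof (intro ballI impI)
      fix p p' assume p: "p \<in> F" "p' \<in> F" "p \<noteq> p'"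
      show "B p \<inter> B p' = {}"
      proof (rule ccontr)
        assume "B p \<inter> B p' \<noteq> {}"
        then obtain t where "t \<in> B p" "t \<in> B p'" by blast
        then have "t \<in> \<Phi> p ` ball z0 \<rho>" "t \<in> \<Phi> p' ` ball z0 \<rho>"
          using sub[OF p(1)] sub[OF p(2)] by blast+
        then obtain x x' where x: "x \<in> ball z0 \<rho>" "x' \<in> ball z0 \<rho>" "\<Phi> p x = \<Phi> p' x'"
          by (elim imageE) simp
        show False
        proof (cases "fst p \<le> fst p'")
          case True
          then show False using distinct[OF p(1,2) _ x] p(3) by blast
        next
          case False
          then show False using distinct[OF p(2,1) _ x(2,1) x(3)[symmetric]] p(3) by simp
        qed
      qed
    qed
    have inR: "B p \<subseteq> cball 0 R'" if p: "p \<in> F" for p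
    proof
      fix t assume "t \<in> B p"
      then obtain x where x: "x \<in> ball z0 \<rho>" "t = \<Phi> p x" using sub[OF p] by blast
      have xb: "x \<in> ball w \<delta>" using x \<rho>(2) ball_subset_cball by blast
      have "dist t (snd p) \<le> 5 / 4 * norm (deriv (\<Phi> p) w) * dist x v"
        using inverse_branch_lipschitz[OF \<Phi>(1)[OF p] w xb vb] x(2) \<Phi>(2)[OF p] by simp
      also have "\<dots> \<le> 5 / 4 * (1 / c) * (2 * \<delta>)"
      proof (intro mult_mono mult_left_mono)
        have "c * 1 \<le> c * l ^ fst p" using c_pos l_gt_1 by (intro mult_left_mono one_le_power) auto
        then have "1 / (c * l ^ fst p) \<le> 1 / c" using c_pos by (intro divide_left_mono) auto
        then show "norm (deriv (\<Phi> p) w) \<le> 1 / c" using D(7)[OF p] by linarith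
        show "dist x v \<le> 2 * \<delta>" using xb vb dist_triangle[of x v w] by (simp add: dist_commute)
      qed (use c_pos in auto)
      also have "\<dots> \<le> 3 * \<delta> / c" using c_pos \<delta>_pos by (simp add: field_simps)
      finally have "dist t (snd p) \<le> 3 * \<delta> / c" .
      moreover have "norm (snd p) \<le> R" using F(2) p by auto
      ultimately show "t \<in> cball 0 R'"
        using norm_triangle_sub[of t "snd p"] by (simp add: R'_def dist_norm)
    qed
    have "(\<Sum>p\<in>F. (b * d p / 2)\<^sup>2) \<le> R'\<^sup>2"
      using F(1) b disj inR R' unfolding B_def
      by (intro sum_disjoint_ball_areas_le[of _ _ "\<lambda>p. \<Phi> p z0"]) (auto simp: d_def)
    moreover have "(d p)\<^sup>2 = (2 / b)\<^sup>2 * (b * d p / 2)\<^sup>2" for p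
      unfolding power_mult_distrib[symmetric] using b by simp
    ultimately have "(\<Sum>p\<in>F. (d p)\<^sup>2) \<le> (2 / b)\<^sup>2 * R'\<^sup>2"
      by (simp only: sum_distrib_left[symmetric]) (intro mult_left_mono, auto)
    then have "(\<Sum>p\<in>F. (d p)\<^sup>2) \<le> (2 / b * R')\<^sup>2" by (simp only: power_mult_distrib)
    then show "(\<Sum>(n, y)\<in>F. (1 / norm (deriv (f ^^ n) y))\<^sup>2) \<le> (2 / b * R')\<^sup>2"
      by (simp add: d_def case_prod_unfold)
  qed
qed

lemma weight_bound:
  obtains C where "0 \<le> C" "\<And>v F. v \<in> J \<Longrightarrow> norm v \<le> R \<Longrightarrow> finite F \<Longrightarrow>
     F \<subseteq> {(n, y). (f ^^ n) y = v \<and> norm y \<le> R} \<Longrightarrow>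
     (\<Sum>(n, y)\<in>F. (1 / norm (deriv (f ^^ n) y))\<^sup>2) \<le> C"
proof -
  obtain C where C: "\<And>w v F. w \<in> J \<Longrightarrow> v \<in> J \<inter> ball w \<delta> \<Longrightarrow> finite F \<Longrightarrow>
     F \<subseteq> {(n, y). (f ^^ n) y = v \<and> norm y \<le> R} \<Longrightarrow>
     (\<Sum>(n, y)\<in>F. (1 / norm (deriv (f ^^ n) y))\<^sup>2) \<le> C w"
  proof -
    have "\<forall>w\<in>J. \<exists>C. \<forall>v F. v \<in> J \<inter> ball w \<delta> \<longrightarrow> finite F \<longrightarrow>
     F \<subseteq> {(n, y). (f ^^ n) y = v \<and> norm y \<le> R} \<longrightarrow>
     (\<Sum>(n, y)\<in>F. (1 / norm (deriv (f ^^ n) y))\<^sup>2) \<le> C"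
      using local_weight_bound by blast
    from bchoice[OF this] show ?thesis using that by blast
  qed
  have "compact (J \<inter> cball 0 R)" using J_closed by (simp add: closed_Int_compact)
  moreover have "J \<inter> cball 0 R \<subseteq> (\<Union>w\<in>J \<inter> cball 0 R. ball w \<delta>)" using \<delta>_pos by auto
  ultimately obtain W where W: "W \<subseteq> J \<inter> cball 0 R" "finite W" "J \<inter> cball 0 R \<subseteq> (\<Union>w\<in>W. ball w \<delta>)"
    by (elim compactE_image) auto
  show ?thesis
  proof (rule that[of "\<Sum>w\<in>W. \<bar>C w\<bar>"])
    show "0 \<le> (\<Sum>w\<in>W. \<bar>C w\<bar>)" by (simp add: sum_nonneg)
    fix v F assume v: "v \<in> J" "norm v \<le> R" and F: "finite F" "F \<subseteq> {(n, y). (f ^^ n) y = v \<and> norm y \<le> R}"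
    have "v \<in> J \<inter> cball 0 R" using v by simp
    then obtain w where w: "w \<in> W" "v \<in> ball w \<delta>" using W(3) by blast
    have "(\<Sum>(n, y)\<in>F. (1 / norm (deriv (f ^^ n) y))\<^sup>2) \<le> C w"
      using C[of w v F] w v F W(1) by blast
    also have "\<dots> \<le> \<bar>C w\<bar>" by simp
    also have "\<dots> \<le> (\<Sum>w\<in>W. \<bar>C w\<bar>)" using w(1) W(2) by (intro member_le_sum) auto
    finally show "(\<Sum>(n, y)\<in>F. (1 / norm (deriv (f ^^ n) y))\<^sup>2) \<le> (\<Sum>w\<in>W. \<bar>C w\<bar>)" .
  qed
qed

end

section \<open>The transfer operator\<close>

lemma nn_integral_count_space_Sigma:
  "(\<integral>\<^sup>+p. g p \<partial>count_space (Sigma A B)) = (\<integral>\<^sup>+x. (\<integral>\<^sup>+y. g (x, y) \<partial>count_space (B x)) \<partial>count_space A)"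
proof -
  have "(\<integral>\<^sup>+p. g p \<partial>count_space (Sigma A B)) = (\<integral>\<^sup>+p. g p * indicator (Sigma A B) p \<partial>count_space UNIV)"
    by (simp add: nn_integral_count_space_indicator)
  also have "\<dots> = (\<integral>\<^sup>+x. (\<integral>\<^sup>+y. g (x, y) * indicator (Sigma A B) (x, y) \<partial>count_space UNIV) \<partial>count_space UNIV)"
    by (rule nn_integral_fst_count_space[symmetric])
  also have "\<dots> = (\<integral>\<^sup>+x. (\<integral>\<^sup>+y. g (x, y) * indicator (B x) y \<partial>count_space UNIV) * indicator A x \<partial>count_space UNIV)"
    by (intro nn_integral_cong) (auto simp: indicator_def)
  also have "\<dots> = (\<integral>\<^sup>+x. (\<integral>\<^sup>+y. g (x, y) \<partial>count_space (B x)) \<partial>count_space A)"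
    by (simp add: nn_integral_count_space_indicator)
  finally show ?thesis .
qed

lemma nn_integral_count_space_le_finite_sums:
  assumes A: "countable A" and le: "\<And>F. finite F \<Longrightarrow> F \<subseteq> A \<Longrightarrow> (\<Sum>x\<in>F. g x) \<le> C"
  shows "(\<integral>\<^sup>+x. g x \<partial>count_space A) \<le> C"
proof (cases "finite A")
  case True
  then show ?thesis using le[of A] by (simp add: nn_integral_count_space_finite)
next
  case False
  have bij: "bij_betw (from_nat_into A) UNIV A" by (rule bij_betw_from_nat_into[OF A False])
  have "(\<integral>\<^sup>+x. g x \<partial>count_space A) = (\<integral>\<^sup>+i. g (from_nat_into A i) \<partial>count_space UNIV)"
    by (rule nn_integral_bij_count_space[OF bij, symmetric])
  also have "\<dots> = (\<Sum>i. g (from_nat_into A i))" by (simp add: nn_integral_count_space_nat)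
  also have "\<dots> \<le> C"
    unfolding suminf_eq_SUP
  proof (rule SUP_least)
    fix n
    have "(\<Sum>i<n. g (from_nat_into A i)) = (\<Sum>x\<in>from_nat_into A ` {..<n}. g x)"
      using bij by (subst sum.reindex) (auto simp: bij_betw_def intro: inj_on_subset)
    also have "\<dots> \<le> C"
      by (rule le) (use bij in \<open>auto simp: bij_betw_def\<close>)
    finally show "(\<Sum>i<n. g (from_nat_into A i)) \<le> C" .
  qed
  finally show ?thesis .
qed

text \<open>The first term dominates where \<open>u \<ge> 1 / A\<close>, the second elsewhere. For
  large \<open>A\<close>, and then \<open>s\<close> close to 2, the first coefficient is close to 1
  and the second is small, so strict contraction at exponent 2 can pass to smaller
  exponents.\<close>

lemma powr_interpolation:
  fixes u A s :: real
  assumes "0 \<le> u" "1 \<le> A" "3/2 \<le> s" "s \<le> 2"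
  shows "u powr s \<le> A powr (2 - s) * u powr 2 + A powr (3/2 - s) * u powr (3/2)"
proof (cases "u = 0")
  case False
  then have u: "0 < u" using assms by simp
  show ?thesis
  proof (cases "1 \<le> A * u")
    case True
    have "1 \<le> (A * u) powr (2 - s)"
      using True assms by (intro ge_one_powr_ge_zero) auto
    then have "1 * u powr s \<le> (A * u) powr (2 - s) * u powr s"
      by (rule mult_right_mono) simp
    also have "\<dots> = A powr (2 - s) * u powr 2"
      using u assms by (simp add: powr_mult powr_add[symmetric])
    finally have "u powr s \<le> A powr (2 - s) * u powr 2" by simp
    moreover have "0 \<le> A powr (3/2 - s) * u powr (3/2)" by simp
    ultimately show ?thesis by linarith
  next
    case False
    have "(A * u) powr (s - 3/2) \<le> 1"
      using False u assms by (intro powr_le1) auto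
    then have "(A * u) powr (s - 3/2) * (A powr (3/2 - s) * u powr (3/2)) \<le> 1 * (A powr (3/2 - s) * u powr (3/2))"
      by (intro mult_right_mono) auto
    moreover have "(A * u) powr (s - 3/2) * (A powr (3/2 - s) * u powr (3/2)) =
        (A powr (s - 3/2) * A powr (3/2 - s)) * (u powr (s - 3/2) * u powr (3/2))"
      using u assms by (simp add: powr_mult)
    moreover have "\<dots> = u powr s"
      using u assms by (simp add: powr_add[symmetric])
    ultimately show ?thesis by (simp add: add_increasing)
  qed
qed (use assms in auto)

text \<open>By \<open>q_ge\<close> the weight of \<open>z\<close> in the metric is at most a
  constant times \<open>1 / (1 + norm z)\<close>, and \<open>preimage_sum\<close> makes the sum of
  its powers over preimages finite. The exponent 3/2 lies between 1, beyond which such sums over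
  arithmetic progressions converge, and 2.\<close>

locale transfer_operator = hyperbolic_branches +
  fixes k M :: real
  assumes k_pos: "0 < k" and q_ge: "\<And>w. w \<in> J \<Longrightarrow> k * (1 + norm w) \<le> q w"
    and countable_preimage: "\<And>w. countable {z. f z = w}"
    and M_nonneg: "0 \<le> M"
    and preimage_sum: "\<And>w. w \<in> J \<Longrightarrow>
      (\<integral>\<^sup>+z. ennreal ((1 / (1 + norm z)) powr (3/2)) \<partial>count_space {z. f z = w}) \<le> ennreal M"
begin

text \<open>The reciprocal of the derivative of \<open>f\<^sup>n\<close> with respect to the metric \<open>|dz| / (1 + |z|)\<close>.\<close>

definition weight :: "nat \<Rightarrow> complex \<Rightarrow> real" where
  "weight n z = (1 + norm ((f ^^ n) z)) / (norm (deriv (f ^^ n) z) * (1 + norm z))"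

definition transfer :: "real \<Rightarrow> (complex \<Rightarrow> ennreal) \<Rightarrow> complex \<Rightarrow> ennreal" where
  "transfer s h w = (\<integral>\<^sup>+z. ennreal (weight 1 z powr s) * h z \<partial>count_space {z. f z = w})"

lemma weight_nonneg: "0 \<le> weight n z"
  by (simp add: weight_def add_nonneg_nonneg)

lemma deriv_funpow_Suc_right: "deriv (f ^^ Suc n) z = deriv (f ^^ n) (f z) * deriv f z"
proof -
  have "deriv (f ^^ n \<circ> f) z = deriv (f ^^ n) (f z) * deriv f z"
    using holo holo_funpow[of n UNIV]
    by (intro deriv_chain) (auto intro: holomorphic_on_imp_differentiable_at[OF _ open_UNIV])
  then show ?thesis by (simp only: funpow_Suc_right)
qed

lemma weight_Suc: "weight (Suc n) z = weight 1 z * weight n (f z)"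
proof -
  have p: "1 + norm (f z) \<noteq> 0" by (smt (verit) norm_ge_zero)
  have "weight (Suc n) z = (1 + norm ((f ^^ n) (f z))) / (norm (deriv (f ^^ n) (f z)) * norm (deriv f z) * (1 + norm z))"
    unfolding weight_def deriv_funpow_Suc_right norm_mult by (simp add: funpow_swap1)
  also have "\<dots> = weight 1 z * weight n (f z)"
    unfolding weight_def using p by simp
  finally show ?thesis .
qed

lemma weight_1_le:
  assumes "f z \<in> J"
  shows "weight 1 z \<le> 1 / k * (1 / (1 + norm z))"
proof -
  have p: "0 < 1 + norm z" "0 < 1 + norm (f z)" by (smt (verit) norm_ge_zero)+
  have "k * (1 + norm (f z)) \<le> norm (deriv f z)" using q_ge[OF assms] q_eq by simp
  moreover have "0 < k * (1 + norm (f z))" using p k_pos by simp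
  ultimately have "(1 + norm (f z)) / norm (deriv f z) \<le> (1 + norm (f z)) / (k * (1 + norm (f z)))"
    using p k_pos by (intro divide_left_mono mult_pos_pos) linarith+
  also have "\<dots> = 1 / k" using p by simp
  finally have "(1 + norm (f z)) / norm (deriv f z) * (1 / (1 + norm z)) \<le> 1 / k * (1 / (1 + norm z))"
    using p by (intro mult_right_mono) auto
  then show ?thesis by (simp add: weight_def)
qed

lemma transfer_mono:
  assumes "\<And>z. f z = w \<Longrightarrow> h z \<le> h' z"
  shows "transfer s h w \<le> transfer s h' w"
  unfolding transfer_def using assms by (intro nn_integral_mono mult_left_mono) auto

lemma transfer_mono_J:
  assumes "w \<in> J" "\<And>z. z \<in> J \<Longrightarrow> h z \<le> h' z"
  shows "transfer s h w \<le> transfer s h' w"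
  using assms J_inv by (intro transfer_mono) auto

lemma transfer_add: "transfer s (\<lambda>z. h z + h' z) w = transfer s h w + transfer s h' w"
  unfolding transfer_def by (simp add: distrib_left nn_integral_add)

lemma transfer_cmult: "transfer s (\<lambda>z. a * h z) w = a * transfer s h w"
proof -
  have "transfer s (\<lambda>z. a * h z) w = (\<integral>\<^sup>+z. a * (ennreal (weight 1 z powr s) * h z) \<partial>count_space {z. f z = w})"
    unfolding transfer_def by (simp only: mult.left_commute)
  also have "\<dots> = a * transfer s h w"
    unfolding transfer_def by (rule nn_integral_cmult) simp
  finally show ?thesis .
qed

lemma funpow_transfer_mono_J:
  assumes "w \<in> J" "\<And>z. z \<in> J \<Longrightarrow> h z \<le> h' z"
  shows "(transfer s ^^ n) h w \<le> (transfer s ^^ n) h' w"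
  using assms(1)
proof (induction n arbitrary: w)
  case (Suc n)
  then show ?case by (auto intro!: transfer_mono_J)
qed (use assms(2) in auto)

lemma funpow_transfer_add:
  "(transfer s ^^ n) (\<lambda>z. h z + h' z) w = (transfer s ^^ n) h w + (transfer s ^^ n) h' w"
proof (induction n arbitrary: w)
  case (Suc n)
  have "(transfer s ^^ n) (\<lambda>z. h z + h' z) = (\<lambda>w. (transfer s ^^ n) h w + (transfer s ^^ n) h' w)"
    using Suc by blast
  then show ?case by (simp add: transfer_add)
qed simp

lemma funpow_transfer_cmult:
  "(transfer s ^^ n) (\<lambda>z. a * h z) w = a * (transfer s ^^ n) h w"
proof (induction n arbitrary: w)
  case (Suc n)
  have "(transfer s ^^ n) (\<lambda>z. a * h z) = (\<lambda>w. a * (transfer s ^^ n) h w)"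
    using Suc by blast
  then show ?case by (simp add: transfer_cmult)
qed simp

text \<open>Weights multiply along orbits by \<open>weight_Suc\<close>, and a point \<open>z\<close>
  with \<open>(f ^^ Suc n) z = w\<close> corresponds to the pair of \<open>f z\<close> and
  \<open>z\<close>.\<close>

lemma funpow_transfer:
  "(transfer s ^^ n) h w = (\<integral>\<^sup>+z. ennreal (weight n z powr s) * h z \<partial>count_space {z. (f ^^ n) z = w})"
proof (induction n arbitrary: h w)
  case 0
  have "weight 0 w = 1"
  proof -
    have "1 + norm w \<noteq> 0" by (smt (verit) norm_ge_zero)
    then show ?thesis by (simp add: weight_def id_def)
  qed
  moreover have "{z. z = w} = {w}" by auto
  ultimately show ?case by (simp add: nn_integral_count_space_finite)
next
  case (Suc n)
  let ?S = "Sigma {y. (f ^^ n) y = w} (\<lambda>y. {z. f z = y})"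
  have "(transfer s ^^ Suc n) h w = (transfer s ^^ n) (transfer s h) w"
    by (simp only: funpow_Suc_right o_apply)
  also have "\<dots> = (\<integral>\<^sup>+y. ennreal (weight n y powr s) *
      (\<integral>\<^sup>+z. ennreal (weight 1 z powr s) * h z \<partial>count_space {z. f z = y}) \<partial>count_space {y. (f ^^ n) y = w})"
    by (simp only: Suc transfer_def)
  also have "\<dots> = (\<integral>\<^sup>+y. (\<integral>\<^sup>+z. ennreal (weight n y powr s) * (ennreal (weight 1 z powr s) * h z)
      \<partial>count_space {z. f z = y}) \<partial>count_space {y. (f ^^ n) y = w})"
    by (simp add: nn_integral_cmult)
  also have "\<dots> = (\<integral>\<^sup>+p. ennreal (weight n (fst p) powr s) * (ennreal (weight 1 (snd p) powr s) * h (snd p)) \<partial>count_space ?S)"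
    by (simp only: nn_integral_count_space_Sigma fst_conv snd_conv)
  also have "\<dots> = (\<integral>\<^sup>+z. ennreal (weight n (f z) powr s) * (ennreal (weight 1 z powr s) * h z)
      \<partial>count_space {z. (f ^^ Suc n) z = w})"
  proof -
    have "bij_betw (\<lambda>z. (f z, z)) {z. (f ^^ Suc n) z = w} ?S"
      by (rule bij_betwI[of _ _ _ snd]) (auto simp: funpow_swap1)
    from nn_integral_bij_count_space[OF this, symmetric] show ?thesis by simp
  qed
  also have "\<dots> = (\<integral>\<^sup>+z. ennreal (weight (Suc n) z powr s) * h z \<partial>count_space {z. (f ^^ Suc n) z = w})"
  proof (rule nn_integral_cong)
    fix z
    have "weight (Suc n) z powr s = weight n (f z) powr s * weight 1 z powr s"
      unfolding weight_Suc by (simp only: powr_mult weight_nonneg mult.commute)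
    then have "ennreal (weight (Suc n) z powr s) = ennreal (weight n (f z) powr s) * ennreal (weight 1 z powr s)"
      by (simp only: ennreal_mult powr_ge_zero)
    then show "ennreal (weight n (f z) powr s) * (ennreal (weight 1 z powr s) * h z) =
        ennreal (weight (Suc n) z powr s) * h z"
      by (simp only: mult.assoc)
  qed
  finally show ?case .
qed

section \<open>Boundedness of the summed iterates at exponent 2\<close>

lemma countable_funpow_preimage: "countable {z. (f ^^ n) z = w}"
proof (induction n arbitrary: w)
  case (Suc n)
  have "{z. (f ^^ Suc n) z = w} = (\<Union>y\<in>{y. f y = w}. {z. (f ^^ n) z = y})" by auto
  then show ?case using Suc countable_preimage by auto
qed simp

text \<open>The sum runs over pairs of time and point, since the orbit of one point may hit a
  periodic \<open>w\<close> several times.\<close>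

lemma sum_funpow_transfer:
  "(\<Sum>n. (transfer s ^^ (n + N)) h w) = (\<integral>\<^sup>+p. ennreal (weight (fst p) (snd p) powr s) * h (snd p)
     \<partial>count_space (Sigma {N..} (\<lambda>n. {z. (f ^^ n) z = w})))"
proof -
  have bij: "bij_betw (\<lambda>n. n + N) UNIV {N..}"
    by (rule bij_betwI[of _ _ _ "\<lambda>n. n - N"]) auto
  have "(\<Sum>n. (transfer s ^^ (n + N)) h w) = (\<integral>\<^sup>+n. (transfer s ^^ (n + N)) h w \<partial>count_space UNIV)"
    by (simp add: nn_integral_count_space_nat)
  also have "\<dots> = (\<integral>\<^sup>+n. (transfer s ^^ n) h w \<partial>count_space {N..})"
    by (rule nn_integral_bij_count_space[OF bij])
  finally show ?thesis
    by (simp only: nn_integral_count_space_Sigma fst_conv snd_conv funpow_transfer)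
qed

text \<open>As long as \<open>w\<close> has norm at most \<open>R\<close>, the metric enlarges a
  contraction factor at most by \<open>1 + R\<close>, so every finite part of the sum is controlled
  by \<open>weight_bound\<close>.\<close>

lemma green_function_bound:
  obtains C where "0 \<le> C" "\<And>w N. w \<in> J \<Longrightarrow> norm w \<le> R \<Longrightarrow>
    (\<Sum>n<N. (transfer 2 ^^ n) (indicator (cball 0 R)) w) \<le> ennreal C"
proof -
  obtain C where C: "0 \<le> C" "\<And>v F. v \<in> J \<Longrightarrow> norm v \<le> R \<Longrightarrow> finite F \<Longrightarrow>
     F \<subseteq> {(n, y). (f ^^ n) y = v \<and> norm y \<le> R} \<Longrightarrow>
     (\<Sum>(n, y)\<in>F. (1 / norm (deriv (f ^^ n) y))\<^sup>2) \<le> C"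
    by (rule weight_bound[of R]) blast
  show ?thesis
  proof (rule that[of "(1 + R)\<^sup>2 * C"])
    show "0 \<le> (1 + R)\<^sup>2 * C" using C(1) by simp
    fix w N assume w: "w \<in> J" "norm w \<le> R"
    let ?S = "Sigma {0..} (\<lambda>n. {z. (f ^^ n) z = w})"
    let ?g = "\<lambda>p. ennreal (weight (fst p) (snd p) powr 2) * indicator (cball 0 R) (snd p)"
    have "(\<Sum>n<N. (transfer 2 ^^ n) (indicator (cball 0 R)) w) \<le> (\<Sum>n. (transfer 2 ^^ n) (indicator (cball 0 R)) w)"
      by (rule sum_le_suminf) auto
    also have "\<dots> = (\<integral>\<^sup>+p. ?g p \<partial>count_space ?S)"
      using sum_funpow_transfer[where N = 0] by simp
    also have "\<dots> \<le> ennreal ((1 + R)\<^sup>2 * C)"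
    proof (rule nn_integral_count_space_le_finite_sums)
      show "countable ?S" using countable_funpow_preimage by auto
      fix F assume F: "finite F" "F \<subseteq> ?S"
      define F' where "F' = {p \<in> F. norm (snd p) \<le> R}"
      have each: "weight (fst p) (snd p) powr 2 \<le> (1 + R)\<^sup>2 * (1 / norm (deriv (f ^^ fst p) (snd p)))\<^sup>2"
        if p: "p \<in> F'" for p
      proof -
        have fp: "(f ^^ fst p) (snd p) = w" using p F(2) by (auto simp: F'_def)
        have "weight (fst p) (snd p) \<le> (1 + R) * (1 / norm (deriv (f ^^ fst p) (snd p)))"
        proof -
          have "(1 + norm w) / (1 + norm (snd p)) \<le> (1 + R) / 1"
            using w(2) norm_ge_zero[of w] by (intro frac_le) (linarith, auto)
          then have "(1 + norm w) / (1 + norm (snd p)) * (1 / norm (deriv (f ^^ fst p) (snd p)))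
              \<le> (1 + R) * (1 / norm (deriv (f ^^ fst p) (snd p)))"
            by (intro mult_right_mono) auto
          then show ?thesis by (simp add: weight_def fp mult.commute)
        qed
        then have "(weight (fst p) (snd p))\<^sup>2 \<le> ((1 + R) * (1 / norm (deriv (f ^^ fst p) (snd p))))\<^sup>2"
          using weight_nonneg by (intro power_mono) auto
        then show ?thesis using weight_nonneg by (simp add: powr_numeral power_mult_distrib power_divide)
      qed
      have "(\<Sum>p\<in>F. ?g p) = (\<Sum>p\<in>F'. ennreal (weight (fst p) (snd p) powr 2))"
        unfolding F'_def using F(1) by (intro sum.mono_neutral_cong_right) (auto simp: indicator_def)
      also have "\<dots> \<le> (\<Sum>p\<in>F'. ennreal ((1 + R)\<^sup>2 * (1 / norm (deriv (f ^^ fst p) (snd p)))\<^sup>2))"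
        using each by (intro sum_mono ennreal_leI)
      also have "\<dots> = ennreal ((1 + R)\<^sup>2 * (\<Sum>(n, y)\<in>F'. (1 / norm (deriv (f ^^ n) y))\<^sup>2))"
        by (subst sum_ennreal) (auto simp: sum_distrib_left case_prod_unfold)
      also have "\<dots> \<le> ennreal ((1 + R)\<^sup>2 * C)"
      proof (intro ennreal_leI mult_left_mono)
        show "(\<Sum>(n, y)\<in>F'. (1 / norm (deriv (f ^^ n) y))\<^sup>2) \<le> C"
          by (rule C(2)[OF w]) (use F in \<open>auto simp: F'_def\<close>)
      qed simp
      finally show "(\<Sum>p\<in>F. ?g p) \<le> ennreal ((1 + R)\<^sup>2 * C)" .
    qed
    finally show "(\<Sum>n<N. (transfer 2 ^^ n) (indicator (cball 0 R)) w) \<le> ennreal ((1 + R)\<^sup>2 * C)" .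
  qed
qed

text \<open>Of the power \<open>s\<close> of \<open>1 / (1 + norm z)\<close>, the part 3/2 is spent
  on convergence; the rest is a gain when all preimages are far from the origin.\<close>

lemma transfer_one_le:
  assumes w: "w \<in> J" and s: "3/2 \<le> s" and T: "0 \<le> T" "\<And>z. f z = w \<Longrightarrow> T \<le> norm z"
  shows "transfer s (\<lambda>_. 1) w \<le> ennreal ((1 / k) powr s * (1 / (1 + T)) powr (s - 3/2) * M)"
proof -
  let ?a = "(1 / k) powr s * (1 / (1 + T)) powr (s - 3/2)"
  have "transfer s (\<lambda>_. 1) w \<le> (\<integral>\<^sup>+z. ennreal ?a * ennreal ((1 / (1 + norm z)) powr (3/2)) \<partial>count_space {z. f z = w})"
    unfolding transfer_def
  proof (rule nn_integral_mono)
    fix z assume "z \<in> space (count_space {z. f z = w})"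
    then have z: "f z = w" by simp
    have p: "0 < 1 + norm z" by (smt (verit) norm_ge_zero)
    have "weight 1 z powr s \<le> (1 / k * (1 / (1 + norm z))) powr s"
      using weight_1_le[of z] z w s weight_nonneg by (intro powr_mono2) auto
    also have "\<dots> = (1 / k) powr s * ((1 / (1 + norm z)) powr (s - 3/2) * (1 / (1 + norm z)) powr (3/2))"
    proof -
      have "(1 / (1 + norm z)) powr s = (1 / (1 + norm z)) powr (s - 3/2) * (1 / (1 + norm z)) powr (3/2)"
        by (simp add: powr_add[symmetric])
      moreover have "(1 / k * (1 / (1 + norm z))) powr s = (1 / k) powr s * (1 / (1 + norm z)) powr s"
        by (rule powr_mult)
      ultimately show ?thesis by (simp only:)
    qed
    also have "\<dots> \<le> (1 / k) powr s * ((1 / (1 + T)) powr (s - 3/2) * (1 / (1 + norm z)) powr (3/2))"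
      using T(1) T(2)[OF z] s
      by (intro mult_left_mono mult_right_mono powr_mono2 divide_left_mono mult_pos_pos) auto
    finally have "weight 1 z powr s \<le> ?a * (1 / (1 + norm z)) powr (3/2)" by (simp add: mult_ac)
    then show "ennreal (weight 1 z powr s) * 1 \<le> ennreal ?a * ennreal ((1 / (1 + norm z)) powr (3/2))"
      by (simp add: ennreal_mult[symmetric] ennreal_leI)
  qed
  also have "\<dots> = ennreal ?a * (\<integral>\<^sup>+z. ennreal ((1 / (1 + norm z)) powr (3/2)) \<partial>count_space {z. f z = w})"
    by (simp add: nn_integral_cmult)
  also have "\<dots> \<le> ennreal ?a * ennreal M" using preimage_sum[OF w] by (rule mult_left_mono) simp
  also have "\<dots> = ennreal (?a * M)" using M_nonneg by (simp add: ennreal_mult)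
  finally show ?thesis .
qed

text \<open>Outside the bounded image of \<open>cball 0 T\<close> a point has only preimages of norm
  above \<open>T\<close>. At exponent 2 the spare power in \<open>transfer_one_le\<close> is 1/2,
  and \<open>T\<close> is chosen so that \<open>a / sqrt (1 + T) \<le> 1/2\<close>.\<close>

lemma transfer_drift:
  obtains R B where "0 \<le> B" "\<And>w. w \<in> J \<Longrightarrow> transfer 2 (\<lambda>_. 1) w \<le> ennreal B"
    "\<And>w. w \<in> J \<Longrightarrow> R < norm w \<Longrightarrow> transfer 2 (\<lambda>_. 1) w \<le> ennreal (1/2)"
proof -
  define a where "a = (1 / k) powr 2 * M"
  have a: "0 \<le> a" using M_nonneg by (simp add: a_def)
  define T where "T = (2 * a)\<^sup>2"
  have T: "0 \<le> T" by (simp add: T_def)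
  have "continuous_on (cball 0 T) f"
    using holo holomorphic_on_imp_continuous_on holomorphic_on_subset by blast
  then have "compact (f ` cball 0 T)" by (intro compact_continuous_image) auto
  then obtain R where R: "\<And>z. norm z \<le> T \<Longrightarrow> norm (f z) \<le> R"
    by (metis bounded_iff compact_imp_bounded imageI mem_cball_0)
  show ?thesis
  proof (rule that[of "(1 / k) powr 2 * (1 / (1 + 0)) powr (2 - 3/2) * M" R])
    show "0 \<le> (1 / k) powr 2 * (1 / (1 + 0)) powr (2 - 3/2) * M" using M_nonneg by simp
    fix w assume w: "w \<in> J"
    show "transfer 2 (\<lambda>_. 1) w \<le> ennreal ((1 / k) powr 2 * (1 / (1 + 0)) powr (2 - 3/2) * M)"
      by (rule transfer_one_le[OF w]) auto
    assume Rw: "R < norm w"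
    have "transfer 2 (\<lambda>_. 1) w \<le> ennreal ((1 / k) powr 2 * (1 / (1 + T)) powr (2 - 3/2) * M)"
    proof (rule transfer_one_le[OF w _ T])
      fix z assume "f z = w"
      then show "T \<le> norm z" using R[of z] Rw by fastforce
    qed simp
    also have "\<dots> \<le> ennreal (1/2)"
    proof (rule ennreal_leI)
      have "2 * a \<le> sqrt (1 + T)" using a by (intro real_le_rsqrt) (simp add: T_def)
      moreover have "(1 / (1 + T)) powr (1/2) = 1 / sqrt (1 + T)"
        using T by (simp add: powr_half_sqrt real_sqrt_divide)
      moreover have "0 < sqrt (1 + T)" using T by simp
      moreover have "a * (1 / sqrt (1 + T)) \<le> 1/2" if "2 * a \<le> sqrt (1 + T)" "0 < sqrt (1 + T)"
        using that by (simp add: pos_divide_le_eq)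
      moreover have "(1 / k) powr 2 * (1 / (1 + T)) powr (2 - 3/2) * M = a * (1 / (1 + T)) powr (1/2)"
        by (simp add: a_def)
      ultimately show "(1 / k) powr 2 * (1 / (1 + T)) powr (2 - 3/2) * M \<le> 1/2"
        by simp
    qed
    finally show "transfer 2 (\<lambda>_. 1) w \<le> ennreal (1/2)" .
  qed
qed

text \<open>The inequality \<open>step\<close>, to which the iterates are applied, bounds a partial
  sum at points of norm at most \<open>R\<close> by 1, half of the previous partial sum and a
  multiple of the sum in \<open>green_function_bound\<close>. Farther out, one application of the
  operator already gains the factor 1/2. Induction over partial sums avoids subtracting possibly
  infinite values.\<close>

lemma transfer_sum_bounded:
  obtains D :: real where "2 \<le> D" "\<And>w N. w \<in> J \<Longrightarrow> (\<Sum>n<N. (transfer 2 ^^ n) (\<lambda>_. 1) w) \<le> ennreal D"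
proof -
  obtain R B where B: "0 \<le> B" "\<And>w. w \<in> J \<Longrightarrow> transfer 2 (\<lambda>_. 1) w \<le> ennreal B"
    and far: "\<And>w. w \<in> J \<Longrightarrow> R < norm w \<Longrightarrow> transfer 2 (\<lambda>_. 1) w \<le> ennreal (1/2)"
    using transfer_drift by metis
  obtain C where C: "0 \<le> C" "\<And>w N. w \<in> J \<Longrightarrow> norm w \<le> R \<Longrightarrow>
    (\<Sum>n<N. (transfer 2 ^^ n) (indicator (cball 0 R)) w) \<le> ennreal C"
    using green_function_bound[of R] by metis
  \<comment> \<open>The solution of \<open>D = 1 + D / 2 + B * C\<close>. The far case uses
    \<open>1 + D / 2 \<le> D\<close>, that is \<open>2 \<le> D\<close>.\<close>
  define D where "D = 2 + 2 * B * C"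
  have D: "2 \<le> D" using B(1) C(1) by (simp add: D_def)
  define \<phi> where "\<phi> N w = (\<Sum>n<N. (transfer 2 ^^ n) (\<lambda>_. 1) w)" for N w
  have step: "transfer 2 (\<lambda>_. 1) z \<le> ennreal (1/2) * 1 + ennreal B * indicator (cball 0 R) z" if "z \<in> J" for z
  proof (cases "R < norm z")
    case True
    then show ?thesis using far[OF that] by simp
  next
    case False
    then show ?thesis using B(2)[OF that] by (simp add: add_increasing)
  qed
  have iter: "(transfer 2 ^^ Suc n) (\<lambda>_. 1) w \<le>
      ennreal (1/2) * (transfer 2 ^^ n) (\<lambda>_. 1) w + ennreal B * (transfer 2 ^^ n) (indicator (cball 0 R)) w"
    if "w \<in> J" for n w
  proof -
    have "(transfer 2 ^^ Suc n) (\<lambda>_. 1) w = (transfer 2 ^^ n) (transfer 2 (\<lambda>_. 1)) w"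
      by (simp only: funpow_Suc_right o_apply)
    also have "\<dots> \<le> (transfer 2 ^^ n) (\<lambda>z. ennreal (1/2) * 1 + ennreal B * indicator (cball 0 R) z) w"
      by (rule funpow_transfer_mono_J[OF that step])
    also have "\<dots> = ennreal (1/2) * (transfer 2 ^^ n) (\<lambda>_. 1) w + ennreal B * (transfer 2 ^^ n) (indicator (cball 0 R)) w"
      by (simp only: funpow_transfer_add funpow_transfer_cmult)
    finally show ?thesis .
  qed
  have split: "\<phi> (Suc N) w = 1 + (\<Sum>n<N. (transfer 2 ^^ Suc n) (\<lambda>_. 1) w)" for N w
    unfolding \<phi>_def by (subst sum.lessThan_Suc_shift) simp
  have near: "\<phi> N w \<le> ennreal D" if w: "w \<in> J" "norm w \<le> R" for N w
  proof (induction N)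
    case (Suc N)
    have "\<phi> (Suc N) w \<le> 1 + (\<Sum>n<N. ennreal (1/2) * (transfer 2 ^^ n) (\<lambda>_. 1) w +
        ennreal B * (transfer 2 ^^ n) (indicator (cball 0 R)) w)"
      unfolding split by (intro add_left_mono sum_mono iter w)
    also have "\<dots> = 1 + (ennreal (1/2) * \<phi> N w + ennreal B * (\<Sum>n<N. (transfer 2 ^^ n) (indicator (cball 0 R)) w))"
      by (simp only: sum.distrib sum_distrib_left \<phi>_def)
    also have "\<dots> \<le> 1 + (ennreal (1/2) * ennreal D + ennreal B * ennreal C)"
      by (intro add_left_mono add_mono mult_left_mono Suc C(2)[OF w]) auto
    also have "ennreal (1/2) * ennreal D = ennreal (D / 2)"
      using D by (subst ennreal_mult[symmetric]) auto
    also have "ennreal B * ennreal C = ennreal (B * C)"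
      using B(1) C(1) by (simp add: ennreal_mult)
    also have "1 + (ennreal (D / 2) + ennreal (B * C)) = ennreal (1 + (D / 2 + B * C))"
      using D B(1) C(1) by (simp only: ennreal_1[symmetric]) (subst ennreal_plus[symmetric], simp_all)+
    also have "1 + (D / 2 + B * C) = D" by (simp add: D_def)
    finally show ?case .
  qed (simp add: \<phi>_def)
  have all: "\<phi> N w \<le> ennreal D" if w: "w \<in> J" for N w
    using w
  proof (induction N arbitrary: w)
    case (Suc N)
    show ?case
    proof (cases "norm w \<le> R")
      case False
      have "(\<Sum>n<N. (transfer 2 ^^ Suc n) (\<lambda>_. 1) w) = transfer 2 (\<phi> N) w"
      proof (induction N)
        case 0
        then show ?case by (simp add: \<phi>_def transfer_def)
      next
        case (Suc N)
        have "\<phi> (Suc N) = (\<lambda>z. \<phi> N z + (transfer 2 ^^ N) (\<lambda>_. 1) z)" by (simp add: \<phi>_def fun_eq_iff)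
        then show ?case using Suc by (simp add: transfer_add)
      qed
      then have "\<phi> (Suc N) w = 1 + transfer 2 (\<phi> N) w" by (simp only: split)
      also have "\<dots> \<le> 1 + transfer 2 (\<lambda>z. ennreal D * 1) w"
        using Suc by (intro add_left_mono transfer_mono_J) auto
      also have "\<dots> \<le> 1 + ennreal D * ennreal (1/2)"
        unfolding transfer_cmult using far[OF Suc.prems] False by (intro add_left_mono mult_left_mono) auto
      also have "ennreal D * ennreal (1/2) = ennreal (D / 2)"
        using D by (subst ennreal_mult[symmetric]) auto
      also have "1 + ennreal (D / 2) = ennreal (1 + D / 2)"
        using D ennreal_plus[of 1 "D / 2"] by simp
      also have "\<dots> \<le> ennreal D" using D by (intro ennreal_leI) simp
      finally show ?thesis .
    qed (use near Suc.prems in auto)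
  qed (simp add: \<phi>_def)
  show ?thesis using that[OF D] all by (simp add: \<phi>_def)
qed

section \<open>Strict contraction at exponent 2 and slightly below\<close>

lemma transfer_subinvariant:
  obtains \<psi> :: "complex \<Rightarrow> real" and D \<rho> where "0 < D" "0 < \<rho>" "\<rho> < 1"
    "\<And>w. w \<in> J \<Longrightarrow> 1 \<le> \<psi> w" "\<And>w. w \<in> J \<Longrightarrow> \<psi> w \<le> D"
    "\<And>w. w \<in> J \<Longrightarrow> transfer 2 (\<lambda>z. ennreal (\<psi> z)) w \<le> ennreal (\<rho> * \<psi> w)"
proof -
  obtain D :: real where D: "2 \<le> D" "\<And>w N. w \<in> J \<Longrightarrow> (\<Sum>n<N. (transfer 2 ^^ n) (\<lambda>_. 1) w) \<le> ennreal D"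
    using transfer_sum_bounded by metis
  define \<Phi> where "\<Phi> w = (\<Sum>n. (transfer 2 ^^ n) (\<lambda>_. 1) w)" for w
  define \<psi> where "\<psi> w = enn2real (\<Phi> w)" for w
  have \<Phi>D: "\<Phi> w \<le> ennreal D" if "w \<in> J" for w
    unfolding \<Phi>_def suminf_eq_SUP using D(2)[OF that] by (rule SUP_least)
  have \<Phi>\<psi>: "\<Phi> w = ennreal (\<psi> w)" if "w \<in> J" for w
    unfolding \<psi>_def using le_less_trans[OF \<Phi>D[OF that] ennreal_less_top] by (simp add: ennreal_enn2real)
  have split: "\<Phi> w = transfer 2 \<Phi> w + 1" for w
  proof -
    have "\<Phi> w = (\<Sum>n. (transfer 2 ^^ (n + 1)) (\<lambda>_. 1) w) + (\<Sum>n<1. (transfer 2 ^^ n) (\<lambda>_. 1) w)"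
      unfolding \<Phi>_def by (rule suminf_offset) simp
    also have "(\<Sum>n. (transfer 2 ^^ (n + 1)) (\<lambda>_. 1) w) = transfer 2 \<Phi> w"
    proof -
      have "transfer 2 \<Phi> w = (\<integral>\<^sup>+z. (\<Sum>n. ennreal (weight 1 z powr 2) * (transfer 2 ^^ n) (\<lambda>_. 1) z) \<partial>count_space {z. f z = w})"
        unfolding transfer_def[of 2 \<Phi>] \<Phi>_def by (simp only: ennreal_suminf_cmult)
      also have "\<dots> = (\<Sum>n. \<integral>\<^sup>+z. ennreal (weight 1 z powr 2) * (transfer 2 ^^ n) (\<lambda>_. 1) z \<partial>count_space {z. f z = w})"
        by (rule nn_integral_suminf) simp
      also have "\<dots> = (\<Sum>n. (transfer 2 ^^ (n + 1)) (\<lambda>_. 1) w)"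
        by (simp add: transfer_def[of 2 _ w])
      finally show ?thesis by (rule sym)
    qed
    finally show ?thesis by simp
  qed
  have \<psi>1: "1 \<le> \<psi> w" and \<psi>D: "\<psi> w \<le> D" if w: "w \<in> J" for w
  proof -
    have "ennreal 1 \<le> ennreal (\<psi> w)" using split[of w] \<Phi>\<psi>[OF w] by (simp add: add_increasing)
    then show "1 \<le> \<psi> w" by (simp add: \<psi>_def)
    show "\<psi> w \<le> D" using \<Phi>D[OF w] \<Phi>\<psi>[OF w] D(1) by simp
  qed
  show ?thesis
  proof (rule that[of D "1 - 1 / D" \<psi>])
    fix w assume w: "w \<in> J"
    have "transfer 2 (\<lambda>z. ennreal (\<psi> z)) w + 1 \<le> transfer 2 \<Phi> w + 1"
      using \<Phi>\<psi> by (intro add_right_mono transfer_mono_J[OF w]) simp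
    also have "\<dots> = ennreal (\<psi> w)" using split[of w] \<Phi>\<psi>[OF w] by simp
    also have "\<dots> = ennreal (\<psi> w - 1) + 1"
      using \<psi>1[OF w] ennreal_plus[of "\<psi> w - 1" 1] by simp
    finally have "transfer 2 (\<lambda>z. ennreal (\<psi> z)) w \<le> ennreal (\<psi> w - 1)"
      by (simp add: ennreal_add_left_cancel_le add.commute)
    \<comment> \<open>The 1 that is lost in one step is at least the fraction \<open>1 / D\<close>
      of \<open>\<psi> w\<close>, since \<open>\<psi> w \<le> D\<close>.\<close>
    also have "\<dots> \<le> ennreal ((1 - 1 / D) * \<psi> w)"
      using \<psi>D[OF w] D(1) by (intro ennreal_leI) (simp add: field_simps)
    finally show "transfer 2 (\<lambda>z. ennreal (\<psi> z)) w \<le> ennreal ((1 - 1 / D) * \<psi> w)" .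
  qed (use D(1) \<psi>1 \<psi>D in auto)
qed

lemma transfer_contracts:
  obtains s \<theta> D :: real where "1 \<le> s" "s < 2" "0 < \<theta>" "\<theta> < 1" "0 < D"
    "\<And>w n. w \<in> J \<Longrightarrow> (transfer s ^^ n) (\<lambda>_. 1) w \<le> ennreal (D * \<theta> ^ n)"
proof -
  obtain \<psi> :: "complex \<Rightarrow> real" and D \<rho> where D: "0 < D" and \<rho>: "0 < \<rho>" "\<rho> < 1" and
    \<psi>: "\<And>w. w \<in> J \<Longrightarrow> 1 \<le> \<psi> w" "\<And>w. w \<in> J \<Longrightarrow> \<psi> w \<le> D"
    and sub: "\<And>w. w \<in> J \<Longrightarrow> transfer 2 (\<lambda>z. ennreal (\<psi> z)) w \<le> ennreal (\<rho> * \<psi> w)"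
    using transfer_subinvariant by metis
  define E where "E = D * ((1 / k) powr (3/2) * M)"
  have E: "0 \<le> E" using D M_nonneg by (simp add: E_def)
  have half: "transfer (3/2) (\<lambda>z. ennreal (\<psi> z)) w \<le> ennreal E" if w: "w \<in> J" for w
  proof -
    have "transfer (3/2) (\<lambda>z. ennreal (\<psi> z)) w \<le> transfer (3/2) (\<lambda>z. ennreal D * 1) w"
      using \<psi>(2) by (intro transfer_mono_J[OF w]) (simp add: ennreal_leI)
    also have "\<dots> = ennreal D * transfer (3/2) (\<lambda>_. 1) w" by (rule transfer_cmult)
    also have "\<dots> \<le> ennreal D * ennreal ((1 / k) powr (3/2) * (1 / (1 + 0)) powr (3/2 - 3/2) * M)"
      by (intro mult_left_mono transfer_one_le[OF w]) auto
    also have "\<dots> = ennreal E" using D M_nonneg by (simp add: ennreal_mult[symmetric] E_def)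
    finally show ?thesis .
  qed
  \<comment> \<open>The order of choices matters: \<open>A\<close> first, so large that
    \<open>A powr (-1/4)\<close> beats \<open>E\<close>, where -1/4 bounds \<open>3/2 - s\<close>
    for \<open>s > 7/4\<close>; then, with \<open>A\<close> fixed, \<open>s\<close> so close to 2
    that \<open>A powr (2 - s)\<close> is nearly 1.\<close>
  have "((\<lambda>A. A powr (-1/4) * E) \<longlongrightarrow> 0 * E) at_top"
    by (intro tendsto_mult tendsto_const tendsto_neg_powr filterlim_ident) auto
  then have "\<forall>\<^sub>F A in at_top. A powr (-1/4) * E < (1 - \<rho>) / 4"
    by (rule order_tendstoD) (use \<rho> in auto)
  then have "\<forall>\<^sub>F A in at_top. A powr (-1/4) * E < (1 - \<rho>) / 4 \<and> 1 \<le> A"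
    using eventually_ge_at_top by (rule eventually_conj)
  then obtain A where A: "A powr (-1/4) * E < (1 - \<rho>) / 4" "1 \<le> (A::real)"
    using eventually_happens'[OF trivial_limit_at_top_linorder] by blast
  have "((\<lambda>s. A powr (2 - s) * \<rho>) \<longlongrightarrow> A powr (2 - 2) * \<rho>) (at_left 2)"
    using A(2) by (intro tendsto_intros) auto
  then have "\<forall>\<^sub>F s in at_left 2. A powr (2 - s) * \<rho> < (1 + \<rho>) / 2"
    by (rule order_tendstoD) (use A(2) \<rho> in auto)
  then have "\<forall>\<^sub>F s in at_left 2. A powr (2 - s) * \<rho> < (1 + \<rho>) / 2 \<and> s \<in> {7/4<..<2}"
    by (rule eventually_conj) (rule eventually_at_left_real, simp)
  then obtain s where s: "A powr (2 - s) * \<rho> < (1 + \<rho>) / 2" "7/4 < s" "s < 2"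
    using eventually_happens'[OF trivial_limit_at_left_real] by (metis (no_types, lifting) greaterThanLessThan_iff)
  \<comment> \<open>The sum of \<open>(1 + \<rho>) / 2\<close> from exponent 2 and
    \<open>(1 - \<rho>) / 4\<close> from exponent 3/2. The latter starts as a constant and becomes a
    multiple of \<psi> through \<open>1 \<le> \<psi>\<close>.\<close>
  define \<theta> where "\<theta> = (3 + \<rho>) / 4"
  have \<theta>: "0 < \<theta>" "\<theta> < 1" using \<rho> by (auto simp: \<theta>_def)
  have step: "transfer s (\<lambda>z. ennreal (\<psi> z)) w \<le> ennreal \<theta> * ennreal (\<psi> w)" if w: "w \<in> J" for w
  proof -
    have "transfer s (\<lambda>z. ennreal (\<psi> z)) w \<le>
       (\<integral>\<^sup>+z. ennreal (A powr (2 - s)) * (ennreal (weight 1 z powr 2) * ennreal (\<psi> z)) +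
            ennreal (A powr (3/2 - s)) * (ennreal (weight 1 z powr (3/2)) * ennreal (\<psi> z)) \<partial>count_space {z. f z = w})"
      unfolding transfer_def
    proof (rule nn_integral_mono)
      fix z
      have "ennreal (weight 1 z powr s) \<le>
          ennreal (A powr (2 - s) * weight 1 z powr 2 + A powr (3/2 - s) * weight 1 z powr (3/2))"
        by (intro ennreal_leI powr_interpolation weight_nonneg A(2)) (use s in auto)
      also have "\<dots> = ennreal (A powr (2 - s)) * ennreal (weight 1 z powr 2) +
          ennreal (A powr (3/2 - s)) * ennreal (weight 1 z powr (3/2))"
        by (simp add: ennreal_mult)
      finally show "ennreal (weight 1 z powr s) * ennreal (\<psi> z) \<le>
          ennreal (A powr (2 - s)) * (ennreal (weight 1 z powr 2) * ennreal (\<psi> z)) +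
          ennreal (A powr (3/2 - s)) * (ennreal (weight 1 z powr (3/2)) * ennreal (\<psi> z))"
        by (metis (no_types, lifting) distrib_right mult.assoc mult_right_mono zero_le)
    qed
    also have "\<dots> = ennreal (A powr (2 - s)) * transfer 2 (\<lambda>z. ennreal (\<psi> z)) w +
        ennreal (A powr (3/2 - s)) * transfer (3/2) (\<lambda>z. ennreal (\<psi> z)) w"
      unfolding transfer_def by (subst nn_integral_add) (auto simp: nn_integral_cmult)
    also have "\<dots> \<le> ennreal (A powr (2 - s)) * ennreal (\<rho> * \<psi> w) + ennreal (A powr (3/2 - s)) * ennreal E"
      by (intro add_mono mult_left_mono sub half w) auto
    also have "\<dots> = ennreal (A powr (2 - s) * (\<rho> * \<psi> w) + A powr (3/2 - s) * E)"
      using \<rho> \<psi>(1)[OF w] E by (simp add: ennreal_mult)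
    also have "\<dots> \<le> ennreal (\<theta> * \<psi> w)"
    proof (rule ennreal_leI)
      have "A powr (3/2 - s) * E \<le> A powr (-1/4) * E"
        using A(2) s E by (intro mult_right_mono powr_mono) auto
      also have "\<dots> \<le> (1 - \<rho>) / 4 * 1" using A(1) by simp
      also have "\<dots> \<le> (1 - \<rho>) / 4 * \<psi> w" using \<rho> \<psi>(1)[OF w] by (intro mult_left_mono) auto
      finally have 1: "A powr (3/2 - s) * E \<le> (1 - \<rho>) / 4 * \<psi> w" .
      have 2: "A powr (2 - s) * \<rho> * \<psi> w \<le> (1 + \<rho>) / 2 * \<psi> w"
        using s(1) \<psi>(1)[OF w] by (intro mult_right_mono) auto
      show "A powr (2 - s) * (\<rho> * \<psi> w) + A powr (3/2 - s) * E \<le> \<theta> * \<psi> w"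
        using 1 2 by (simp add: \<theta>_def field_simps)
    qed
    also have "\<dots> = ennreal \<theta> * ennreal (\<psi> w)" using \<theta> by (simp add: ennreal_mult')
    finally show ?thesis .
  qed
  have iter: "(transfer s ^^ n) (\<lambda>z. ennreal (\<psi> z)) w \<le> ennreal (\<theta> ^ n) * ennreal (\<psi> w)" if "w \<in> J" for n w
    using that
  proof (induction n arbitrary: w)
    case (Suc n)
    have "(transfer s ^^ Suc n) (\<lambda>z. ennreal (\<psi> z)) w = (transfer s ^^ n) (transfer s (\<lambda>z. ennreal (\<psi> z))) w"
      by (simp only: funpow_Suc_right o_apply)
    also have "\<dots> \<le> (transfer s ^^ n) (\<lambda>z. ennreal \<theta> * ennreal (\<psi> z)) w"
      by (rule funpow_transfer_mono_J[OF Suc.prems step])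
    also have "\<dots> = ennreal \<theta> * (transfer s ^^ n) (\<lambda>z. ennreal (\<psi> z)) w"
      by (rule funpow_transfer_cmult)
    also have "\<dots> \<le> ennreal \<theta> * (ennreal (\<theta> ^ n) * ennreal (\<psi> w))"
      by (intro mult_left_mono Suc) auto
    finally show ?case using \<theta> by (simp add: ennreal_mult mult.assoc)
  qed simp
  show ?thesis
  proof (rule that[of s \<theta> D])
    fix w n assume w: "w \<in> J"
    have "(transfer s ^^ n) (\<lambda>_. 1) w \<le> (transfer s ^^ n) (\<lambda>z. ennreal (\<psi> z)) w"
      using \<psi>(1) by (intro funpow_transfer_mono_J[OF w]) (simp add: ennreal_leI flip: ennreal_1)
    also have "\<dots> \<le> ennreal (\<theta> ^ n) * ennreal (\<psi> w)" by (rule iter[OF w])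
    also have "\<dots> \<le> ennreal (\<theta> ^ n) * ennreal D" using \<psi>(2)[OF w] by (intro mult_left_mono ennreal_leI) auto
    also have "\<dots> = ennreal (D * \<theta> ^ n)" using D \<theta> by (simp add: ennreal_mult mult.commute)
    finally show "(transfer s ^^ n) (\<lambda>_. 1) w \<le> ennreal (D * \<theta> ^ n)" .
  qed (use s \<theta> D in auto)
qed

text \<open>A Borel-Cantelli argument: a point whose orbit visits the disc infinitely often lies in
  pullbacks of arbitrarily large order, and the \<open>s\<close>-th powers of their diameters are
  bounded by a tail of the convergent sum of
  \<open>(transfer s ^^ n) (\<lambda>_. 1) w\<close>.\<close>

lemma recurrent_set_null:
  assumes s: "1 \<le> s" and \<theta>: "0 < \<theta>" "\<theta> < 1" and D: "0 < D"
    and contr: "\<And>n. (transfer s ^^ n) (\<lambda>_. 1) w \<le> ennreal (D * \<theta> ^ n)"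
    and w: "w \<in> J" and d: "0 < d" and R: "0 \<le> R"
  shows "hausdorff_content s d {z \<in> J. norm z \<le> R \<and> (\<exists>\<^sub>F n in sequentially. (f ^^ n) z \<in> ball w \<delta>)} = 0"
    (is "hausdorff_content s d ?Z = 0")
proof -
  \<comment> \<open>A pullback that contains a point of norm at most \<open>R\<close> has its centre
    within \<open>2 * \<delta> / c\<close> of that point. Pullbacks with centre beyond
    \<open>R'\<close> are replaced by the empty set below.\<close>
  define R' where "R' = R + 2 * \<delta> / c"
  have R': "0 \<le> R'" using R \<delta>_pos c_pos by (simp add: R'_def)
  \<comment> \<open>Converts weights into Euclidean diameters: a pullback has diameter at most
    \<open>3 * \<delta>\<close> times the derivative of its branch at \<open>w\<close>, and the
    metric costs a factor \<open>1 + R'\<close>.\<close>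
  define H where "H = (3 * \<delta> * (1 + R')) powr s"
  define \<Phi> where "\<Phi> p = (SOME \<phi>. inverse_branch (fst p) w \<phi> \<and> \<phi> w = snd p)" for p
  define U where "U p = (if norm (snd p) \<le> R' then \<Phi> p ` ball w \<delta> else {})" for p
  have wb: "w \<in> ball w \<delta>" using \<delta>_pos by simp
  have \<Phi>: "inverse_branch (fst p) w (\<Phi> p)" "\<Phi> p w = snd p" if "(f ^^ fst p) (snd p) = w" for p
    using someI_ex[OF inverse_branch_exists[OF w wb that]] unfolding \<Phi>_def by blast+
  have diam0: "diameter (U p) \<le> 3 * \<delta> * norm (deriv (\<Phi> p) w)" "bounded (U p)"
    if p: "(f ^^ fst p) (snd p) = w" for p
  proof -
    have ds: "dist x y \<le> 3 * \<delta> * norm (deriv (\<Phi> p) w)" if xy: "x \<in> U p" "y \<in> U p" for x y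
    proof -
      obtain x' y' where *: "x' \<in> ball w \<delta>" "y' \<in> ball w \<delta>" "x = \<Phi> p x'" "y = \<Phi> p y'"
        using xy by (auto simp: U_def split: if_splits)
      have "dist x y \<le> 5 / 4 * norm (deriv (\<Phi> p) w) * dist x' y'"
        using inverse_branch_lipschitz[OF \<Phi>(1)[OF p] w *(1,2)] *(3,4) by simp
      also have "\<dots> \<le> 5 / 4 * norm (deriv (\<Phi> p) w) * (2 * \<delta>)"
        using *(1,2) dist_triangle[of x' y' w] by (intro mult_left_mono) (auto simp: dist_commute)
      also have "\<dots> = 5 / 2 * (\<delta> * norm (deriv (\<Phi> p) w))" by simp
      also have "\<dots> \<le> 3 * (\<delta> * norm (deriv (\<Phi> p) w))"
        using \<delta>_pos by (intro mult_right_mono) auto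
      finally show ?thesis by simp
    qed
    then show "diameter (U p) \<le> 3 * \<delta> * norm (deriv (\<Phi> p) w)"
      using \<delta>_pos by (intro diameter_le) (auto simp: dist_norm)
    show "bounded (U p)"
    proof (cases "U p = {}")
      case False
      then obtain x where "x \<in> U p" by blast
      then show ?thesis using ds[of x] unfolding bounded_def by blast
    qed simp
  qed
  have dphi: "norm (deriv (\<Phi> p) w) = 1 / norm (deriv (f ^^ fst p) (snd p))" if p: "(f ^^ fst p) (snd p) = w" for p
    using inverse_branchD(3)[OF \<Phi>(1)[OF p] w wb] unfolding \<Phi>(2)[OF p]
    by (metis inverse_eq_divide inverse_unique)
  have gauge: "hausdorff_gauge s (U p) \<le> ennreal H * ennreal (weight (fst p) (snd p) powr s)"
    if p: "(f ^^ fst p) (snd p) = w" for p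
  proof (cases "norm (snd p) \<le> R'")
    case True
    have "norm (deriv (\<Phi> p) w) \<le> (1 + R') * weight (fst p) (snd p)"
    proof -
      have z: "0 < 1 + norm (snd p)" "1 \<le> 1 + norm w" by (smt (verit) norm_ge_zero)+
      have "1 * norm (deriv (\<Phi> p) w) \<le> ((1 + R') * ((1 + norm w) / (1 + norm (snd p)))) * norm (deriv (\<Phi> p) w)"
      proof (rule mult_right_mono)
        have "(1 + norm (snd p)) * 1 \<le> (1 + R') * (1 + norm w)"
          using True z R' by (intro mult_mono) auto
        then show "1 \<le> (1 + R') * ((1 + norm w) / (1 + norm (snd p)))"
          using z by (simp add: pos_le_divide_eq)
      qed simp
      then show ?thesis unfolding dphi[OF p] weight_def p by (simp add: mult_ac)
    qed
    then have "diameter (U p) \<le> 3 * \<delta> * ((1 + R') * weight (fst p) (snd p))"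
      using diam0(1)[OF p] \<delta>_pos by (meson less_imp_le mult_left_mono order_trans zero_less_mult_iff zero_less_numeral)
    then have "diameter (U p) powr s \<le> (3 * \<delta> * (1 + R') * weight (fst p) (snd p)) powr s"
      using s diameter_ge_0[OF diam0(2)[OF p]] by (intro powr_mono2) (auto simp: mult_ac)
    also have "\<dots> = H * weight (fst p) (snd p) powr s"
      unfolding H_def using \<delta>_pos R' weight_nonneg by (intro powr_mult)
    finally have "ennreal (diameter (U p) powr s) \<le> ennreal (H * weight (fst p) (snd p) powr s)"
      by (rule ennreal_leI)
    then show ?thesis using s by (simp add: hausdorff_gauge_def ennreal_mult H_def)
  qed (simp add: U_def hausdorff_gauge_def)
  have "hausdorff_content s d ?Z \<le> 0 + ennreal \<epsilon>" if \<epsilon>: "\<epsilon> > 0" for \<epsilon> :: real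
  proof -
    have "(\<lambda>n. H * (D * \<theta> ^ n * (1 / (1 - \<theta>)))) \<longlonglongrightarrow> H * (D * 0 * (1 / (1 - \<theta>)))"
      using \<theta> by (intro tendsto_intros LIMSEQ_power_zero) auto
    then have 1: "\<forall>\<^sub>F n in sequentially. H * (D * \<theta> ^ n * (1 / (1 - \<theta>))) < \<epsilon>"
      by (rule order_tendstoD) (use \<epsilon> in simp)
    have "(\<lambda>n. 3 * \<delta> / c * (1 / l) ^ n) \<longlonglongrightarrow> 3 * \<delta> / c * 0"
      using l_gt_1 by (intro tendsto_intros LIMSEQ_power_zero) auto
    then have 2: "\<forall>\<^sub>F n in sequentially. 3 * \<delta> / c * (1 / l) ^ n < d"
      by (rule order_tendstoD) (use d in simp)
    obtain N where N: "\<And>n. n \<ge> N \<Longrightarrow> H * (D * \<theta> ^ n * (1 / (1 - \<theta>))) < \<epsilon> \<and> 3 * \<delta> / c * (1 / l) ^ n < d"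
      using eventually_conj[OF 1 2] unfolding eventually_sequentially by blast
    let ?I = "Sigma {N..} (\<lambda>n. {z. (f ^^ n) z = w})"
    have "hausdorff_content s d ?Z \<le> (\<integral>\<^sup>+p. hausdorff_gauge s (U p) \<partial>count_space ?I)"
    proof (rule hausdorff_content_le)
      show "countable ?I" using countable_funpow_preimage by auto
      show "?Z \<subseteq> (\<Union>p\<in>?I. U p)"
      proof
        fix z assume "z \<in> ?Z"
        then have z: "norm z \<le> R" "\<exists>\<^sub>F n in sequentially. (f ^^ n) z \<in> ball w \<delta>" by auto
        obtain n where n: "n \<ge> N" "(f ^^ n) z \<in> ball w \<delta>"
          using z(2) unfolding frequently_sequentially by blast
        obtain \<phi> where \<phi>: "inverse_branch n w \<phi>" "\<phi> ((f ^^ n) z) = z"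
          using inverse_branch_exists[OF w n(2) refl] by blast
        have fw: "(f ^^ n) (\<phi> w) = w" by (rule inverse_branchD(2)[OF \<phi>(1) w wb])
        have "dist (\<phi> w) z \<le> 2 * \<delta> / (c * l ^ n)"
          using inverse_branch_dist_le[OF \<phi>(1) w n(2)] \<phi>(2) by simp
        also have "\<dots> \<le> 2 * \<delta> / c"
        proof -
          have "c * 1 \<le> c * l ^ n" using c_pos l_gt_1 by (intro mult_left_mono one_le_power) auto
          then show ?thesis using c_pos \<delta>_pos by (intro divide_left_mono) auto
        qed
        finally have "norm (\<phi> w) \<le> R'"
          using z(1) norm_triangle_sub[of "\<phi> w" z] by (simp add: R'_def dist_norm)
        moreover have "\<Phi> (n, \<phi> w) ((f ^^ n) z) = \<phi> ((f ^^ n) z)"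
        proof (rule inverse_branch_unique[of n w "\<Phi> (n, \<phi> w)" \<phi> w w])
          show "inverse_branch n w (\<Phi> (n, \<phi> w))" "\<Phi> (n, \<phi> w) w = \<phi> w"
            using \<Phi>[of "(n, \<phi> w)"] fw by auto
        qed (fact \<phi>(1) w wb n(2))+
        ultimately have "z \<in> U (n, \<phi> w)"
          using \<phi>(2) n(2) unfolding U_def by (auto simp: image_iff intro!: bexI[of _ "(f ^^ n) z"])
        then show "z \<in> (\<Union>p\<in>?I. U p)" using n(1) fw by blast
      qed
      show "0 \<le> d" using d by simp
      fix p assume "p \<in> ?I"
      then have p: "(f ^^ fst p) (snd p) = w" "N \<le> fst p" by auto
      have "diameter (U p) \<le> 3 * \<delta> * (1 / (c * l ^ fst p))"
        using diam0(1)[OF p(1)] inverse_branchD(7)[OF \<Phi>(1)[OF p(1)] w] \<delta>_pos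
        by (meson less_imp_le mult_left_mono order_trans zero_less_mult_iff zero_less_numeral)
      also have "\<dots> \<le> d" using N[OF p(2)] by (simp add: power_divide)
      finally show "bounded (U p) \<and> diameter (U p) \<le> d" using diam0(2)[OF p(1)] by blast
    qed
    also have "\<dots> \<le> (\<integral>\<^sup>+p. ennreal H * (ennreal (weight (fst p) (snd p) powr s) * 1) \<partial>count_space ?I)"
      using gauge by (intro nn_integral_mono) auto
    also have "\<dots> = ennreal H * (\<integral>\<^sup>+p. ennreal (weight (fst p) (snd p) powr s) * 1 \<partial>count_space ?I)"
      by (rule nn_integral_cmult) simp
    also have "\<dots> = ennreal H * (\<Sum>n. (transfer s ^^ (n + N)) (\<lambda>_. 1) w)"
      by (simp only: sum_funpow_transfer)
    also have "\<dots> \<le> ennreal H * (\<Sum>n. ennreal (D * \<theta> ^ (n + N)))"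
      by (intro mult_left_mono suminf_le contr) auto
    also have "(\<Sum>n. ennreal (D * \<theta> ^ (n + N))) = ennreal (D * \<theta> ^ N * (1 / (1 - \<theta>)))"
    proof -
      have "(\<lambda>n. D * \<theta> ^ N * \<theta> ^ n) sums (D * \<theta> ^ N * (1 / (1 - \<theta>)))"
        using \<theta> by (intro sums_mult geometric_sums) auto
      then have "(\<lambda>n. D * \<theta> ^ (n + N)) sums (D * \<theta> ^ N * (1 / (1 - \<theta>)))"
        by (simp add: power_add mult_ac)
      then show ?thesis using D \<theta> by (subst suminf_ennreal2) (auto simp: sums_iff)
    qed
    also have "ennreal H * ennreal (D * \<theta> ^ N * (1 / (1 - \<theta>))) = ennreal (H * (D * \<theta> ^ N * (1 / (1 - \<theta>))))"
      using D \<theta> by (intro ennreal_mult[symmetric]) (auto simp: H_def)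
    also have "\<dots> \<le> ennreal \<epsilon>" using N[of N] by (intro ennreal_leI) simp
    finally show ?thesis by simp
  qed
  then have "hausdorff_content s d ?Z \<le> 0" by (rule ennreal_le_epsilon)
  then show ?thesis by simp
qed

text \<open>A finite lower limit makes the orbit return infinitely often to some ball about 0. Its
  Julia points lie in finitely many discs of radius \<delta>, so one of these is visited infinitely
  often, and countably many null sets cover everything.\<close>

lemma HD_liminf_finite_less_2:
  "HD {z \<in> J. liminf (\<lambda>n. ereal (norm ((f ^^ n) z))) < \<infinity>} < 2"
proof -
  obtain s \<theta> D :: real where s: "1 \<le> s" "s < 2" and \<theta>: "0 < \<theta>" "\<theta> < 1" and D: "0 < D"
    and contr: "\<And>w n. w \<in> J \<Longrightarrow> (transfer s ^^ n) (\<lambda>_. 1) w \<le> ennreal (D * \<theta> ^ n)"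
    using transfer_contracts by metis
  \<comment> \<open>Here \<open>k\<close> is a radius and hides the constant of the locale.\<close>
  have "\<exists>W. W \<subseteq> J \<and> finite W \<and> J \<inter> cball 0 (real k) \<subseteq> (\<Union>w\<in>W. ball w \<delta>)" for k :: nat
  proof -
    have "compact (J \<inter> cball 0 (real k))" using J_closed by (simp add: closed_Int_compact)
    moreover have "J \<inter> cball 0 (real k) \<subseteq> (\<Union>w\<in>J \<inter> cball 0 (real k). ball w \<delta>)" using \<delta>_pos by auto
    ultimately obtain W where "W \<subseteq> J \<inter> cball 0 (real k)" "finite W" "J \<inter> cball 0 (real k) \<subseteq> (\<Union>w\<in>W. ball w \<delta>)"
      by (elim compactE_image) auto
    then show ?thesis by blast
  qed
  then obtain W where W: "\<And>k. W k \<subseteq> J" "\<And>k. finite (W k)" "\<And>k::nat. J \<inter> cball 0 (real k) \<subseteq> (\<Union>w\<in>W k. ball w \<delta>)"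
    by metis
  define Z where "Z p = {z \<in> J. norm z \<le> real (fst p) \<and> (\<exists>\<^sub>F n in sequentially. (f ^^ n) z \<in> ball (snd p) \<delta>)}"
    for p :: "nat \<times> complex"
  have sub: "{z \<in> J. liminf (\<lambda>n. ereal (norm ((f ^^ n) z))) < \<infinity>} \<subseteq> (\<Union>p\<in>Sigma UNIV W. Z p)"
  proof
    fix z assume "z \<in> {z \<in> J. liminf (\<lambda>n. ereal (norm ((f ^^ n) z))) < \<infinity>}"
    then have z: "z \<in> J" "liminf (\<lambda>n. ereal (norm ((f ^^ n) z))) < \<infinity>" by auto
    obtain m :: nat where m: "liminf (\<lambda>n. ereal (norm ((f ^^ n) z))) < ereal (real m)"
      using less_PInf_Ex_of_nat z(2) by auto
    obtain m' :: nat where m': "norm z \<le> real m'" using real_arch_simple by blast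
    define k where "k = max m m'"
    have fr: "\<exists>\<^sub>F n in sequentially. norm ((f ^^ n) z) \<le> real k"
    proof (rule ccontr)
      assume "\<not> (\<exists>\<^sub>F n in sequentially. norm ((f ^^ n) z) \<le> real k)"
      then have "\<forall>\<^sub>F n in sequentially. \<not> norm ((f ^^ n) z) \<le> real k"
        by (simp add: not_frequently)
      then have "\<forall>\<^sub>F n in sequentially. ereal (real m) \<le> ereal (norm ((f ^^ n) z))"
        by (rule eventually_mono) (simp add: k_def)
      then have "ereal (real m) \<le> liminf (\<lambda>n. ereal (norm ((f ^^ n) z)))"
        by (rule Liminf_bounded)
      then show False using m by simp
    qed
    have "\<exists>\<^sub>F n in sequentially. \<exists>w\<in>W k. (f ^^ n) z \<in> ball w \<delta>"
      using fr
    proof (rule frequently_elim1)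
      fix n assume "norm ((f ^^ n) z) \<le> real k"
      then have "(f ^^ n) z \<in> J \<inter> cball 0 (real k)" using z(1) funpow_in_J by simp
      then show "\<exists>w\<in>W k. (f ^^ n) z \<in> ball w \<delta>" using W(3) by blast
    qed
    from frequently_bex_finite[OF W(2) this]
    obtain w where w: "w \<in> W k" "\<exists>\<^sub>F n in sequentially. (f ^^ n) z \<in> ball w \<delta>"
      by blast
    then have "z \<in> Z (k, w)" using z(1) m' by (simp add: Z_def k_def)
    then show "z \<in> (\<Union>p\<in>Sigma UNIV W. Z p)" using w(1) by blast
  qed
  have "HD {z \<in> J. liminf (\<lambda>n. ereal (norm ((f ^^ n) z))) < \<infinity>} \<le> ereal s"
  proof (rule HD_le)
    fix d :: real assume d: "0 < d"
    have "hausdorff_content s d (\<Union>p\<in>Sigma UNIV W. Z p) = 0"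
    proof (rule hausdorff_content_UN_countable_null)
      show "countable (Sigma UNIV W)" using W(2) by (auto intro: countable_finite)
      fix p assume "p \<in> Sigma UNIV W"
      then have "snd p \<in> J" using W(1)[of "fst p"] by auto
      then show "hausdorff_content s d (Z p) = 0"
        unfolding Z_def using d by (intro recurrent_set_null[OF s(1) \<theta> D contr]) auto
    qed (use d in simp)
    then show "hausdorff_content s d {z \<in> J. liminf (\<lambda>n. ereal (norm ((f ^^ n) z))) < \<infinity>} = 0"
      using hausdorff_content_mono[OF sub, of s d] by simp
  qed (use s in simp)
  also have "ereal s < 2" using s(2) by simp
  finally show ?thesis .
qed

end

section \<open>The exponential and the cosine\<close>

text \<open>The common features of the cosine and of \<open>exp (- \<i> * \<zeta>)\<close>, where
  the factor \<open>- \<i>\<close> gives growth in the upper half-plane and the real period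
  \<open>2 * pi\<close>. \<open>S\<close> consists of singular values, and \<open>Q_lip\<close>
  controls log \<open>Q\<close> away from them. In \<open>onto\<close>, a square of side 7 is mapped
  over an annulus; \<open>preimages\<close> has two progressions because the cosine is even.\<close>

locale exp_like =
  fixes C :: "complex \<Rightarrow> complex" and Q :: "complex \<Rightarrow> real" and S :: "complex set"
  assumes C_holo: "C holomorphic_on UNIV"
    and norm_C_le: "\<And>\<zeta>. norm (C \<zeta>) \<le> exp \<bar>Im \<zeta>\<bar>"
    and deriv_C_ge: "\<And>\<zeta>. 0 \<le> Im \<zeta> \<Longrightarrow> sinh (Im \<zeta>) \<le> norm (deriv C \<zeta>)"
    and deriv_C_le: "\<And>\<zeta>. 0 \<le> Im \<zeta> \<Longrightarrow> norm (deriv C \<zeta>) \<le> exp (Im \<zeta>)"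
    and onto: "\<And>m x w. 0 \<le> m \<Longrightarrow> exp m \<le> norm w \<Longrightarrow> norm w \<le> sinh (m + 7) \<Longrightarrow>
       \<exists>\<zeta>. C \<zeta> = w \<and> x \<le> Re \<zeta> \<and> Re \<zeta> \<le> x + 7 \<and> m \<le> Im \<zeta> \<and> Im \<zeta> \<le> m + 7"
    and preimages: "\<And>w. \<exists>\<zeta>0 \<zeta>1. Re \<zeta>0 \<in> {0..2*pi} \<and> Re \<zeta>1 \<in> {0..2*pi} \<and>
       (\<forall>\<zeta>. C \<zeta> = w \<longrightarrow> (\<exists>k::int. \<zeta> = \<zeta>0 + of_real (2 * pi * of_int k) \<or> \<zeta> = \<zeta>1 + of_real (2 * pi * of_int k)))"
    and norm_deriv_C: "\<And>\<zeta>. norm (deriv C \<zeta>) = Q (C \<zeta>)"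
    and Q_ge: "\<And>w. 2 \<le> norm w \<Longrightarrow> norm w / 2 \<le> Q w"
    and S_nonempty: "S \<noteq> {}"
    and Q_lip: "\<And>d w u. 0 < d \<Longrightarrow> (\<And>s. s \<in> S \<Longrightarrow> d \<le> dist w s) \<Longrightarrow> Q u \<le> Q w * exp (dist w u / d)"
    and Q_low: "\<And>d. 0 < d \<Longrightarrow> \<exists>k>0. \<forall>w. (\<forall>s\<in>S. d \<le> dist w s) \<longrightarrow> k * (1 + norm w) \<le> Q w"
    and branch: "\<And>w r u \<zeta>. ball w r \<inter> S = {} \<Longrightarrow> u \<in> ball w r \<Longrightarrow> C \<zeta> = u \<Longrightarrow>
       \<exists>\<psi>. \<psi> holomorphic_on ball w r \<and> (\<forall>x\<in>ball w r. C (\<psi> x) = x) \<and> \<psi> u = \<zeta>"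
    and singular: "\<And>a b. a \<noteq> 0 \<Longrightarrow> S \<subseteq> sing_inv (\<lambda>z. C (a * z + b))"

section \<open>Elementary estimates for exponential, cosine and hyperbolic sine\<close>

lemma shift_into_interval:
  fixes x y :: real
  obtains k :: int where "y \<le> x + 2 * pi * of_int k" "x + 2 * pi * of_int k \<le> y + 2 * pi"
proof (rule that[of "\<lceil>(y - x) / (2 * pi)\<rceil>"])
  have "(y - x) / (2 * pi) \<le> of_int \<lceil>(y - x) / (2 * pi)\<rceil>" "of_int \<lceil>(y - x) / (2 * pi)\<rceil> \<le> (y - x) / (2 * pi) + 1"
    by linarith+
  then have "2 * pi * ((y - x) / (2 * pi)) \<le> 2 * pi * of_int \<lceil>(y - x) / (2 * pi)\<rceil>"
    "2 * pi * of_int \<lceil>(y - x) / (2 * pi)\<rceil> \<le> 2 * pi * ((y - x) / (2 * pi) + 1)"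
    using pi_gt_zero by (intro mult_left_mono; simp)+
  then show "y \<le> x + 2 * pi * of_int \<lceil>(y - x) / (2 * pi)\<rceil>" "x + 2 * pi * of_int \<lceil>(y - x) / (2 * pi)\<rceil> \<le> y + 2 * pi"
    by (simp_all add: distrib_left)
qed

lemma two_pi_le_7: "2 * pi \<le> 7"
  using pi_approx by simp

lemma exp_minus_i_shift: "exp (- \<i> * (\<zeta> + of_real (2 * pi * of_int k))) = exp (- \<i> * \<zeta>)"
  by (rule exp_eq[THEN iffD2], rule exI[of _ "- k"]) (simp add: algebra_simps)

lemma cos_shift: "cos (\<zeta> + of_real (2 * pi * of_int k)) = cos (\<zeta> :: complex)"
  by (rule complex_cos_eq[THEN iffD2], rule bexI[of _ "of_int k"]) (simp_all add: mult_ac)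

text \<open>By \<open>1 + x \<le> exp x\<close>, the logarithm of the distance to \<open>v\<close>
  grows at rate at most \<open>1 / d\<close> from a point at distance at least
  \<open>d\<close>.\<close>

lemma norm_shift_exp_bound:
  fixes w u v :: complex
  assumes "0 < d" "d \<le> dist w v"
  shows "norm (u - v) \<le> norm (w - v) * exp (dist w u / d)"
proof -
  have d: "0 < norm (w - v)" using assms unfolding dist_norm by linarith
  have "norm (u - v) \<le> norm (w - v) + dist w u"
    using dist_triangle[of u v w] by (simp add: dist_norm norm_minus_commute)
  also have "\<dots> = norm (w - v) * (1 + dist w u / norm (w - v))" using d by (simp add: distrib_left)
  also have "\<dots> \<le> norm (w - v) * (1 + dist w u / d)"
    using assms d by (intro mult_left_mono add_left_mono divide_left_mono) (auto simp: dist_norm)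
  also have "\<dots> \<le> norm (w - v) * exp (dist w u / d)"
    by (intro mult_left_mono exp_ge_add_one_self) auto
  finally show ?thesis .
qed

lemma one_plus_norm_le:
  fixes w v :: complex
  assumes "0 < d" "d \<le> dist w v"
  shows "1 / (1 + (1 + norm v) / d) * (1 + norm w) \<le> norm (w - v)"
proof -
  have "1 + norm w \<le> (1 + norm v) + norm (w - v)"
    using norm_triangle_sub[of w v] by simp
  moreover have "(1 + norm v) * 1 \<le> (1 + norm v) * (norm (w - v) / d)"
    using assms by (intro mult_left_mono) (auto simp: dist_norm add_nonneg_nonneg)
  moreover have "(1 + norm v) * (norm (w - v) / d) = (1 + norm v) / d * norm (w - v)" by simp
  ultimately have "1 + norm w \<le> (1 + (1 + norm v) / d) * norm (w - v)"
    by (simp only: distrib_right mult_1 mult_1_right)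
  moreover have "0 < 1 + (1 + norm v) / d"
    using assms(1) by (intro add_pos_nonneg divide_nonneg_pos) auto
  ultimately show ?thesis by (simp add: pos_divide_le_eq mult.commute)
qed

lemma sinh_le_exp: "sinh (x::real) \<le> exp x"
proof -
  have "(u - v) / 2 \<le> u" if "0 < u" "0 < v" for u v :: real using that by simp
  then show ?thesis unfolding sinh_field_def by (meson exp_gt_zero)
qed

lemma cosh_le_exp:
  assumes "0 \<le> x"
  shows "cosh (x::real) \<le> exp x"
proof -
  have "(u + v) / 2 \<le> u" if "v \<le> u" for u v :: real using that by simp
  then show ?thesis using assms by (simp add: cosh_field_def)
qed

lemma norm_cos_bounds: "\<bar>sinh (Im z)\<bar> \<le> norm (cos z)" "norm (cos z) \<le> cosh (Im z)"
proof -
  have c: "cos z = (exp (\<i> * z) + exp (- \<i> * z)) / 2" by (simp add: cos_exp_eq)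
  have n: "norm (exp (\<i> * z)) = exp (- Im z)" "norm (exp (- \<i> * z)) = exp (Im z)" by (simp_all add: norm_exp_eq_Re)
  have "norm (cos z) \<le> (exp (- Im z) + exp (Im z)) / 2"
    unfolding c norm_divide using norm_triangle_ineq[of "exp (\<i> * z)" "exp (- \<i> * z)"] n by simp
  then show "norm (cos z) \<le> cosh (Im z)" by (simp add: cosh_field_def add.commute)
  have "\<bar>exp (- Im z) - exp (Im z)\<bar> / 2 \<le> norm (cos z)"
    unfolding c norm_divide using norm_diff_ineq[of "exp (\<i> * z)" "exp (- \<i> * z)"]
      norm_diff_ineq[of "exp (- \<i> * z)" "exp (\<i> * z)"] n by (simp add: add.commute)
  then show "\<bar>sinh (Im z)\<bar> \<le> norm (cos z)" by (simp add: sinh_field_def abs_minus_commute)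
qed

lemma norm_sin_bounds: "\<bar>sinh (Im z)\<bar> \<le> norm (sin z)" "norm (sin z) \<le> cosh (Im z)"
  using norm_cos_bounds[of "z - of_real (pi / 2)"] by (simp_all add: cos_diff)

text \<open>Makes the annulus in \<open>onto\<close> thick: its outer radius is at least 42 times
  the inner one, which leaves room for the block of squares in \<open>many_children\<close>.\<close>

lemma sinh_shift_ge:
  assumes "0 \<le> (y::real)"
  shows "42 * exp y \<le> sinh (y + 7)"
proof -
  have e: "(2::real) \<le> exp 1" using exp_ge_add_one_self[of "1::real"] by simp
  have "(2::real) ^ 7 \<le> exp 1 ^ 7" by (rule power_mono[OF e]) simp
  also have "\<dots> = exp 7" by (simp flip: exp_of_nat_mult)
  finally have e7: "128 \<le> exp (7::real)" by simp
  have "128 * exp y \<le> exp y * exp 7" using mult_left_mono[OF e7, of "exp y"] by simp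
  then have 1: "128 * exp y \<le> exp (y + 7)" by (simp add: exp_add)
  have 2: "exp (- (y + 7)) \<le> 1" using assms by simp
  have 3: "1 \<le> exp y" using assms by simp
  have "42 * exp y * 2 \<le> exp (y + 7) - exp (- (y + 7))" using 1 2 3 by linarith
  then show ?thesis unfolding sinh_field_def by (simp only: pos_le_divide_eq zero_less_numeral)
qed

text \<open>The real part of \<zeta> has modulus at least
  \<open>2 * pi * (\<bar>i\<bar> - 1)\<close>, so norms grow linearly along a progression of
  preimages.\<close>

lemma norm_ge_of_shift:
  assumes "Re \<zeta>0 \<in> {0..2*pi}" "\<zeta> = \<zeta>0 + of_real (2 * pi * of_int i)"
  shows "1 + real (nat \<bar>i\<bar>) \<le> 2 * (1 + norm \<zeta>)"
proof -
  define r :: real where "r = \<bar>of_int i\<bar>"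
  have nat: "real (nat \<bar>i\<bar>) = r" by (simp add: r_def)
  have "2 * pi * of_int i = Re \<zeta> - Re \<zeta>0" using assms(2) by simp
  then have "\<bar>2 * pi * of_int i\<bar> \<le> \<bar>Re \<zeta>\<bar> + \<bar>Re \<zeta>0\<bar>" by (simp add: abs_triangle_ineq4)
  moreover have "\<bar>2 * pi * of_int i\<bar> = 2 * pi * r" by (simp add: abs_mult r_def)
  moreover have "\<bar>Re \<zeta>0\<bar> \<le> 2 * pi" using assms(1) by simp
  ultimately have "2 * pi * r \<le> norm \<zeta> + 2 * pi"
    using abs_Re_le_cmod[of \<zeta>] by linarith
  then have 1: "2 * pi * (r - 1) \<le> norm \<zeta>" by (simp add: right_diff_distrib)
  define N where "N = norm \<zeta>"
  have "r \<le> 1 + N"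
  proof (cases "r \<le> 1")
    case True
    then show ?thesis using norm_ge_zero[of \<zeta>, folded N_def] by linarith
  next
    case False
    then have "1 * (r - 1) \<le> 2 * pi * (r - 1)" using pi_ge_two by (intro mult_right_mono) auto
    with 1 have "1 * (r - 1) \<le> N" unfolding N_def by (rule order_trans[rotated])
    then show ?thesis by simp
  qed
  then show ?thesis
    unfolding nat N_def[symmetric] distrib_left using norm_ge_zero[of \<zeta>, folded N_def] by linarith
qed

interpretation exponential: exp_like "\<lambda>\<zeta>. exp (- \<i> * \<zeta>)" norm "{0}"
proof
  let ?C = "\<lambda>\<zeta>. exp (- \<i> * \<zeta>)"
  have dC: "deriv ?C \<zeta> = - \<i> * exp (- \<i> * \<zeta>)" for \<zeta>
    by (rule DERIV_imp_deriv) (auto intro!: derivative_eq_intros)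
  have nC: "norm (?C \<zeta>) = exp (Im \<zeta>)" for \<zeta> by (simp add: norm_exp_eq_Re)
  have ndC: "norm (deriv ?C \<zeta>) = exp (Im \<zeta>)" for \<zeta> by (simp only: dC norm_mult nC) simp
  have eqC: "\<exists>k::int. \<zeta> = \<zeta>' + of_real (2 * pi * of_int k)" if eq: "?C \<zeta> = ?C \<zeta>'" for \<zeta> \<zeta>'
  proof -
    obtain n :: int where n: "- \<i> * \<zeta> = - \<i> * \<zeta>' + (of_int (2 * n) * pi) * \<i>"
      using eq unfolding exp_eq by blast
    then have "\<i> * (- \<i> * \<zeta>) = \<i> * (- \<i> * \<zeta>' + (of_int (2 * n) * pi) * \<i>)" by simp
    then have "\<zeta> = \<zeta>' + of_real (2 * pi * of_int (- n))" by (simp add: algebra_simps)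
    then show ?thesis by blast
  qed
  show "?C holomorphic_on UNIV" by (intro holomorphic_intros)
  show "norm (?C \<zeta>) \<le> exp \<bar>Im \<zeta>\<bar>" for \<zeta> by (simp only: nC) simp
  show "sinh (Im \<zeta>) \<le> norm (deriv ?C \<zeta>)" "norm (deriv ?C \<zeta>) \<le> exp (Im \<zeta>)" for \<zeta>
    by (simp_all only: ndC sinh_le_exp order_refl)
  show "norm (deriv ?C \<zeta>) = norm (?C \<zeta>)" for \<zeta> by (simp only: ndC nC)
  show "\<exists>\<zeta>. ?C \<zeta> = w \<and> x \<le> Re \<zeta> \<and> Re \<zeta> \<le> x + 7 \<and> m \<le> Im \<zeta> \<and> Im \<zeta> \<le> m + 7"
    if m: "0 \<le> m" "exp m \<le> norm w" "norm w \<le> sinh (m + 7)" for m x and w :: complex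
  proof -
    have w: "w \<noteq> 0" using m(2) by (auto simp: not_le)
    obtain k :: int where k: "x \<le> Re (\<i> * Ln w) + 2 * pi * of_int k" "Re (\<i> * Ln w) + 2 * pi * of_int k \<le> x + 2 * pi"
      by (rule shift_into_interval)
    let ?z = "\<i> * Ln w + of_real (2 * pi * of_int k)"
    have "?C ?z = w" unfolding exp_minus_i_shift using w by simp
    moreover have "x \<le> Re ?z" "Re ?z \<le> x + 7" using k two_pi_le_7 by simp_all
    moreover have "Im ?z = ln (norm w)" using w by simp
    moreover have "m \<le> ln (norm w)" using m(2) w by (simp add: ln_ge_iff)
    moreover have "ln (norm w) \<le> m + 7"
      using order_trans[OF m(3) sinh_le_exp] w by (metis exp_gt_zero ln_exp ln_mono zero_less_norm_iff)
    ultimately show ?thesis by (intro exI[of _ ?z]) simp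
  qed
  show "\<exists>\<zeta>0 \<zeta>1. Re \<zeta>0 \<in> {0..2*pi} \<and> Re \<zeta>1 \<in> {0..2*pi} \<and>
       (\<forall>\<zeta>. ?C \<zeta> = w \<longrightarrow> (\<exists>k::int. \<zeta> = \<zeta>0 + of_real (2 * pi * of_int k) \<or> \<zeta> = \<zeta>1 + of_real (2 * pi * of_int k)))" for w
  proof (cases "\<exists>\<zeta>. ?C \<zeta> = w")
    case True
    then obtain \<zeta> where \<zeta>: "?C \<zeta> = w" by blast
    obtain k :: int where k: "0 \<le> Re \<zeta> + 2 * pi * of_int k" "Re \<zeta> + 2 * pi * of_int k \<le> 0 + 2 * pi"
      by (rule shift_into_interval)
    let ?z = "\<zeta> + of_real (2 * pi * of_int k)"
    have "?C ?z = w" using \<zeta> by (simp only: exp_minus_i_shift)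
    then have "\<forall>\<zeta>'. ?C \<zeta>' = w \<longrightarrow> (\<exists>k::int. \<zeta>' = ?z + of_real (2 * pi * of_int k))"
      using eqC[of _ ?z] by metis
    moreover have "Re ?z \<in> {0..2*pi}" using k by simp
    ultimately show ?thesis by blast
  next
    case False
    then show ?thesis by (intro exI[of _ 0]) auto
  qed
  show "norm w / 2 \<le> norm w" for w :: complex by simp
  show "norm u \<le> norm w * exp (dist w u / d)" if "0 < d" "\<And>s. s \<in> {0} \<Longrightarrow> d \<le> dist w s" for d and w u :: complex
    using norm_shift_exp_bound[of d w 0 u] that by simp
  show "\<exists>k>0. \<forall>w::complex. (\<forall>s\<in>{0}. d \<le> dist w s) \<longrightarrow> k * (1 + norm w) \<le> norm w" if d: "0 < d" for d
  proof (intro exI[of _ "1 / (1 + (1 + norm (0::complex)) / d)"] conjI allI impI)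
    show "0 < 1 / (1 + (1 + norm (0::complex)) / d)" using d by (simp add: add_pos_pos)
    fix w :: complex assume "\<forall>s\<in>{0}. d \<le> dist w s"
    then show "1 / (1 + (1 + norm (0::complex)) / d) * (1 + norm w) \<le> norm w"
      using one_plus_norm_le[of d w 0] d by simp
  qed
  show "\<exists>\<psi>. \<psi> holomorphic_on ball w r \<and> (\<forall>x\<in>ball w r. ?C (\<psi> x) = x) \<and> \<psi> u = \<zeta>"
    if b: "ball w r \<inter> {0} = {}" "u \<in> ball w r" "?C \<zeta> = u" for w r u \<zeta>
  proof -
    have "(\<lambda>x::complex. x) holomorphic_on ball w r" by (intro holomorphic_intros)
    moreover have "contractible (ball w r)" by (intro convex_imp_contractible convex_ball)
    moreover have "\<And>z. z \<in> ball w r \<Longrightarrow> z \<noteq> 0" using b(1) by auto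
    ultimately obtain g where g: "g holomorphic_on ball w r" "\<And>z. z \<in> ball w r \<Longrightarrow> z = exp (g z)"
      using contractible_imp_holomorphic_log[of "\<lambda>x. x" "ball w r"] by metis
    have gC: "?C (\<i> * g x) = x" if "x \<in> ball w r" for x
    proof -
      have "- \<i> * (\<i> * g x) = g x" by (simp add: mult.assoc[symmetric])
      then show ?thesis using g(2)[OF that] by simp
    qed
    obtain k :: int where k: "\<zeta> = \<i> * g u + of_real (2 * pi * of_int k)"
      using eqC[of \<zeta> "\<i> * g u"] gC[OF b(2)] b(3) by metis
    show ?thesis
    proof (intro exI[of _ "\<lambda>x. \<i> * g x + of_real (2 * pi * of_int k)"] conjI ballI)
      show "(\<lambda>x. \<i> * g x + of_real (2 * pi * of_int k)) holomorphic_on ball w r"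
        using g(1) by (intro holomorphic_intros)
      show "?C (\<i> * g x + of_real (2 * pi * of_int k)) = x" if "x \<in> ball w r" for x
        unfolding exp_minus_i_shift by (rule gC[OF that])
    qed (use k in simp)
  qed
  show "{0} \<subseteq> sing_inv (\<lambda>z. ?C (a * z + b))" if a: "a \<noteq> 0" for a b
  proof -
    \<comment> \<open>Chosen so that \<open>a * \<gamma> t + b = - \<i> * t\<close>, where the
      function has the value \<open>exp (- t)\<close>; so 0 is an asymptotic value.\<close>
    define \<gamma> where "\<gamma> t = (- \<i> * of_real t - b) / a" for t :: real
    have "filterlim (\<lambda>t. - \<i> * of_real t - b) at_infinity (at_top :: real filter)"
    proof -
      have "filterlim (\<lambda>t::real. norm (- \<i> * of_real t)) at_top at_top"
        by (simp add: norm_mult filterlim_abs_real)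
      then have "filterlim (\<lambda>t::real. - \<i> * of_real t) at_infinity at_top"
        by (simp only: filterlim_at_infinity_conv_norm_at_top)
      then show ?thesis
        using tendsto_add_filterlim_at_infinity'[of "\<lambda>t. - \<i> * of_real t" at_top "\<lambda>_. - b" "- b"] by simp
    qed
    then have "filterlim (\<lambda>t. norm (- \<i> * of_real t - b)) at_top (at_top :: real filter)"
      by (simp only: filterlim_at_infinity_conv_norm_at_top)
    then have "filterlim (\<lambda>t. inverse (norm a) * norm (- \<i> * of_real t - b)) at_top (at_top :: real filter)"
      by (intro filterlim_tendsto_pos_mult_at_top[OF tendsto_const]) (use a in simp_all)
    moreover have "norm (\<gamma> t) = inverse (norm a) * norm (- \<i> * of_real t - b)" for t
      by (simp add: \<gamma>_def norm_divide norm_mult norm_inverse divide_inverse mult.commute)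
    ultimately have "filterlim \<gamma> at_infinity at_top"
      by (simp only: filterlim_at_infinity_conv_norm_at_top)
    moreover have "continuous_on {0..} \<gamma>"
      unfolding \<gamma>_def using a by (intro continuous_intros) auto
    moreover have "((\<lambda>t. ?C (a * \<gamma> t + b)) \<longlongrightarrow> 0) at_top"
    proof -
      have "?C (a * \<gamma> t + b) = of_real (exp (- t))" for t
        using a by (simp add: \<gamma>_def exp_of_real[symmetric] mult.assoc[symmetric] del: exp_of_real)
      moreover have "((\<lambda>t::real. exp (- t)) \<longlongrightarrow> 0) at_top"
        using exp_at_bot filterlim_uminus_at_bot_at_top filterlim_compose by blast
      ultimately show ?thesis using tendsto_of_real[of "\<lambda>t::real. exp (- t)" 0 at_top] by simp
    qed
    ultimately show ?thesis
      unfolding sing_inv_def finite_asymptotic_values_def by blast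
  qed
qed simp

text \<open>The formula for \<open>Q\<close> is the square root of the modulus of
  \<open>1 - cos^2\<close>. Writing \<open>w - (-1)\<close> makes both factors distances to a
  singular value, the form used in \<open>norm_shift_exp_bound\<close> and
  \<open>one_plus_norm_le\<close>.\<close>

interpretation cosine: exp_like cos "\<lambda>w. sqrt (norm (w - 1) * norm (w - (-1)))" "{1, -1}"
proof
  let ?Q = "\<lambda>w::complex. sqrt (norm (w - 1) * norm (w - (-1)))"
  have dC: "deriv cos \<zeta> = - sin \<zeta>" for \<zeta> :: complex
    by (rule DERIV_imp_deriv) (auto intro!: derivative_eq_intros)
  have eqC: "\<exists>k::int. \<zeta> = \<zeta>' + of_real (2 * pi * of_int k) \<or> \<zeta> = - \<zeta>' + of_real (2 * pi * of_int k)"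
    if eq: "cos \<zeta> = cos \<zeta>'" for \<zeta> \<zeta>' :: complex
  proof -
    obtain n where "n \<in> \<int>" and n: "\<zeta> = \<zeta>' + of_real (2 * n * pi) \<or> \<zeta> = - \<zeta>' + of_real (2 * n * pi)"
      using eq unfolding complex_cos_eq by blast
    then obtain k where "n = of_int k" by (elim Ints_cases)
    then show ?thesis using n by (intro exI[of _ k]) (simp add: mult_ac)
  qed
  \<comment> \<open>As the cosine is even, the sign of \<open>Arccos w\<close> can be chosen to
    reach the upper half-plane.\<close>
  have surj: "\<exists>\<zeta>. cos \<zeta> = w \<and> 0 \<le> Im \<zeta>" for w
    using cos_Arccos[of w] by (cases "0 \<le> Im (Arccos w)") (auto intro: exI[of _ "Arccos w"] exI[of _ "- Arccos w"])
  show "cos holomorphic_on (UNIV :: complex set)" by (intro holomorphic_intros)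
  show "norm (cos \<zeta>) \<le> exp \<bar>Im \<zeta>\<bar>" for \<zeta> :: complex
    using norm_cos_bounds(2)[of \<zeta>] cosh_le_exp[of "\<bar>Im \<zeta>\<bar>"] by (simp add: cosh_real_abs)
  show "sinh (Im \<zeta>) \<le> norm (deriv cos \<zeta>)" if "0 \<le> Im \<zeta>" for \<zeta>
    using norm_sin_bounds(1)[of \<zeta>] by (simp add: dC)
  show "norm (deriv cos \<zeta>) \<le> exp (Im \<zeta>)" if "0 \<le> Im \<zeta>" for \<zeta>
    using norm_sin_bounds(2)[of \<zeta>] cosh_le_exp[OF that] by (simp add: dC)
  show "norm (deriv cos \<zeta>) = ?Q (cos \<zeta>)" for \<zeta>
  proof -
    have "(norm (sin \<zeta>))\<^sup>2 = norm ((sin \<zeta>)\<^sup>2)" by (simp add: norm_power)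
    also have "(sin \<zeta>)\<^sup>2 = - ((cos \<zeta> - 1) * (cos \<zeta> - (-1)))"
      by (simp add: sin_squared_eq power2_eq_square algebra_simps)
    also have "norm (- ((cos \<zeta> - 1) * (cos \<zeta> - (-1)))) = norm (cos \<zeta> - 1) * norm (cos \<zeta> - (-1))"
      by (simp only: norm_minus_cancel norm_mult)
    finally show ?thesis by (simp add: dC real_sqrt_unique[symmetric])
  qed
  show "\<exists>\<zeta>. cos \<zeta> = w \<and> x \<le> Re \<zeta> \<and> Re \<zeta> \<le> x + 7 \<and> m \<le> Im \<zeta> \<and> Im \<zeta> \<le> m + 7"
    if m: "0 \<le> m" "exp m \<le> norm w" "norm w \<le> sinh (m + 7)" for m x and w :: complex
  proof -
    obtain \<zeta> where \<zeta>: "cos \<zeta> = w" "0 \<le> Im \<zeta>" using surj by blast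
    obtain k :: int where k: "x \<le> Re \<zeta> + 2 * pi * of_int k" "Re \<zeta> + 2 * pi * of_int k \<le> x + 2 * pi"
      by (rule shift_into_interval)
    let ?z = "\<zeta> + of_real (2 * pi * of_int k)"
    have "exp m \<le> exp (Im \<zeta>)"
      using m(2) norm_cos_bounds(2)[of \<zeta>, unfolded \<zeta>(1)] cosh_le_exp[OF \<zeta>(2)] by linarith
    then have "m \<le> Im \<zeta>" by simp
    moreover have "sinh (Im \<zeta>) \<le> sinh (m + 7)"
      using m(3) norm_cos_bounds(1)[of \<zeta>, unfolded \<zeta>(1)] by linarith
    then have "Im \<zeta> \<le> m + 7" by simp
    moreover have "cos ?z = w" unfolding cos_shift by (rule \<zeta>(1))
    moreover have "x \<le> Re ?z" "Re ?z \<le> x + 7" using k two_pi_le_7 by simp_all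
    ultimately show ?thesis by (intro exI[of _ ?z]) simp
  qed
  show "\<exists>\<zeta>0 \<zeta>1. Re \<zeta>0 \<in> {0..2*pi} \<and> Re \<zeta>1 \<in> {0..2*pi} \<and>
       (\<forall>\<zeta>. cos \<zeta> = w \<longrightarrow> (\<exists>k::int. \<zeta> = \<zeta>0 + of_real (2 * pi * of_int k) \<or> \<zeta> = \<zeta>1 + of_real (2 * pi * of_int k)))" for w
  proof -
    obtain \<zeta> where \<zeta>: "cos \<zeta> = w" using surj by blast
    obtain k :: int where k: "0 \<le> Re \<zeta> + 2 * pi * of_int k" "Re \<zeta> + 2 * pi * of_int k \<le> 0 + 2 * pi"
      by (rule shift_into_interval)
    obtain k' :: int where k': "0 \<le> Re (- \<zeta>) + 2 * pi * of_int k'" "Re (- \<zeta>) + 2 * pi * of_int k' \<le> 0 + 2 * pi"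
      by (rule shift_into_interval)
    let ?z = "\<zeta> + of_real (2 * pi * of_int k)" and ?z' = "- \<zeta> + of_real (2 * pi * of_int k')"
    have "\<exists>j::int. \<zeta>' = ?z + of_real (2 * pi * of_int j) \<or> \<zeta>' = ?z' + of_real (2 * pi * of_int j)"
      if \<zeta>': "cos \<zeta>' = w" for \<zeta>'
    proof -
      obtain j :: int where "\<zeta>' = \<zeta> + of_real (2 * pi * of_int j) \<or> \<zeta>' = - \<zeta> + of_real (2 * pi * of_int j)"
        using eqC[of \<zeta>' \<zeta>] \<zeta> \<zeta>' by metis
      then show ?thesis
      proof
        assume "\<zeta>' = \<zeta> + of_real (2 * pi * of_int j)"
        then have "\<zeta>' = ?z + of_real (2 * pi * of_int (j - k))" by (simp add: algebra_simps)
        then show ?thesis by blast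
      next
        assume "\<zeta>' = - \<zeta> + of_real (2 * pi * of_int j)"
        then have "\<zeta>' = ?z' + of_real (2 * pi * of_int (j - k'))" by (simp add: algebra_simps)
        then show ?thesis by blast
      qed
    qed
    moreover have "Re ?z \<in> {0..2*pi}" "Re ?z' \<in> {0..2*pi}" using k k' by simp_all
    ultimately show ?thesis by blast
  qed
  show "norm w / 2 \<le> ?Q w" if w: "2 \<le> norm w" for w :: complex
  proof (rule real_le_rsqrt)
    have "norm w / 2 \<le> norm (w - 1)" using norm_triangle_ineq2[of w 1] w by simp
    moreover have "norm w / 2 \<le> norm (w - (-1))" using norm_triangle_ineq2[of w "-1"] w by simp
    ultimately show "(norm w / 2)\<^sup>2 \<le> norm (w - 1) * norm (w - (-1))"
      unfolding power2_eq_square by (intro mult_mono) auto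
  qed
  show "?Q u \<le> ?Q w * exp (dist w u / d)" if d: "0 < d" "\<And>s. s \<in> {1, -1} \<Longrightarrow> d \<le> dist w s" for d and w u :: complex
  proof -
    have "norm (u - 1) * norm (u - (-1)) \<le>
        (norm (w - 1) * exp (dist w u / d)) * (norm (w - (-1)) * exp (dist w u / d))"
      using norm_shift_exp_bound[of d w 1 u] norm_shift_exp_bound[of d w "-1" u] d by (intro mult_mono) auto
    also have "\<dots> = (norm (w - 1) * norm (w - (-1))) * (exp (dist w u / d))\<^sup>2"
      by (simp add: power2_eq_square)
    finally have "?Q u \<le> sqrt ((norm (w - 1) * norm (w - (-1))) * (exp (dist w u / d))\<^sup>2)"
      by (rule real_sqrt_le_mono)
    then show ?thesis by (simp only: real_sqrt_mult real_sqrt_abs abs_exp_cancel)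
  qed
  show "\<exists>k>0. \<forall>w::complex. (\<forall>s\<in>{1, -1}. d \<le> dist w s) \<longrightarrow> k * (1 + norm w) \<le> ?Q w" if d: "0 < d" for d
  proof (intro exI[of _ "1 / (1 + 2 / d)"] conjI allI impI)
    show k: "0 < 1 / (1 + 2 / d)" using d by (simp add: add_pos_pos)
    fix w :: complex assume w: "\<forall>s\<in>{1, -1}. d \<le> dist w s"
    have "1 / (1 + 2 / d) * (1 + norm w) \<le> norm (w - 1)" "1 / (1 + 2 / d) * (1 + norm w) \<le> norm (w - (-1))"
      using one_plus_norm_le[of d w 1] one_plus_norm_le[of d w "-1"] w d by simp_all
    then have "(1 / (1 + 2 / d) * (1 + norm w))\<^sup>2 \<le> norm (w - 1) * norm (w - (-1))"
      unfolding power2_eq_square using k by (intro mult_mono mult_nonneg_nonneg) (auto simp: add_nonneg_nonneg)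
    then show "1 / (1 + 2 / d) * (1 + norm w) \<le> ?Q w" by (rule real_le_rsqrt)
  qed
  show "\<exists>\<psi>. \<psi> holomorphic_on ball w r \<and> (\<forall>x\<in>ball w r. cos (\<psi> x) = x) \<and> \<psi> u = \<zeta>"
    if b: "ball w r \<inter> {1, -1} = {}" "u \<in> ball w r" "cos \<zeta> = u" for w r u \<zeta>
  proof -
    have "(\<lambda>x::complex. x) holomorphic_on ball w r" by (intro holomorphic_intros)
    moreover have "contractible (ball w r)" by (intro convex_imp_contractible convex_ball)
    moreover have "\<And>z. z \<in> ball w r \<Longrightarrow> z \<noteq> 1 \<and> z \<noteq> -1" using b(1) by auto
    ultimately obtain g where g: "g holomorphic_on ball w r" "\<And>z. z \<in> ball w r \<Longrightarrow> z = cos (g z)"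
      using contractible_imp_holomorphic_arccos[of "\<lambda>x. x" "ball w r"] by metis
    obtain k :: int where k: "\<zeta> = g u + of_real (2 * pi * of_int k) \<or> \<zeta> = - g u + of_real (2 * pi * of_int k)"
      using eqC[of \<zeta> "g u"] g(2)[OF b(2)] b(3) by metis
    then show ?thesis
    proof
      assume "\<zeta> = g u + of_real (2 * pi * of_int k)"
      moreover have "(\<lambda>x. g x + of_real (2 * pi * of_int k)) holomorphic_on ball w r"
        using g(1) by (intro holomorphic_intros)
      moreover have "cos (g x + of_real (2 * pi * of_int k)) = x" if "x \<in> ball w r" for x
        unfolding cos_shift using g(2)[OF that] by simp
      ultimately show ?thesis by (intro exI[of _ "\<lambda>x. g x + of_real (2 * pi * of_int k)"]) blast
    next
      assume "\<zeta> = - g u + of_real (2 * pi * of_int k)"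
      moreover have "(\<lambda>x. - g x + of_real (2 * pi * of_int k)) holomorphic_on ball w r"
        using g(1) by (intro holomorphic_intros)
      moreover have "cos (- g x + of_real (2 * pi * of_int k)) = x" if "x \<in> ball w r" for x
        unfolding cos_shift using g(2)[OF that] by simp
      ultimately show ?thesis by (intro exI[of _ "\<lambda>x. - g x + of_real (2 * pi * of_int k)"]) blast
    qed
  qed
  show "{1, -1} \<subseteq> sing_inv (\<lambda>z. cos (a * z + b))" if a: "a \<noteq> 0" for a b :: complex
  proof -
    have d: "deriv (\<lambda>z. cos (a * z + b)) z = - sin (a * z + b) * a" for z
      by (rule DERIV_imp_deriv) (auto intro!: derivative_eq_intros)
    have "a * (- b / a) + b = 0" using a by simp
    then have "1 \<in> critical_values (\<lambda>z. cos (a * z + b))"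
      unfolding critical_values_def by (intro image_eqI[of _ _ "- b / a"]) (simp_all only: d mem_Collect_eq, simp_all)
    moreover have "a * ((of_real pi - b) / a) + b = of_real pi" using a by simp
    then have "-1 \<in> critical_values (\<lambda>z. cos (a * z + b))"
      unfolding critical_values_def
      by (intro image_eqI[of _ _ "(of_real pi - b) / a"]) (simp_all only: d mem_Collect_eq, simp_all flip: cos_of_real sin_of_real)
    ultimately have "1 \<in> critical_values (\<lambda>z. cos (a * z + b))" "-1 \<in> critical_values (\<lambda>z. cos (a * z + b))"
      by blast+
    then show ?thesis by (simp add: sing_inv_def)
  qed
qed simp

section \<open>Affine precompositions\<close>

locale exp_like_map = exp_like +
  fixes a b :: complex
  assumes a_nonzero: "a \<noteq> 0"
begin

definition F :: "complex \<Rightarrow> complex" where "F z = C (a * z + b)"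

text \<open>The conjugate of \<open>F\<close> under the affine map \<open>a * z + b\<close>; in this
  coordinate the period of \<open>C\<close> is real and fits the grid.\<close>

definition G :: "complex \<Rightarrow> complex" where "G \<zeta> = a * C \<zeta> + b"

lemma F_holo: "F holomorphic_on UNIV"
proof -
  have "(C \<circ> (\<lambda>z. a * z + b)) holomorphic_on UNIV"
    by (rule holomorphic_on_compose) (auto intro!: holomorphic_intros holomorphic_on_subset[OF C_holo])
  then show ?thesis by (simp add: comp_def F_def[abs_def])
qed

lemma deriv_F: "deriv F z = deriv C (a * z + b) * a"
proof -
  have 1: "(C has_field_derivative deriv C (a * z + b)) (at (a * z + b))"
    using C_holo by (rule holomorphic_derivI[OF _ open_UNIV]) simp
  have 2: "((\<lambda>z. a * z + b) has_field_derivative a) (at z)"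
    by (auto intro!: derivative_eq_intros)
  show ?thesis unfolding F_def[abs_def] by (rule DERIV_imp_deriv[OF DERIV_chain2[OF 1 2]])
qed

lemma norm_deriv_F: "norm (deriv F z) = norm a * Q (F z)"
  by (simp add: deriv_F norm_mult norm_deriv_C F_def)

lemma G_semiconj: "(G ^^ n) (a * z + b) = a * (F ^^ n) z + b"
  by (induction n) (simp_all add: G_def F_def)

lemma norm_F_le: "norm (F w) \<le> exp ((norm a + norm b) * (1 + norm w))"
proof -
  have "norm (F w) \<le> exp \<bar>Im (a * w + b)\<bar>" unfolding F_def by (rule norm_C_le)
  also have "\<bar>Im (a * w + b)\<bar> \<le> norm (a * w + b)" by (rule abs_Im_le_cmod)
  also have "\<dots> \<le> norm a * norm w + norm b"
    using norm_triangle_ineq[of "a * w" b] by (simp add: norm_mult)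
  also have "\<dots> \<le> (norm a + norm b) * (1 + norm w)"
    by (simp add: algebra_simps add_nonneg_nonneg)
  finally show ?thesis by simp
qed

lemma julia_setI_growth:
  assumes "\<And>n. 2 \<le> norm (deriv F ((F ^^ n) z))"
  shows "z \<in> julia_set F"
proof (rule julia_setI_deriv_at_top[OF F_holo _ _ _ norm_F_le])
  show "0 < norm a / 2" using a_nonzero by simp
  show "0 < norm a + norm b" using a_nonzero by (simp add: add_pos_nonneg)
  show "norm a / 2 * norm (F w) \<le> norm (deriv F w)" if "2 \<le> norm (F w)" for w
    using mult_left_mono[OF Q_ge[OF that], of "norm a"] by (simp add: norm_deriv_F)
  have ge: "2 ^ n \<le> norm (deriv (F ^^ n) z)" for n
  proof (induction n)
    case (Suc n)
    have "2 * 2 ^ n \<le> norm (deriv F ((F ^^ n) z)) * norm (deriv (F ^^ n) z)"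
      using Suc assms[of n] by (intro mult_mono) auto
    then show ?case unfolding deriv_funpow_Suc[OF F_holo] norm_mult by simp
  qed (simp add: id_def)
  have "filterlim (\<lambda>n. 2 ^ n :: real) at_top sequentially"
    by real_asymp
  then show "filterlim (\<lambda>n. norm (deriv (F ^^ n) z)) at_top sequentially"
    by (rule filterlim_at_top_mono) (use ge in simp)
qed

section \<open>High squares and the dimension of the Julia set\<close>

definition good :: "real \<Rightarrow> (int \<times> int) set" where
  "good X = {p. X \<le> 7 * of_int (snd p)}"

definition lip :: "int \<times> int \<Rightarrow> real" where
  "lip p = norm a * exp (7 * of_int (snd p) + 7)"

lemma G_lipschitz:
  assumes p: "p \<in> good X" "0 \<le> X" and xy: "x \<in> grid_square p" "y \<in> grid_square p"
  shows "dist (G x) (G y) \<le> lip p * dist x y"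
  unfolding dist_norm
proof (rule field_differentiable_bound[of "grid_square p" G "\<lambda>\<zeta>. a * deriv C \<zeta>"])
  show "convex (grid_square p)" by (simp add: grid_square_def)
  fix z assume z: "z \<in> grid_square p"
  have "(C has_field_derivative deriv C z) (at z)"
    using C_holo by (rule holomorphic_derivI[OF _ open_UNIV]) simp
  then have "(G has_field_derivative a * deriv C z) (at z)"
    unfolding G_def[abs_def] by (auto intro!: derivative_eq_intros)
  then show "(G has_field_derivative a * deriv C z) (at z within grid_square p)"
    by (rule has_field_derivative_at_within)
  have Im: "0 \<le> Im z" "Im z \<le> 7 * of_int (snd p) + 7"
    using z p by (auto simp: mem_grid_square good_def)
  have "norm (deriv C z) \<le> exp (7 * of_int (snd p) + 7)"
    using deriv_C_le[OF Im(1)] Im(2) by (meson exp_le_cancel_iff order_trans)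
  then show "norm (a * deriv C z) \<le> lip p"
    by (simp add: norm_mult lip_def mult_left_mono)
qed (use xy in auto)

lemma continuous_on_G: "continuous_on UNIV G"
  unfolding G_def[abs_def]
  by (intro continuous_intros holomorphic_on_imp_continuous_on C_holo)

text \<open>On a square with lower edge at height \<open>y\<close>, \<open>G\<close> covers the
  annulus about \<open>b\<close> with radii \<rho> and \<open>42 * \<rho>\<close>. The children form
  a block of at least \<open>\<rho> * \<rho>\<close> squares that starts \<open>2 * \<rho>\<close>
  above \<open>b\<close>, hence outside the inner circle and above height \<open>X\<close>. The
  proportion is \<open>exp (-14)\<close> since \<open>lip p\<close> is
  \<open>exp 7 * \<rho>\<close>.\<close>

lemma many_children:
  assumes p: "p \<in> good X" and X: "0 \<le> X" "2 \<le> norm a * exp X" "X + norm b \<le> norm a * exp X"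
  shows "exp (-14) * (lip p)\<^sup>2 \<le> real (card (grid_children G (good X) p))"
proof -
  define y where "y = 7 * real_of_int (snd p)"
  define \<rho> where "\<rho> = norm a * exp y"
  have y: "X \<le> y" using p by (simp add: good_def y_def)
  have "norm a * exp X \<le> \<rho>" unfolding \<rho>_def using y by (intro mult_left_mono) auto
  then have \<rho>: "2 \<le> \<rho>" "X + norm b \<le> \<rho>" using X by linarith+
  define i0 where "i0 = \<lceil>Re b / 7\<rceil>"
  define j0 where "j0 = \<lceil>(Im b + 2 * \<rho>) / 7\<rceil>"
  let ?I = "{i0..i0 + \<lfloor>\<rho>\<rfloor>} \<times> {j0..j0 + \<lfloor>\<rho>\<rfloor>}"
  have c: "s \<le> 7 * of_int \<lceil>s / 7\<rceil>" "7 * of_int \<lceil>s / 7\<rceil> \<le> s + 7" for s :: real by linarith+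
  have i0: "Re b \<le> 7 * of_int i0" "7 * of_int i0 \<le> Re b + 7" unfolding i0_def by (rule c)+
  have j0: "Im b + 2 * \<rho> \<le> 7 * of_int j0" "7 * of_int j0 \<le> Im b + 2 * \<rho> + 7" unfolding j0_def by (rule c)+
  have "?I \<subseteq> grid_children G (good X) p"
  proof
    fix p' assume "p' \<in> ?I"
    then have p': "i0 \<le> fst p'" "fst p' \<le> i0 + \<lfloor>\<rho>\<rfloor>" "j0 \<le> snd p'" "snd p' \<le> j0 + \<lfloor>\<rho>\<rfloor>" by auto
    then have r: "of_int i0 \<le> (of_int (fst p') :: real)" "(of_int (fst p') :: real) \<le> of_int i0 + \<rho>"
      "of_int j0 \<le> (of_int (snd p') :: real)" "(of_int (snd p') :: real) \<le> of_int j0 + \<rho>"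
      by linarith+
    have "p' \<in> good X"
      using r(3) j0(1) \<rho> abs_Im_le_cmod[of b] unfolding good_def mem_Collect_eq by linarith
    moreover have "grid_square p' \<subseteq> G ` grid_square p"
    proof
      fix \<zeta> assume "\<zeta> \<in> grid_square p'"
      then have "7 * of_int (fst p') \<le> Re \<zeta>" "Re \<zeta> \<le> 7 * of_int (fst p') + 7"
         "7 * of_int (snd p') \<le> Im \<zeta>" "Im \<zeta> \<le> 7 * of_int (snd p') + 7" by (auto simp: mem_grid_square)
      \<comment> \<open>The generous factors 20 and 22 add up to 42.\<close>
      then have R: "0 \<le> Re (\<zeta> - b)" "Re (\<zeta> - b) \<le> 20 * \<rho>" and I: "2 * \<rho> \<le> Im (\<zeta> - b)" "Im (\<zeta> - b) \<le> 22 * \<rho>"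
        using r i0 j0 \<rho> unfolding minus_complex.simps by linarith+
      have lo: "\<rho> \<le> norm (\<zeta> - b)" using abs_Im_le_cmod[of "\<zeta> - b"] I \<rho> by linarith
      have hi: "norm (\<zeta> - b) \<le> 42 * \<rho>" using cmod_le[of "\<zeta> - b"] R I by linarith
      have na: "0 < norm a" using a_nonzero by simp
      define w where "w = (\<zeta> - b) / a"
      have nw: "norm w = norm (\<zeta> - b) / norm a" by (simp add: w_def norm_divide)
      have "exp y \<le> norm w" using lo na by (simp add: nw \<rho>_def pos_le_divide_eq mult.commute)
      moreover have "norm w \<le> 42 * exp y" using hi na by (simp add: nw \<rho>_def pos_divide_le_eq mult_ac)
      then have "norm w \<le> sinh (y + 7)" using sinh_shift_ge[of y] y X by linarith
      ultimately obtain \<zeta>' where \<zeta>': "C \<zeta>' = w" "7 * of_int (fst p) \<le> Re \<zeta>'" "Re \<zeta>' \<le> 7 * of_int (fst p) + 7"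
        "y \<le> Im \<zeta>'" "Im \<zeta>' \<le> y + 7"
        using onto[of y w "7 * of_int (fst p)"] y X by force
      have "\<zeta>' \<in> grid_square p" using \<zeta>' by (simp add: mem_grid_square y_def)
      moreover have "G \<zeta>' = \<zeta>" using \<zeta>'(1) a_nonzero by (simp add: G_def w_def)
      ultimately show "\<zeta> \<in> G ` grid_square p" by blast
    qed
    ultimately show "p' \<in> grid_children G (good X) p" by (simp add: grid_children_def)
  qed
  then have "card ?I \<le> card (grid_children G (good X) p)"
    by (rule card_mono[OF finite_grid_children[OF continuous_on_G]])
  moreover have "\<rho> * \<rho> \<le> real (card ?I)"
  proof -
    have "\<rho> \<le> real (card {i..i + \<lfloor>\<rho>\<rfloor>})" for i using \<rho> by simp
    then show ?thesis unfolding card_cartesian_product of_nat_mult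
      using \<rho> by (intro mult_mono) auto
  qed
  moreover have "exp (-14) * (lip p)\<^sup>2 = \<rho> * \<rho>"
  proof -
    have "exp (-14) * (exp (y + 7))\<^sup>2 = exp y * exp (y::real)"
      by (simp add: power2_eq_square flip: exp_add)
    then show ?thesis by (simp add: lip_def \<rho>_def y_def power_mult_distrib power2_eq_square mult_ac)
  qed
  ultimately show ?thesis by linarith
qed

lemma grid_level_orbit:
  assumes "\<zeta> \<in> grid_level G Gd n p" "p \<in> Gd" "k \<le> n"
  shows "\<exists>p'\<in>Gd. (G ^^ k) \<zeta> \<in> grid_square p'"
  using assms
proof (induction k arbitrary: \<zeta> n p)
  case 0
  then show ?case using grid_level_subset by fastforce
next
  case (Suc k)
  then obtain n' where n: "n = Suc n'" by (cases n) auto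
  then obtain p' where "p' \<in> grid_children G Gd p" "G \<zeta> \<in> grid_level G Gd n' p'"
    using Suc.prems by auto
  moreover from this have "p' \<in> Gd" by (simp add: grid_children_def)
  ultimately show ?case using Suc.IH[of "G \<zeta>" n' p'] Suc.prems n by (simp add: funpow_swap1)
qed

text \<open>If the content vanished, finitely many open sets with a small sum of powers would cover
  the compact set \<open>K\<close>. In the coordinate of \<open>G\<close> they would, by compactness
  of the nested levels, already cover a finite level, against
  \<open>grid_level_cover_sum_ge\<close>.\<close>

lemma hausdorff_content_julia_pos:
  assumes t: "1 \<le> t" "t < 2"
  shows "0 < hausdorff_content t 1 (julia_set F)"
proof (rule ccontr)
  assume "\<not> 0 < hausdorff_content t 1 (julia_set F)"
  then have null: "hausdorff_content t 1 (julia_set F) = 0" by simp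
  have na: "0 < norm a" using a_nonzero by simp
  have top: "filterlim (\<lambda>X::real. norm a * exp X) at_top at_top"
    by (rule filterlim_tendsto_pos_mult_at_top[OF tendsto_const na exp_at_top])
  have 1: "\<forall>\<^sub>F X in at_top. 2 \<le> norm a * exp X" using top unfolding filterlim_at_top by blast
  have 2: "\<forall>\<^sub>F X in at_top. X + norm b \<le> norm a * exp X"
    using na by real_asymp
  have 3: "\<forall>\<^sub>F X in at_top. 2 \<le> norm a * sinh X"
    unfolding sinh_field_def using na by real_asymp
  have 4: "\<forall>\<^sub>F X in at_top. 18 * (norm a * exp (X + 7)) powr (t - 2) < exp (-14)"
  proof (rule order_tendstoD)
    have "filterlim (\<lambda>X::real. norm a * exp (X + 7)) at_top at_top"
      using na by real_asymp
    then have "((\<lambda>X::real. (norm a * exp (X + 7)) powr (t - 2)) \<longlongrightarrow> 0) at_top"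
      by (rule tendsto_neg_powr[rotated]) (use t in simp)
    then show "((\<lambda>X::real. 18 * (norm a * exp (X + 7)) powr (t - 2)) \<longlongrightarrow> 18 * 0) at_top"
      by (intro tendsto_mult tendsto_const)
  qed simp
  obtain X where X: "0 \<le> X" "2 \<le> norm a * exp X" "X + norm b \<le> norm a * exp X" "2 \<le> norm a * sinh X"
    "18 * (norm a * exp (X + 7)) powr (t - 2) < exp (-14)"
    using eventually_happens'[OF trivial_limit_at_top_linorder
        eventually_conj[OF eventually_ge_at_top[of 0] eventually_conj[OF 1 eventually_conj[OF 2 eventually_conj[OF 3 4]]]]]
    by blast
  define p :: "int \<times> int" where "p = (0, \<lceil>X\<rceil>)"
  have p: "p \<in> good X" using X(1) unfolding p_def good_def mem_Collect_eq snd_conv by linarith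
  define E where "E = (\<Inter>n. grid_level G (good X) n p)"
  define K where "K = (\<lambda>\<zeta>. (\<zeta> - b) / a) ` E"
  have compE: "compact E"
    unfolding E_def by (rule compact_Inter) (auto intro: compact_grid_level[OF continuous_on_G])
  then have compK: "compact K"
    unfolding K_def using a_nonzero by (intro compact_continuous_image continuous_intros) auto
  have "K \<subseteq> julia_set F"
  proof
    fix z assume "z \<in> K"
    then obtain \<zeta> where \<zeta>: "\<zeta> \<in> E" "z = (\<zeta> - b) / a" by (auto simp: K_def)
    then have z: "\<zeta> = a * z + b" using a_nonzero by simp
    show "z \<in> julia_set F"
    proof (rule julia_setI_growth)
      fix n
      have "\<zeta> \<in> grid_level G (good X) n p" using \<zeta>(1) by (auto simp: E_def)
      then obtain p' where "p' \<in> good X" "(G ^^ n) \<zeta> \<in> grid_square p'"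
        using grid_level_orbit[OF _ p order_refl] by blast
      then have Im: "X \<le> Im (a * (F ^^ n) z + b)"
        by (auto simp: z G_semiconj mem_grid_square good_def)
      have "2 \<le> norm a * sinh X" by (rule X(4))
      also have "\<dots> \<le> norm a * sinh (Im (a * (F ^^ n) z + b))" using Im by (intro mult_left_mono) auto
      also have "\<dots> \<le> norm a * norm (deriv C (a * (F ^^ n) z + b))"
        using deriv_C_ge[of "a * (F ^^ n) z + b"] Im X(1) by (intro mult_left_mono) (linarith, simp)
      finally show "2 \<le> norm (deriv F ((F ^^ n) z))" by (simp add: deriv_F norm_mult mult.commute)
    qed
  qed
  then have nullK: "hausdorff_content t 1 K = 0"
    using hausdorff_content_mono[of K "julia_set F" t 1] null by simp
  \<comment> \<open>Passing to the coordinate of \<open>G\<close> multiplies diameters by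
    \<open>norm a\<close>, so the bound \<open>exp (-14) / 180\<close> is divided by
    \<open>norm a powr t\<close>.\<close>
  define \<eta> where "\<eta> = exp (-14) / 180 / norm a powr t"
  have \<eta>: "0 < \<eta>" using na by (simp add: \<eta>_def)
  have t0: "0 < t" using t by simp
  obtain V :: "nat \<Rightarrow> complex set" and I where V: "finite I" "K \<subseteq> (\<Union>i\<in>I. V i)"
    "\<And>i. bounded (V i)" "\<And>i. open (V i)" "(\<Sum>i\<in>I. diameter (V i) powr t) < \<eta>"
    by (rule compact_null_content_finite_cover[OF compK nullK t0 \<eta>]) (rule that)
  define U where "U i = {\<zeta>. (\<zeta> - b) / a \<in> V i}" for i
  have openU: "open (U i)" for i
  proof -
    have "continuous_on UNIV (\<lambda>\<zeta>. (\<zeta> - b) / a)" using a_nonzero by (intro continuous_intros) auto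
    then have "open ((\<lambda>\<zeta>. (\<zeta> - b) / a) -` V i)" by (rule open_vimage[OF V(4)])
    then show ?thesis by (simp add: U_def vimage_def)
  qed
  have EU: "E \<subseteq> (\<Union>i\<in>I. U i)" using V(2) by (auto simp: K_def U_def)
  have "\<exists>n. grid_level G (good X) n p \<subseteq> (\<Union>i\<in>I. U i)"
  proof (rule ccontr)
    assume neg: "\<not> ?thesis"
    define S' where "S' n = grid_level G (good X) n p - (\<Union>i\<in>I. U i)" for n
    have "\<Inter>(range S') \<noteq> {}"
    proof (rule compact_nest)
      show "compact (S' n)" for n
        unfolding S'_def using compact_grid_level[OF continuous_on_G] openU by (intro compact_diff) auto
      show "S' n \<noteq> {}" for n using neg by (auto simp: S'_def)
      show "S' n \<subseteq> S' m" if "m \<le> n" for m n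
      proof -
        have "grid_level G (good X) n p \<subseteq> grid_level G (good X) m p"
          using lift_Suc_antimono_le[of "\<lambda>n. grid_level G (good X) n p", OF grid_level_decreasing that] .
        then show ?thesis by (auto simp: S'_def)
      qed
    qed
    then show False using EU by (auto simp: S'_def E_def)
  qed
  then obtain n where n: "grid_level G (good X) n p \<subseteq> (\<Union>i\<in>I. U i)" by blast
  have "exp (-14) / 180 \<le> (\<Sum>i\<in>I. diameter (U i \<inter> grid_square p) powr t)"
  proof (rule grid_level_cover_sum_ge[of G t "exp (-14)" "good X" lip, OF continuous_on_G _ _ _ _ _ _ _ _ V(1) p n])
    have "exp (-14) \<le> (1::real)" by simp
    then show "exp (-14) \<le> (180::real)" by linarith
    show "0 < lip p" for p using na by (simp add: lip_def)
    show "dist (G x) (G y) \<le> lip p * dist x y" if "p \<in> good X" "x \<in> grid_square p" "y \<in> grid_square p" for p x y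
      by (rule G_lipschitz[OF that(1) X(1) that(2,3)])
    show "exp (-14) * (lip p)\<^sup>2 \<le> real (card (grid_children G (good X) p))" if "p \<in> good X" for p
      by (rule many_children[OF that X(1-3)])
    show "18 * lip p powr (t - 2) \<le> exp (-14)" if "p \<in> good X" for p
    proof -
      have "norm a * exp (X + 7) \<le> lip p" using that by (simp add: lip_def good_def mult_left_mono)
      then have "lip p powr (t - 2) \<le> (norm a * exp (X + 7)) powr (t - 2)"
        using na t by (intro powr_mono2') auto
      then show ?thesis using X(5) by linarith
    qed
  qed (use t in auto)
  also have "\<dots> \<le> (\<Sum>i\<in>I. norm a powr t * diameter (V i) powr t)"
  proof (rule sum_mono)
    fix i assume "i \<in> I"
    have "bounded (U i \<inter> grid_square p)"
      using compact_grid_square by (meson bounded_Int compact_imp_bounded)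
    then have "0 \<le> diameter (U i \<inter> grid_square p)" by (rule diameter_ge_0)
    moreover have "diameter (U i \<inter> grid_square p) \<le> norm a * diameter (V i)"
    proof (rule diameter_le)
      show "U i \<inter> grid_square p \<noteq> {} \<or> 0 \<le> norm a * diameter (V i)"
        using diameter_ge_0[OF V(3)] by simp
      fix x y assume xy: "x \<in> U i \<inter> grid_square p" "y \<in> U i \<inter> grid_square p"
      have "x - y = a * ((x - b) / a - (y - b) / a)" using a_nonzero by (simp add: field_simps)
      then have "norm (x - y) = norm a * dist ((x - b) / a) ((y - b) / a)"
        by (metis dist_norm norm_mult)
      also have "\<dots> \<le> norm a * diameter (V i)"
        using xy by (intro mult_left_mono diameter_bounded_bound[OF V(3)]) (auto simp: U_def)
      finally show "norm (x - y) \<le> norm a * diameter (V i)" .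
    qed
    ultimately have "diameter (U i \<inter> grid_square p) powr t \<le> (norm a * diameter (V i)) powr t"
      using t by (intro powr_mono2) auto
    also have "\<dots> = norm a powr t * diameter (V i) powr t" by (rule powr_mult)
    finally show "diameter (U i \<inter> grid_square p) powr t \<le> norm a powr t * diameter (V i) powr t" .
  qed
  also have "\<dots> = norm a powr t * (\<Sum>i\<in>I. diameter (V i) powr t)" by (simp add: sum_distrib_left)
  also have "\<dots> < norm a powr t * \<eta>" using V(5) na by (intro mult_strict_left_mono) auto
  also have "\<dots> = exp (-14) / 180" using na by (simp add: \<eta>_def)
  finally show False by simp
qed

lemma HD_julia_set_ge_2: "2 \<le> HD (julia_set F)"
  using HD_ge[of 1 2 "julia_set F"] hausdorff_content_julia_pos by simp

section \<open>Sums over preimages and the comparison of dimensions\<close>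

lemma preimage_sum_bound:
  obtains M where "0 \<le> M" "\<And>w. countable {z. F z = w}"
    "\<And>w. (\<integral>\<^sup>+z. ennreal ((1 / (1 + norm z)) powr (3/2)) \<partial>count_space {z. F z = w}) \<le> ennreal M"
proof -
  define B where "B = 1 + norm a + norm b"
  have B: "0 < B" unfolding B_def by (intro add_pos_nonneg) auto
  define u where "u n = (2 * B) powr (3/2) * (1 + real n) powr (-3/2)" for n
  have "summable (\<lambda>n. real n powr (-3/2))" by (simp add: summable_real_powr_iff)
  then have "summable (\<lambda>n. real (Suc n) powr (-3/2))" by (subst summable_Suc_iff)
  then have us: "summable u" unfolding u_def by (intro summable_mult) (simp add: add.commute)
  have u0: "0 \<le> u n" for n by (simp add: u_def)
  have main: "countable {z. F z = w} \<and>
     (\<forall>T. finite T \<longrightarrow> T \<subseteq> {z. F z = w} \<longrightarrow> (\<Sum>z\<in>T. (1 / (1 + norm z)) powr (3/2)) \<le> 4 * suminf u)" for w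
  proof -
    obtain \<zeta>0 \<zeta>1 where \<zeta>: "Re \<zeta>0 \<in> {0..2*pi}" "Re \<zeta>1 \<in> {0..2*pi}"
       "\<And>\<zeta>. C \<zeta> = w \<Longrightarrow> (\<exists>k::int. \<zeta> = \<zeta>0 + of_real (2 * pi * of_int k) \<or> \<zeta> = \<zeta>1 + of_real (2 * pi * of_int k))"
      using preimages[of w] by blast
    \<comment> \<open>An index holds the modulus and the sign of the integer shift and the choice of
      the progression. The shift 0 is counted twice, which is harmless for an upper bound; the two
      Booleans account for the factor 4 below.\<close>
    define h where "h = (\<lambda>(n::nat, s::bool, j::bool).
      ((if j then \<zeta>0 else \<zeta>1) + of_real (2 * pi * of_int (if s then int n else - int n)) - b) / a)"
    have sub: "{z. F z = w} \<subseteq> range h"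
    proof
      fix z assume "z \<in> {z. F z = w}"
      then have "C (a * z + b) = w" by (simp add: F_def)
      then obtain k :: int and j :: bool where k: "a * z + b = (if j then \<zeta>0 else \<zeta>1) + of_real (2 * pi * of_int k)"
        using \<zeta>(3) by (metis (full_types))
      have "z = ((a * z + b) - b) / a" using a_nonzero by simp
      also have "\<dots> = h (nat \<bar>k\<bar>, 0 \<le> k, j)"
        unfolding k h_def by (cases "0 \<le> k") simp_all
      finally show "z \<in> range h" by blast
    qed
    have hb: "(1 / (1 + norm (h x))) powr (3/2) \<le> u (fst x)" for x
    proof -
      obtain n s j where x: "x = (n, s, j)" by (cases x) auto
      let ?i = "if s then int n else - int n"
      define Z where "Z = (if j then \<zeta>0 else \<zeta>1) + of_real (2 * pi * of_int ?i)"
      have "nat \<bar>?i\<bar> = n" by simp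
      moreover have "Re (if j then \<zeta>0 else \<zeta>1) \<in> {0..2*pi}" using \<zeta>(1,2) by simp
      ultimately have 1: "1 + real n \<le> 2 * (1 + norm Z)"
        using norm_ge_of_shift[of "if j then \<zeta>0 else \<zeta>1" Z ?i] Z_def by simp
      have "h x = (Z - b) / a" by (simp only: h_def x Z_def prod.case)
      then have "Z = a * h x + b" using a_nonzero by simp
      then have "norm Z \<le> norm a * norm (h x) + norm b"
        using norm_triangle_ineq[of "a * h x" b] by (simp add: norm_mult)
      moreover have "B * (1 + norm (h x)) = 1 + norm a * norm (h x) + norm b + (norm a + norm (h x) + norm b * norm (h x))"
        by (simp add: B_def algebra_simps)
      moreover have "0 \<le> norm a + norm (h x) + norm b * norm (h x)"
        by (intro add_nonneg_nonneg mult_nonneg_nonneg norm_ge_zero)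
      ultimately have "1 + norm Z \<le> B * (1 + norm (h x))" by linarith
      with 1 have 2: "1 + real n \<le> 2 * B * (1 + norm (h x))" by simp
      have p: "0 < 1 + norm (h x)" by (intro add_pos_nonneg) auto
      have "1 / (1 + norm (h x)) \<le> 2 * B / (1 + real n)"
        using 2 p by (simp add: field_simps)
      then have "(1 / (1 + norm (h x))) powr (3/2) \<le> (2 * B / (1 + real n)) powr (3/2)"
        using p by (intro powr_mono2) auto
      also have "\<dots> = u n" using B by (simp add: u_def powr_divide powr_minus_divide)
      finally show ?thesis by (simp add: x)
    qed
    have "countable (range h)" by simp
    then have "countable {z. F z = w}" using sub countable_subset by blast
    moreover have "(\<Sum>z\<in>T. (1 / (1 + norm z)) powr (3/2)) \<le> 4 * suminf u"
      if T: "finite T" "T \<subseteq> {z. F z = w}" for T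
    proof -
      have "T \<subseteq> h ` UNIV" using T(2) sub by blast
      then obtain X where X: "finite X" "T = h ` X"
        using finite_subset_image[OF T(1)] by metis
      obtain m where m: "fst ` X \<subseteq> {..<m}"
        using finite_nat_bounded[of "fst ` X"] X(1) by auto
      have "(\<Sum>z\<in>T. (1 / (1 + norm z)) powr (3/2)) \<le> (\<Sum>x\<in>X. (1 / (1 + norm (h x))) powr (3/2))"
        unfolding X(2) using sum_image_le[OF X(1), of "\<lambda>z. (1 / (1 + norm z)) powr (3/2)" h] by (simp add: comp_def)
      also have "\<dots> \<le> (\<Sum>x\<in>X. u (fst x))" by (rule sum_mono) (rule hb)
      also have "\<dots> \<le> (\<Sum>x\<in>{..<m} \<times> (UNIV :: (bool \<times> bool) set). u (fst x))"
        by (rule sum_mono2) (use m u0 in auto)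
      also have "\<dots> = (\<Sum>n<m. \<Sum>y\<in>(UNIV :: (bool \<times> bool) set). u n)"
        by (simp only: sum.cartesian_product case_prod_unfold)
      also have "\<dots> = 4 * (\<Sum>n<m. u n)"
        by (simp add: sum_distrib_left)
      also have "\<dots> \<le> 4 * suminf u"
        using sum_le_suminf[OF us, of "{..<m}"] u0 by simp
      finally show ?thesis .
    qed
    ultimately show ?thesis by blast
  qed
  show ?thesis
  proof (rule that[of "4 * suminf u"])
    show "0 \<le> 4 * suminf u" using suminf_nonneg[OF us u0] by simp
    fix w
    show "countable {z. F z = w}" using main by blast
    show "(\<integral>\<^sup>+z. ennreal ((1 / (1 + norm z)) powr (3/2)) \<partial>count_space {z. F z = w}) \<le> ennreal (4 * suminf u)"
    proof (rule nn_integral_count_space_le_finite_sums)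
      show "countable {z. F z = w}" using main by blast
      fix T assume "finite T" "T \<subseteq> {z. F z = w}"
      then have "(\<Sum>z\<in>T. (1 / (1 + norm z)) powr (3/2)) \<le> 4 * suminf u" using main by blast
      then show "(\<Sum>z\<in>T. ennreal ((1 / (1 + norm z)) powr (3/2))) \<le> ennreal (4 * suminf u)"
        by (subst sum_ennreal) (auto intro: ennreal_leI)
    qed
  qed
qed

lemma branch_F:
  assumes "ball w r \<inter> S = {}" "u \<in> ball w r" "F y = u"
  obtains \<psi> where "\<psi> holomorphic_on ball w r" "\<And>x. x \<in> ball w r \<Longrightarrow> F (\<psi> x) = x" "\<psi> u = y"
proof -
  obtain \<psi> where \<psi>: "\<psi> holomorphic_on ball w r" "\<And>x. x \<in> ball w r \<Longrightarrow> C (\<psi> x) = x" "\<psi> u = a * y + b"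
    using branch[OF assms(1,2), of "a * y + b"] assms(3) by (auto simp: F_def)
  show ?thesis
  proof (rule that[of "\<lambda>x. (\<psi> x - b) / a"])
    show "(\<lambda>x. (\<psi> x - b) / a) holomorphic_on ball w r"
      using \<psi>(1) a_nonzero by (intro holomorphic_intros) auto
  qed (use \<psi> a_nonzero in \<open>auto simp: F_def\<close>)
qed

lemma HD_radial_less:
  assumes hyp: "hyperbolic F"
  shows "HD (radial_julia_set F) < HD (julia_set F)"
proof -
  let ?J = "julia_set F"
  define d where "d = setdist ?J (postcritical_set F)"
  have d: "0 < d" using hyp by (simp add: hyperbolic_def topologically_hyperbolic_def d_def)
  have dist_S: "d \<le> dist w s" if "w \<in> ?J" "s \<in> S" for w s
  proof -
    have "s \<in> sing_inv F" using singular[OF a_nonzero, of b] that(2) by (auto simp: F_def[abs_def])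
    then have "s \<in> (\<Union>n. (F ^^ n) ` sing_inv F)" by (intro UN_I[of 0]) auto
    then have "s \<in> postcritical_set F" unfolding postcritical_set_def by (rule subsetD[OF closure_subset])
    then show ?thesis unfolding d_def using that(1) by (intro setdist_le_dist)
  qed
  \<comment> \<open>Discs of radius \<open>d / 2\<close> are used so that all their points keep the
    distance \<open>d / 2\<close> from the singular values.\<close>
  have half: "d / 2 \<le> dist u s" if "w \<in> ?J" "u \<in> ball w (d / 2)" "s \<in> S" for w u s
    using dist_S[OF that(1,3)] that(2) dist_triangle[of w s u] by simp
  have disj: "ball w (d / 2) \<inter> S = {}" if "w \<in> ?J" for w
  proof (rule ccontr)
    assume "ball w (d / 2) \<inter> S \<noteq> {}"
    then obtain u where "u \<in> ball w (d / 2)" "u \<in> S" by blast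
    with half[OF that this] d show False by simp
  qed
  obtain c l where cl: "0 < c" "1 < l" "\<And>n z. 1 \<le> n \<Longrightarrow> z \<in> ?J \<Longrightarrow> c * l ^ n \<le> norm (deriv (F ^^ n) z)"
  proof -
    have "expanding F" using hyp by (simp add: hyperbolic_def)
    then show ?thesis using that unfolding expanding_def by auto
  qed
  have d2: "0 < d / 2" using d by simp
  obtain k where k: "0 < k" "\<And>w. (\<And>s. s \<in> S \<Longrightarrow> d / 2 \<le> dist w s) \<Longrightarrow> k * (1 + norm w) \<le> Q w"
    using Q_low[OF d2] by blast
  obtain M where M: "0 \<le> M" "\<And>w. countable {z. F z = w}"
    "\<And>w. (\<integral>\<^sup>+z. ennreal ((1 / (1 + norm z)) powr (3/2)) \<partial>count_space {z. F z = w}) \<le> ennreal M"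
    by (rule preimage_sum_bound) (rule that)
  have na: "0 < norm a" using a_nonzero by simp
  have J_inv: "F z \<in> ?J \<longleftrightarrow> z \<in> ?J" for z
  proof
    assume Fz: "F z \<in> ?J"
    have cz: "F z \<in> ball (F z) (d / 2)" using d2 by simp
    obtain \<psi> where \<psi>: "\<psi> holomorphic_on ball (F z) (d / 2)" "\<And>x. x \<in> ball (F z) (d / 2) \<Longrightarrow> F (\<psi> x) = x" "\<psi> (F z) = z"
      by (rule branch_F[OF disj[OF Fz] cz refl]) (rule that)
    show "z \<in> ?J" by (rule julia_set_preimage[OF Fz _ \<psi>(1,3,2)]) (use d in simp)
  qed (rule julia_set_image[OF F_holo])
  obtain s where s: "s \<in> S" using S_nonempty by blast
  interpret T: transfer_operator F "\<lambda>w. norm a * Q w" ?J "min c 1" l "d / 2" "2 / d" "norm a * k" M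
  proof
    show "interior ?J = {}"
    proof (rule interior_julia_set_empty[OF F_holo d])
      \<comment> \<open>A singular value provides the disc of Fatou points that excludes interior
        points of the Julia set.\<close>
      show "ball s d \<inter> ?J = {}" using dist_S[OF _ s] by (force simp: dist_commute)
    qed
    show "0 < norm a * Q u" if "w \<in> ?J" "u \<in> ball w (d / 2)" for w u
    proof -
      have "0 < k * (1 + norm u)" using k(1) by (intro mult_pos_pos add_pos_nonneg) auto
      also have "\<dots> \<le> Q u" by (rule k(2)) (rule half[OF that])
      finally show ?thesis using na by simp
    qed
    show "norm a * Q w \<le> norm a * Q u * exp (2 / d * dist w u)" if "w \<in> ?J" "u \<in> ball w (d / 2)" for w u
    proof -
      have "Q w \<le> Q u * exp (dist u w / (d / 2))"
        by (rule Q_lip) (use d half[OF that] in auto)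
      then have "norm a * Q w \<le> norm a * (Q u * exp (dist u w / (d / 2)))" by (intro mult_left_mono) auto
      then show ?thesis by (simp add: dist_commute mult_ac)
    qed
    show "norm a * Q u \<le> norm a * Q w * exp (2 / d * dist w u)" if "w \<in> ?J" "u \<in> ball w (d / 2)" for w u
    proof -
      have "Q u \<le> Q w * exp (dist w u / (d / 2))"
        by (rule Q_lip) (use d half[OF that(1), of w] that in auto)
      then have "norm a * Q u \<le> norm a * (Q w * exp (dist w u / (d / 2)))" by (intro mult_left_mono) auto
      then show ?thesis by (simp add: mult_ac)
    qed
    show "\<exists>\<psi>. \<psi> holomorphic_on ball w (d / 2) \<and> (\<forall>x\<in>ball w (d / 2). F (\<psi> x) = x) \<and> \<psi> u = y"
      if "w \<in> ?J" "u \<in> ball w (d / 2)" "F y = u" for w u y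
      using branch_F[OF disj[OF that(1)] that(2,3)] by metis
    show "min c 1 * l ^ n \<le> norm (deriv (F ^^ n) z)" if z: "z \<in> ?J" for z n
    proof (cases n)
      case 0
      then show ?thesis by (simp add: id_def)
    next
      case (Suc m)
      have "min c 1 * l ^ n \<le> c * l ^ n" using cl(2) by (intro mult_right_mono) auto
      also have "\<dots> \<le> norm (deriv (F ^^ n) z)" using cl(3)[of n z] z Suc by simp
      finally show ?thesis .
    qed
    show "norm a * k * (1 + norm w) \<le> norm a * Q w" if w: "w \<in> ?J" for w
    proof -
      have "k * (1 + norm w) \<le> Q w"
        by (rule k(2)) (use half[OF w, of w] d in auto)
      then show ?thesis using mult_left_mono[of "k * (1 + norm w)" "Q w" "norm a"] by (simp add: mult.assoc)
    qed
  qed (use F_holo closed_julia_set J_inv norm_deriv_F cl d k na M in auto)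
  have "HD (radial_julia_set F) < 2"
    unfolding radial_julia_set_def by (rule T.HD_liminf_finite_less_2)
  also have "2 \<le> HD ?J" by (rule HD_julia_set_ge_2)
  finally show ?thesis .
qed

end

theorem corollary1p5:
  fixes f :: "complex \<Rightarrow> complex"
  assumes "f \<in> exponential_family \<union> sine_family"
    and "hyperbolic f"
  shows "HD (radial_julia_set f) < HD (julia_set f)"
  using assms(1)
proof
  assume "f \<in> exponential_family"
  then obtain l where l: "f = (\<lambda>z. l * exp z)" "l \<noteq> 0" by (auto simp: exponential_family_def)
  interpret E: exp_like_map "\<lambda>\<zeta>. exp (- \<i> * \<zeta>)" norm "{0}" \<i> "\<i> * Ln l"
    by unfold_locales simp
  have "E.F = f"
  proof
    fix z
    have "- \<i> * (\<i> * z + \<i> * Ln l) = z + Ln l" by (simp add: algebra_simps)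
    then have "E.F z = exp (z + Ln l)" by (simp only: E.F_def)
    then show "E.F z = f z" using l by (simp add: exp_add)
  qed
  then show ?thesis using E.HD_radial_less assms(2) by simp
next
  assume "f \<in> sine_family"
  then obtain a b where ab: "f = (\<lambda>z. sin (a * z + b))" "a \<noteq> 0" by (auto simp: sine_family_def)
  interpret E: exp_like_map cos "\<lambda>w. sqrt (norm (w - 1) * norm (w - (-1)))" "{1, -1}" a "b - of_real (pi / 2)"
    by unfold_locales (rule ab(2))
  have "E.F = f"
  proof
    fix z
    have "E.F z = cos ((a * z + b) - of_real (pi / 2))" by (simp only: E.F_def add_diff_eq)
    also have "\<dots> = f z" by (simp add: ab(1) cos_diff flip: cos_of_real sin_of_real)
    finally show "E.F z = f z" .
  qed
  then show ?thesis using E.HD_radial_less assms(2) by simp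
qed

end
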